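(* Let $m\ge0$, and let real values be prescribed for a function and for its normal derivatives at all points of $V_m$. Let $u$ be the unique minimizer of $\int_{SG}|\Delta u|^2\,d\mu$ among all functions in $\operatorname{dom}_{L^2}\Delta$ with the prescribed values and normal derivatives at all points of $V_m$. For real numbers $a_0,a_1,a_2,b_0,b_1,b_2$ put $d_i=2a_i-a_{i+1}-a_{i-1}-b_i$ (indices mod 3) and $$\Theta(a_i,b_i)=11\sum_{i}d_i^2-8\sum_{i<j}d_id_j .$$ Then $$\Theta(a_i,b_i)=90\sum_ia_i^2+30\sum_{i\ne j}a_ib_j+11\sum_ib_i^2-90\sum_{i<j}a_ia_j-60\sum_ia_ib_i-8\sum_{i<j}b_ib_j,$$ and $$\int_{SG}|\Delta u|^2\,d\mu=\left(\tfrac{25}{3}\right)^m\sum_{|w|=m}\Theta\Bigl(u(F_wq_i),\left(\tfrac35\right)^m\partial_nu(F_wq_i)\Bigr),$$ where in the term for $w$ the numbers $a_i,b_i$ are $u(F_wq_i)$ and $\left(\frac35\right)^m\partial_nu(F_wq_i)$, $i=0,1,2$, with the normal derivative taken with respect to the cell $F_wSG$.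
   Context: Let $q_0,q_1,q_2$ be the vertices of an equilateral triangle in the plane, $F_i(x)=\frac12(x+q_i)$, and let $SG$ (the Sierpinski gasket) be the unique nonempty compact set with $SG=\bigcup_{i}F_i(SG)$. For a word $w$ of length $|w|=m$ let $F_w=F_{w_1}\circ\cdots\circ F_{w_m}$. Put $V_0=\{q_0,q_1,q_2\}$, $V_m=\bigcup_iF_iV_{m-1}$; $x\sim_m y$ means $x\ne y$ and $x,y\in F_wV_0$ for some word $w$ of length $m$. The energy of a continuous $u:SG\to\mathbb{R}$ is $\mathcal{E}(u)=\lim_{m\to\infty}\left(\frac53\right)^m\sum_{\{x,y\}:x\sim_m y}(u(x)-u(y))^2$, $\operatorname{dom}\mathcal{E}$ is the set of continuous $u$ with $\mathcal{E}(u)<\infty$, and $\mathcal{E}(u,v)$ is the associated bilinear form. $\mu$ is the self-similar probability measure with $\mu(F_wSG)=3^{-|w|}$. $\operatorname{dom}_{L^2}\Delta$ is the set of $u\in\operatorname{dom}\mathcal{E}$ for which there is $f\in L^2(\mu)$ with $\mathcal{E}(u,v)=-\int fv\,d\mu$ for all $v\in\operatorname{dom}\mathcal{E}$ with $v|_{V_0}=0$; then $\Delta u:=f$. Normal derivatives: the normal derivative at $y=F_wq_i$, $|w|=m$, with respect to the cell $F_wSG$ is $\partial_nu(F_wq_i)=\lim_{k\to\infty}\left(\frac53\right)^{m+k}\bigl(2u(y)-u(F_wF_i^kq_{i+1})-u(F_wF_i^kq_{i-1})\bigr)$ (indices mod 3), which exists for $u\in\operatorname{dom}_{L^2}\Delta$.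 A point of $V_m\setminus V_0$ lies in two $m$-cells and the two normal derivatives there sum to $0$; prescribing the normal derivative at such a point means prescribing it with respect to one fixed choice of $m$-cell (and hence its negative for the other). *)

theory Defs
  imports "HOL-Probability.Probability_Measure"
begin

text \<open>Indices live in the numeral type \<^typ>\<open>3\<close>, whose arithmetic is modulo 3, so that
  \<open>i + 1\<close> and \<open>i - 1\<close> are the two other indices. A word is a list over this type.
  Functions on the gasket are total functions on the plane; everything below depends only on
  their values on the gasket.\<close>

definition equilateral :: "(3 \<Rightarrow> real ^ 2) \<Rightarrow> bool" where
  "equilateral q \<longleftrightarrow> (\<exists>s>0. \<forall>i j. i \<noteq> j \<longrightarrow> dist (q i) (q j) = s)"

definition sgF :: "(3 \<Rightarrow> real ^ 2) \<Rightarrow> 3 \<Rightarrow> real ^ 2 \<Rightarrow> real ^ 2" where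
  "sgF q i x = (1 / 2) *\<^sub>R (x + q i)"

primrec sgFw :: "(3 \<Rightarrow> real ^ 2) \<Rightarrow> 3 list \<Rightarrow> real ^ 2 \<Rightarrow> real ^ 2" where
  "sgFw q [] = id"
| "sgFw q (i # w) = sgF q i \<circ> sgFw q w"

definition SG :: "(3 \<Rightarrow> real ^ 2) \<Rightarrow> (real ^ 2) set" where
  "SG q = (THE K. K \<noteq> {} \<and> compact K \<and> K = (\<Union>i. sgF q i ` K))"

primrec sgV :: "(3 \<Rightarrow> real ^ 2) \<Rightarrow> nat \<Rightarrow> (real ^ 2) set" where
  "sgV q 0 = range q"
| "sgV q (Suc m) = (\<Union>i. sgF q i ` sgV q m)"

definition sg_adj :: "(3 \<Rightarrow> real ^ 2) \<Rightarrow> nat \<Rightarrow> real ^ 2 \<Rightarrow> real ^ 2 \<Rightarrow> bool" where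
  "sg_adj q m x y \<longleftrightarrow>
     x \<noteq> y \<and> (\<exists>w. length w = m \<and> x \<in> sgFw q w ` sgV q 0 \<and> y \<in> sgFw q w ` sgV q 0)"

text \<open>The factor 1/2 below turns the sum over ordered pairs into the sum over unordered pairs.\<close>

definition graph_energy :: "(3 \<Rightarrow> real ^ 2) \<Rightarrow> nat \<Rightarrow> (real ^ 2 \<Rightarrow> real) \<Rightarrow> real" where
  "graph_energy q m u =
     (5 / 3) ^ m * ((1 / 2) * (\<Sum>(x, y)\<in>{(x, y). sg_adj q m x y}. (u x - u y)\<^sup>2))"

definition energy :: "(3 \<Rightarrow> real ^ 2) \<Rightarrow> (real ^ 2 \<Rightarrow> real) \<Rightarrow> ereal" where
  "energy q u = lim (\<lambda>m. ereal (graph_energy q m u))"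

definition dom_energy :: "(3 \<Rightarrow> real ^ 2) \<Rightarrow> (real ^ 2 \<Rightarrow> real) set" where
  "dom_energy q = {u. continuous_on (SG q) u \<and> energy q u < \<infinity>}"

text \<open>The bilinear form associated with the energy, by polarization.\<close>

definition energy_form ::
    "(3 \<Rightarrow> real ^ 2) \<Rightarrow> (real ^ 2 \<Rightarrow> real) \<Rightarrow> (real ^ 2 \<Rightarrow> real) \<Rightarrow> real" where
  "energy_form q u v =
     (real_of_ereal (energy q (\<lambda>x. u x + v x)) - real_of_ereal (energy q (\<lambda>x. u x - v x))) / 4"

text \<open>A Borel probability measure whose underlying space is the gasket itself.\<close>

definition self_similar_measure :: "(3 \<Rightarrow> real ^ 2) \<Rightarrow> (real ^ 2) measure \<Rightarrow> bool" where
  "self_similar_measure q \<mu> \<longleftrightarrow>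
     prob_space \<mu> \<and> sets \<mu> = sets (restrict_space borel (SG q)) \<and>
     (\<forall>A\<in>sets \<mu>. measure \<mu> A = (\<Sum>i\<in>UNIV. (1 / 3) * measure \<mu> {x \<in> SG q. sgF q i x \<in> A})) \<and>
     (\<forall>w. measure \<mu> (sgFw q w ` SG q) = (1 / 3) ^ length w)"

definition L2_fun :: "'a measure \<Rightarrow> ('a \<Rightarrow> real) set" where
  "L2_fun M = {f \<in> borel_measurable M. integrable M (\<lambda>x. (f x)\<^sup>2)}"

definition has_laplacian ::
    "(3 \<Rightarrow> real ^ 2) \<Rightarrow> (real ^ 2) measure \<Rightarrow> (real ^ 2 \<Rightarrow> real) \<Rightarrow> (real ^ 2 \<Rightarrow> real) \<Rightarrow> bool" where
  "has_laplacian q \<mu> u f \<longleftrightarrow>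
     u \<in> dom_energy q \<and> f \<in> L2_fun \<mu> \<and>
     (\<forall>v\<in>dom_energy q. (\<forall>x\<in>sgV q 0. v x = 0) \<longrightarrow>
        energy_form q u v = - (\<integral>x. f x * v x \<partial>\<mu>))"

definition dom_L2_laplacian ::
    "(3 \<Rightarrow> real ^ 2) \<Rightarrow> (real ^ 2) measure \<Rightarrow> (real ^ 2 \<Rightarrow> real) set" where
  "dom_L2_laplacian q \<mu> = {u. \<exists>f. has_laplacian q \<mu> u f}"

text \<open>The Laplacian is an element of L2, determined almost everywhere; we choose a
  representative.\<close>

definition laplacian ::
    "(3 \<Rightarrow> real ^ 2) \<Rightarrow> (real ^ 2) measure \<Rightarrow> (real ^ 2 \<Rightarrow> real) \<Rightarrow> real ^ 2 \<Rightarrow> real" where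
  "laplacian q \<mu> u = (SOME f. has_laplacian q \<mu> u f)"

text \<open>\<open>normal_deriv q u w i\<close> is the normal derivative at the point \<open>sgFw q w (q i)\<close> with respect
  to the cell \<open>sgFw q w ` SG q\<close>.\<close>

definition normal_deriv ::
    "(3 \<Rightarrow> real ^ 2) \<Rightarrow> (real ^ 2 \<Rightarrow> real) \<Rightarrow> 3 list \<Rightarrow> 3 \<Rightarrow> real" where
  "normal_deriv q u w i =
     lim (\<lambda>k. (5 / 3) ^ (length w + k) *
       (2 * u (sgFw q w (q i))
        - u (sgFw q w ((sgF q i ^^ k) (q (i + 1))))
        - u (sgFw q w ((sgF q i ^^ k) (q (i - 1))))))"

text \<open>A choice, for every point of \<open>sgV q m\<close>, of an m-cell containing it: \<open>c x = (w, i)\<close> names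
  the cell of the word \<open>w\<close> and the index \<open>i\<close> of the corner of that cell at which \<open>x\<close> lies.\<close>

definition cell_choice :: "(3 \<Rightarrow> real ^ 2) \<Rightarrow> nat \<Rightarrow> (real ^ 2 \<Rightarrow> 3 list \<times> 3) \<Rightarrow> bool" where
  "cell_choice q m c \<longleftrightarrow>
     (\<forall>x\<in>sgV q m. length (fst (c x)) = m \<and> sgFw q (fst (c x)) (q (snd (c x))) = x)"

definition interpolants ::
    "(3 \<Rightarrow> real ^ 2) \<Rightarrow> (real ^ 2) measure \<Rightarrow> nat \<Rightarrow> (real ^ 2 \<Rightarrow> 3 list \<times> 3) \<Rightarrow>
     (real ^ 2 \<Rightarrow> real) \<Rightarrow> (real ^ 2 \<Rightarrow> real) \<Rightarrow> (real ^ 2 \<Rightarrow> real) set" where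
  "interpolants q \<mu> m c \<alpha> \<beta> =
     {u \<in> dom_L2_laplacian q \<mu>.
        \<forall>x\<in>sgV q m. u x = \<alpha> x \<and> normal_deriv q u (fst (c x)) (snd (c x)) = \<beta> x}"

definition laplacian_energy ::
    "(3 \<Rightarrow> real ^ 2) \<Rightarrow> (real ^ 2) measure \<Rightarrow> (real ^ 2 \<Rightarrow> real) \<Rightarrow> real" where
  "laplacian_energy q \<mu> u = (\<integral>x. \<bar>laplacian q \<mu> u x\<bar>\<^sup>2 \<partial>\<mu>)"

definition is_minimizer ::
    "(3 \<Rightarrow> real ^ 2) \<Rightarrow> (real ^ 2) measure \<Rightarrow> nat \<Rightarrow> (real ^ 2 \<Rightarrow> 3 list \<times> 3) \<Rightarrow>
     (real ^ 2 \<Rightarrow> real) \<Rightarrow> (real ^ 2 \<Rightarrow> real) \<Rightarrow> (real ^ 2 \<Rightarrow> real) \<Rightarrow> bool" where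
  "is_minimizer q \<mu> m c \<alpha> \<beta> u \<longleftrightarrow>
     u \<in> interpolants q \<mu> m c \<alpha> \<beta> \<and>
     (\<forall>v\<in>interpolants q \<mu> m c \<alpha> \<beta>. laplacian_energy q \<mu> u \<le> laplacian_energy q \<mu> v)"

definition Theta :: "(3 \<Rightarrow> real) \<Rightarrow> (3 \<Rightarrow> real) \<Rightarrow> real" where
  "Theta a b =
     (let d = (\<lambda>i. 2 * a i - a (i + 1) - a (i - 1) - b i)
      in 11 * (\<Sum>i\<in>UNIV. (d i)\<^sup>2) - 8 * (\<Sum>(i, j)\<in>{(i, j). i < j}. d i * d j))"

end

theory Submission
  imports Defs
begin

text \<open>The minimizer is the function whose Laplacian is harmonic on every cell of level \<open>m\<close>: if \<open>z\<close>
  has vanishing values and normal derivatives at the corners of a cell, then by the Gauss-Green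
  formula its Laplacian is orthogonal to the harmonic functions on that cell, so any other
  interpolant has a larger energy by Pythagoras.

  On a cell, a biharmonic function is determined by its corner values \<open>a\<close> and the corner values
  \<open>f\<close> of its Laplacian. Its normal derivatives are \<open>b = D a + M f\<close>, where \<open>(D a) i = 2 a i - a (i + 1) -
  a (i - 1)\<close> and \<open>M\<close> is the Gram matrix of the harmonic functions with corner values 0 and 1. Hence \<open>f\<close>
  can be chosen to match given \<open>a\<close> and \<open>b\<close>, and its squared norm is \<open>f \<bullet> M f = d \<bullet> M\<^sup>-\<^sup>1 d\<close> with
  \<open>d = D a - b\<close>. Since \<open>M\<^sup>-\<^sup>1 = 15 I - 4 J\<close> with \<open>J\<close> the all-one matrix, this is \<open>Theta a b\<close>; the
  powers of \<open>m\<close> come from rescaling.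

  Biharmonic functions are constructed from their values on the vertices, which satisfy a linear
  self-similar recursion that contracts oscillations.\<close>

text \<open>The Laplacian is defined weakly and is only an L2 function, so pointwise arguments and a
  Green function are not at hand. Three devices replace them. (1) The pairs \<open>(a, f)\<close>
  are subdivided so that the fluxes at new midpoints cancel. This makes a discrete Gauss-Green
  identity exact on every level, with a quadrature rule in place of the integral of
  \<open>harm f\<close> against \<open>v\<close>; only the quadrature has to converge. (2) The
  boundary terms of Gauss-Green are first defined as the defect of the weak equation on harmonic
  functions; splines concentrating at a corner then show that the difference quotients converge to
  this defect. (3) \<open>laplacian\<close> is a chosen representative, so uniqueness almost
  everywhere is needed. Constants may be tested on every cell, hence a Laplacian of zero has mean
  zero on each cell, is orthogonal to continuous functions and integrates to zero over Borel sets.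
  In matrix form \<open>M = (3 I + 4 J) / 45\<close>; with \<open>J J = 3 J\<close> this gives the
  stated inverse.\<close>

lemma UNIV_3_eq: "(UNIV :: 3 set) = {0, 1, 2}"
proof -
  have "(3 :: 3) = 0" by simp
  then show ?thesis using exhaust_3 by fastforce
qed

lemma sum_3_eq: "(\<Sum>i\<in>(UNIV :: 3 set). f i) = f 0 + f 1 + (f 2 :: 'a :: comm_monoid_add)"
  unfolding UNIV_3_eq by (simp add: ac_simps)

lemma cases_3: obtains "i = (0 :: 3)" | "i = 1" | "i = 2"
  using UNIV_3_eq by blast

lemma neg_3_eq: "- (1 :: 3) = 2" "- (2 :: 3) = 1" "(0 :: 3) - 1 = 2" "(2 :: 3) + 1 = 0" "(1 :: 3) + 1 = 2"
  "(1 :: 3) - 1 = 0" "(2 :: 3) - 1 = 1" "(1 :: 3) + 2 = 0" "(3 :: 3) = 0" "(2 :: 3) + 2 = 1"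
  by simp_all

lemma less_3_pairs: "{(i, j). i < (j :: 3)} = {(0, 1), (0, 2), (1, 2)}"
proof -
  have "(0 :: 3) < 1" "(0 :: 3) < 2" "(1 :: 3) < 2"
    by (simp_all add: less_bit1_def bit1.Rep_0 bit1.Rep_1 bit1.Rep_numeral)
  moreover from this have "\<not> (1 :: 3) < 0" "\<not> (2 :: 3) < 0" "\<not> (2 :: 3) < 1" by auto
  ultimately show ?thesis by (auto elim: cases_3) (metis cases_3 less_irrefl)+
qed

text \<open>The square of the sum of the \<open>d i\<close> contributes -4 to each square and -8 to
  each mixed product, so 15 - 4 gives the coefficient 11. In this form \<open>Theta\<close> is
  visibly the quadratic form of \<open>15 I - 4 J\<close> at \<open>d\<close>.\<close>

lemma Theta_eq: "Theta a b = 15 * (\<Sum>i\<in>UNIV. (3 * a i - (\<Sum>k\<in>UNIV. a k) - b i)\<^sup>2)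
    - 4 * (\<Sum>i\<in>UNIV. 3 * a i - (\<Sum>k\<in>UNIV. a k) - b i)\<^sup>2"
  unfolding Theta_def Let_def less_3_pairs
  by (simp add: sum_3_eq neg_3_eq power2_eq_square algebra_simps)

lemma Theta_expand:
  "Theta a b = 90 * (\<Sum>i\<in>UNIV. (a i)\<^sup>2) + 30 * (\<Sum>(i, j)\<in>{(i, j). i \<noteq> j}. a i * b j)
    + 11 * (\<Sum>i\<in>UNIV. (b i)\<^sup>2) - 90 * (\<Sum>(i, j)\<in>{(i, j). i < j}. a i * a j)
    - 60 * (\<Sum>i\<in>UNIV. a i * b i) - 8 * (\<Sum>(i, j)\<in>{(i, j). i < j}. b i * b j)"
proof -
  have ne: "{(i, j :: 3). i \<noteq> j} = {(0, 1), (1, 0), (0, 2), (2, 0), (1, 2), (2, 1)}"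
    using UNIV_3_eq by (auto elim: cases_3) (metis cases_3)+
  show ?thesis unfolding Theta_eq less_3_pairs ne
    by (simp add: sum_3_eq power2_eq_square algebra_simps)
qed

subsection \<open>The gasket\<close>

locale gasket =
  fixes q :: "3 \<Rightarrow> real ^ 2"
  assumes equilateral: "equilateral q"
begin

abbreviation K :: "(real ^ 2) set" where "K \<equiv> SG q"
abbreviation F :: "3 \<Rightarrow> real ^ 2 \<Rightarrow> real ^ 2" where "F \<equiv> sgF q"
abbreviation Fw :: "3 list \<Rightarrow> real ^ 2 \<Rightarrow> real ^ 2" where "Fw \<equiv> sgFw q"

section \<open>Barycentric coordinates of the triangle\<close>

definition side :: real where "side = dist (q 0) (q 1)"

text \<open>Three times the vector from the centroid to \<open>q i\<close>; it is orthogonal to the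
  opposite side.\<close>

definition outer :: "3 \<Rightarrow> real ^ 2" where "outer i = 2 *\<^sub>R q i - q (i + 1) - q (i - 1)"

text \<open>The barycentric coordinate belonging to \<open>q i\<close>, written as an inner product
  so that affinity and continuity are immediate. The factor normalises: for the other corners
  \<open>(q j - q i) \<bullet> outer i\<close> is \<open>- (3 / 2) * side\<^sup>2\<close>.\<close>

definition bary :: "3 \<Rightarrow> real ^ 2 \<Rightarrow> real" where
  "bary i x = 1 + 2 / (3 * side\<^sup>2) * ((x - q i) \<bullet> outer i)"

lemma side_pos: "side > 0" and dist_q: "i \<noteq> j \<Longrightarrow> dist (q i) (q j) = side"
proof -
  obtain s where s: "s > 0" "\<And>i j. i \<noteq> j \<Longrightarrow> dist (q i) (q j) = s"
    using equilateral unfolding equilateral_def by blast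
  have "side = s" unfolding side_def by (rule s(2)) simp
  then show "side > 0" "i \<noteq> j \<Longrightarrow> dist (q i) (q j) = side" using s by auto
qed

lemma inner_q: "i \<noteq> j \<Longrightarrow> q i \<bullet> q j = (q i \<bullet> q i + q j \<bullet> q j - side\<^sup>2) / 2"
proof -
  assume "i \<noteq> j"
  then have "(norm (q i - q j))\<^sup>2 = side\<^sup>2" using dist_q[of i j] by (simp add: dist_norm)
  then show ?thesis by (simp add: power2_norm_eq_inner inner_diff inner_commute)
qed

lemma inner_qs: "q 1 \<bullet> q 0 = (q 0 \<bullet> q 0 + q 1 \<bullet> q 1 - side\<^sup>2) / 2" "q 0 \<bullet> q 1 = (q 0 \<bullet> q 0 + q 1 \<bullet> q 1 - side\<^sup>2) / 2"
  "q 2 \<bullet> q 0 = (q 0 \<bullet> q 0 + q 2 \<bullet> q 2 - side\<^sup>2) / 2" "q 0 \<bullet> q 2 = (q 0 \<bullet> q 0 + q 2 \<bullet> q 2 - side\<^sup>2) / 2"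
  "q 1 \<bullet> q 2 = (q 1 \<bullet> q 1 + q 2 \<bullet> q 2 - side\<^sup>2) / 2" "q 2 \<bullet> q 1 = (q 1 \<bullet> q 1 + q 2 \<bullet> q 2 - side\<^sup>2) / 2"
  by (subst inner_q; simp)+

lemma outer_eqs: "outer 0 = 2 *\<^sub>R q 0 - q 1 - q 2" "outer 1 = 2 *\<^sub>R q 1 - q 2 - q 0"
  "outer 2 = 2 *\<^sub>R q 2 - q 0 - q 1"
  by (simp_all add: outer_def neg_3_eq)

lemma bary_q: "bary i (q j) = (if i = j then 1 else 0)"
proof (cases "i = j")
  case False
  have "(q j - q i) \<bullet> outer i = - (3 / 2) * side\<^sup>2"
    using False
    by (cases i rule: cases_3; cases j rule: cases_3)
       (simp_all add: outer_eqs inner_diff inner_add inner_qs field_simps)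
  then show ?thesis using False side_pos by (simp add: bary_def)
qed (simp add: bary_def)

lemma sum_bary: "(\<Sum>i\<in>UNIV. bary i x) = 1"
proof -
  have "(x - q 0) \<bullet> outer 0 + (x - q 1) \<bullet> outer 1 + (x - q 2) \<bullet> outer 2 = - 3 * side\<^sup>2"
    by (simp add: outer_eqs inner_diff inner_add inner_qs field_simps)
  moreover have "(\<Sum>i\<in>UNIV. bary i x) = 3 + 2 / (3 * side\<^sup>2) *
      ((x - q 0) \<bullet> outer 0 + (x - q 1) \<bullet> outer 1 + (x - q 2) \<bullet> outer 2)"
    by (simp only: sum_3_eq bary_def distrib_left)
  ultimately show ?thesis using side_pos by simp
qed

lemma bary_F: "bary i (F j x) = (bary i x + bary i (q j)) / 2"
proof -
  define c where "c = 2 / (3 * side\<^sup>2)"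
  have "(F j x - q i) \<bullet> outer i = ((x - q i) \<bullet> outer i + (q j - q i) \<bullet> outer i) / 2"
    by (simp add: sgF_def inner_diff inner_add)
  then show ?thesis unfolding bary_def c_def[symmetric] by (simp add: field_simps)
qed

lemma continuous_bary: "continuous_on S (bary i)"
  unfolding bary_def by (intro continuous_intros)

lemma bary_inj: assumes "\<And>i. bary i x = bary i y" shows "x = y"
proof -
  define z where "z = x - y"
  have z: "z \<bullet> outer i = 0" for i
  proof -
    have "2 / (3 * side\<^sup>2) * ((x - q i) \<bullet> outer i) = 2 / (3 * side\<^sup>2) * ((y - q i) \<bullet> outer i)"
      using assms[of i] unfolding bary_def by linarith
    then have "(x - q i) \<bullet> outer i = (y - q i) \<bullet> outer i" using side_pos by simp
    then show ?thesis by (simp add: z_def inner_diff)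
  qed
  define a b where "a = outer 0" and "b = outer 1"
  have n: "a \<bullet> a = 3 * side\<^sup>2" "b \<bullet> b = 3 * side\<^sup>2" "a \<bullet> b = - (3 / 2) * side\<^sup>2"
    by (simp_all add: a_def b_def outer_eqs inner_diff inner_add inner_qs field_simps)
  \<comment> \<open>Lagrange's identity: in the plane the Gram determinant is the square of the
    determinant. So \<open>outer 0\<close> and \<open>outer 1\<close> form a basis, and
    \<open>z\<close>, orthogonal to both, vanishes.\<close>
  have "(a $ 1 * b $ 2 - a $ 2 * b $ 1)\<^sup>2 = (a \<bullet> a) * (b \<bullet> b) - (a \<bullet> b)\<^sup>2"
    by (simp add: inner_vec_def UNIV_2 power2_eq_square algebra_simps)
  also have "\<dots> = 27 / 4 * (side\<^sup>2)\<^sup>2" unfolding n by (simp add: power2_eq_square)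
  also have "\<dots> > 0" using side_pos by simp
  finally have det: "a $ 1 * b $ 2 - a $ 2 * b $ 1 \<noteq> 0" by auto
  have e: "z $ 1 * a $ 1 + z $ 2 * a $ 2 = 0" "z $ 1 * b $ 1 + z $ 2 * b $ 2 = 0"
    using z[of 0] z[of 1] by (simp_all add: inner_vec_def UNIV_2 a_def b_def)
  have "z $ 1 * (a $ 1 * b $ 2 - a $ 2 * b $ 1) = 0" "z $ 2 * (a $ 1 * b $ 2 - a $ 2 * b $ 1) = 0"
    using e by algebra+
  then have "z $ 1 = 0" "z $ 2 = 0" using det by simp_all
  then have "z = 0" by (simp add: vec_eq_iff forall_2)
  then show ?thesis by (simp add: z_def)
qed

lemma F_inj: "F i x = F i y \<longleftrightarrow> x = y" by (simp add: sgF_def)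

lemma F_q: "F i (q i) = q i" by (simp add: sgF_def flip: scaleR_2)

lemma F_swap: "F i (q j) = F j (q i)" by (simp add: sgF_def add.commute)

lemma continuous_F: "continuous_on S (F i)"
  unfolding sgF_def by (intro continuous_intros)

lemma dist_F: "dist (F i x) (F i y) = dist x y / 2"
  by (simp add: sgF_def dist_norm flip: scaleR_diff_right)

section \<open>The gasket as the closure of its vertices\<close>

definition vertices :: "(real ^ 2) set" where "vertices = (\<Union>m. sgV q m)"

lemma sgV_Suc: "sgV q m \<subseteq> sgV q (Suc m)"
proof (induction m)
  case 0
  have "q i \<in> sgV q (Suc 0)" for i using F_q[of i] by (auto simp: image_iff intro!: exI[of _ i] bexI[of _ "q i"])
  then show ?case by auto
next
  case (Suc m)
  then show ?case by fastforce
qed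

lemma vertices_eq: "vertices = (\<Union>i. F i ` vertices)"
proof
  show "vertices \<subseteq> (\<Union>i. F i ` vertices)"
  proof
    fix x assume "x \<in> vertices"
    then obtain m where "x \<in> sgV q m" by (auto simp: vertices_def)
    then have "x \<in> sgV q (Suc m)" using sgV_Suc by blast
    then show "x \<in> (\<Union>i. F i ` vertices)" by (auto simp: vertices_def)
  qed
  show "(\<Union>i. F i ` vertices) \<subseteq> vertices"
  proof
    fix x assume "x \<in> (\<Union>i. F i ` vertices)"
    then obtain i m y where "y \<in> sgV q m" "x = F i y" by (auto simp: vertices_def)
    then have "x \<in> sgV q (Suc m)" by auto
    then show "x \<in> vertices" unfolding vertices_def by blast
  qed
qed

lemma bounded_vertices: "bounded vertices"
proof -
  define B where "B = Max (range (\<lambda>i. norm (q i)))"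
  have qB: "norm (q i) \<le> B" for i unfolding B_def by (rule Max_ge) auto
  have "norm x \<le> B" if "x \<in> sgV q m" for m x using that
  proof (induction m arbitrary: x)
    case (Suc m)
    then obtain i y where y: "y \<in> sgV q m" "x = F i y" by auto
    have "norm x \<le> (norm y + norm (q i)) / 2"
      unfolding y(2) sgF_def using norm_triangle_ineq[of y "q i"] by simp
    also have "\<dots> \<le> (B + B) / 2" using add_mono[OF Suc.IH[OF y(1)] qB[of i]] by simp
    finally show ?case by simp
  qed (use qB in auto)
  then show ?thesis unfolding bounded_iff vertices_def by blast
qed

text \<open>A point of \<open>K'\<close> farthest from \<open>L\<close> is some \<open>F i y\<close>
  with \<open>y\<close> in \<open>K'\<close>. Since \<open>F i\<close> maps \<open>L\<close> into
  itself and halves distances, the largest distance is at most half of itself.\<close>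

lemma self_similar_subset:
  assumes K': "K' \<noteq> {}" "compact K'" "K' = (\<Union>i. F i ` K')"
    and L: "L \<noteq> {}" "compact L" "L = (\<Union>i. F i ` L)"
  shows "K' \<subseteq> L"
proof -
  have "continuous_on K' (\<lambda>x. infdist x L)" by (intro continuous_intros)
  then obtain x where x: "x \<in> K'" "\<And>y. y \<in> K' \<Longrightarrow> infdist y L \<le> infdist x L"
    using continuous_attains_sup[OF K'(2,1)] by blast
  obtain i y where y: "y \<in> K'" "x = F i y" using x(1) K'(3) by blast
  obtain z where z: "z \<in> L" "infdist y L = dist y z"
    using infdist_attains_inf[OF compact_imp_closed[OF L(2)] L(1)] by blast
  have "F i z \<in> L" using z(1) L(3) by blast
  then have "infdist x L \<le> dist x (F i z)" by (rule infdist_le)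
  also have "\<dots> = infdist y L / 2" by (simp add: y(2) dist_F z(2))
  also have "\<dots> \<le> infdist x L / 2" using x(2)[OF y(1)] by simp
  finally have "infdist x L \<le> 0" by simp
  then have "infdist y L = 0" if "y \<in> K'" for y
    using x(2)[OF that] infdist_nonneg[of y L] by linarith
  then show ?thesis using in_closed_iff_infdist_zero[OF compact_imp_closed[OF L(2)] L(1)] by blast
qed

text \<open>The definite description in \<open>SG\<close> needs existence, supplied by
  \<open>closure vertices\<close>, and uniqueness, supplied by \<open>self_similar_subset\<close> in
  both directions.\<close>

lemma SG_eq_closure: "K = closure vertices"
  and SG_unfold: "K = (\<Union>i. F i ` K)"
  and compact_SG: "compact K"
proof -
  let ?C = "closure vertices"
  have c: "compact ?C" using bounded_vertices by (simp add: compact_closure)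
  have ne: "?C \<noteq> {}" using vertices_def by (auto intro!: exI[of _ 0])
  have sub1: "F i ` ?C \<subseteq> ?C" for i
  proof -
    have "F i ` closure vertices \<subseteq> closure (F i ` vertices)"
      by (rule image_closure_subset) (auto intro: continuous_F closure_subset[THEN subsetD])
    moreover have "F i ` vertices \<subseteq> vertices" using vertices_eq by blast
    ultimately show ?thesis using closure_mono by blast
  qed
  have sub2: "?C \<subseteq> (\<Union>i. F i ` ?C)"
  proof (rule closure_minimal)
    show "vertices \<subseteq> (\<Union>i. F i ` ?C)" using vertices_eq closure_subset[of vertices] by blast
    show "closed (\<Union>i. F i ` ?C)"
      by (intro closed_UN) (auto intro!: compact_imp_closed compact_continuous_image continuous_F c)
  qed
  have C: "?C \<noteq> {} \<and> compact ?C \<and> ?C = (\<Union>i. F i ` ?C)" using ne c sub1 sub2 by blast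
  have "K = ?C" unfolding SG_def
  proof (rule the_equality)
    show "?C \<noteq> {} \<and> compact ?C \<and> ?C = (\<Union>i. F i ` ?C)" by (rule C)
    show "L = ?C" if "L \<noteq> {} \<and> compact L \<and> L = (\<Union>i. F i ` L)" for L
      using that C self_similar_subset by (metis subset_antisym)
  qed
  then show "K = ?C" "K = (\<Union>i. F i ` K)" "compact K" using C by auto
qed

lemma closed_SG: "closed K" by (rule compact_imp_closed[OF compact_SG])

lemma F_in [simp]: "x \<in> K \<Longrightarrow> F i x \<in> K" using SG_unfold by blast

lemma Fw_in [simp]: "x \<in> K \<Longrightarrow> Fw w x \<in> K" by (induction w) auto

lemma sgV_in: "x \<in> sgV q m \<Longrightarrow> x \<in> K"
  unfolding SG_eq_closure using closure_subset[of vertices] by (auto simp: vertices_def)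

lemma q_in [simp]: "q i \<in> K" using sgV_in[of "q i" 0] by auto

lemma SG_cases: assumes "x \<in> K" obtains i y where "y \<in> K" "x = F i y"
  using assms SG_unfold by blast

text \<open>At a minimum point \<open>F j z\<close> the coordinate is at least half its value at
  \<open>z\<close>, hence at least half the minimum. So the minimum is at least half of itself and
  cannot be negative.\<close>

lemma bary_nonneg: assumes "x \<in> K" shows "bary i x \<ge> 0"
proof -
  obtain y where y: "y \<in> K" "\<And>z. z \<in> K \<Longrightarrow> bary i y \<le> bary i z"
    using continuous_attains_inf[OF compact_SG _ continuous_bary] assms by blast
  obtain j z where z: "z \<in> K" "y = F j z" using SG_cases[OF y(1)] .
  have "bary i y = (bary i z + bary i (q j)) / 2" by (simp add: z bary_F)
  then have "bary i y \<ge> bary i z / 2" by (simp add: bary_q split: if_splits)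
  then have "bary i y \<ge> 0" using y(2)[OF z(1)] by linarith
  then show ?thesis using y(2)[OF assms] by linarith
qed

lemma bary_le_1: assumes "x \<in> K" shows "bary i x \<le> 1"
proof -
  have "bary i x \<le> (\<Sum>j\<in>UNIV. bary j x)"
    by (rule member_le_sum) (auto intro: bary_nonneg assms)
  then show ?thesis by (simp add: sum_bary)
qed

lemma bary_eq_1: assumes "x \<in> K" "bary i x = 1" shows "x = q i"
proof (rule bary_inj)
  fix j
  have "bary j x = 0" if "j \<noteq> i"
  proof -
    have "(\<Sum>l\<in>UNIV. bary l x) = bary i x + (\<Sum>l\<in>UNIV - {i}. bary l x)"
      by (simp add: sum.remove)
    then have "(\<Sum>l\<in>UNIV - {i}. bary l x) = 0" using assms sum_bary by simp
    then show ?thesis using that bary_nonneg[OF assms(1)] by (subst (asm) sum_nonneg_eq_0_iff) auto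
  qed
  then show "bary j x = bary j (q i)" using assms by (auto simp: bary_q)
qed

lemma F_eq_cornerD: assumes "x \<in> K" "F i x = q j" shows "i = j \<and> x = q j"
proof -
  have "bary j (F i x) = 1" using assms by (simp add: bary_q)
  then have "bary j x + bary j (q i) = 2" by (simp add: bary_F)
  then have "bary j x = 1" "bary j (q i) = 1"
    using bary_le_1[OF assms(1), of j] bary_le_1[OF q_in, of j i] by linarith+
  then show ?thesis using bary_eq_1[OF assms(1)] by (auto simp: bary_q split: if_splits)
qed

text \<open>The coordinate \<open>bary i\<close> is at least 1/2 on the cell \<open>F i\<close>
  K\<open>and at most 1/2 on\<close>F j \<open>K\<close>. At a common point it equals 1/2, and this
  bound is attained only at the midpoint of \<open>q i\<close> and \<open>q j\<close>.\<close>

lemma F_meet: assumes "x \<in> K" "y \<in> K" "F i x = F j y" "i \<noteq> j" shows "x = q j \<and> y = q i"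
proof -
  have *: "b = q i" if "a \<in> K" "b \<in> K" "F i a = F j b" "i \<noteq> j" for a b i j
  proof -
    have "(bary i a + 1) / 2 = bary i b / 2"
      using arg_cong[OF that(3), of "bary i"] that(4) by (simp add: bary_F bary_q)
    then have "bary i b = 1" using bary_nonneg[OF that(1), of i] bary_le_1[OF that(2), of i] by simp
    then show ?thesis by (rule bary_eq_1[OF that(2)])
  qed
  show ?thesis using *[OF assms] *[OF assms(2,1) assms(3)[symmetric]] assms(4) by blast
qed

lemma q_inj: "q i = q j \<longleftrightarrow> i = j" using bary_q[of i i] bary_q[of i j] by (auto split: if_splits)

definition cell_of :: "real ^ 2 \<Rightarrow> 3" where
  "cell_of x = (if x \<in> F 0 ` K then 0 else if x \<in> F 1 ` K then 1 else 2)"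

text \<open>At a common point of two cells the first cell is used; the choice is immaterial exactly when
  \<open>g i (q j) = g j (q i)\<close>.\<close>

definition glue :: "(3 \<Rightarrow> real ^ 2 \<Rightarrow> real) \<Rightarrow> real ^ 2 \<Rightarrow> real" where
  "glue g x = g (cell_of x) (2 *\<^sub>R x - q (cell_of x))"

lemma F_inverse: "2 *\<^sub>R F i x - q i = x" by (simp add: sgF_def)

lemma cell_of: assumes "x \<in> K" shows "x \<in> F (cell_of x) ` K"
proof -
  have "x \<in> F 0 ` K \<or> x \<in> F 1 ` K \<or> x \<in> F 2 ` K"
    using assms SG_unfold unfolding UNIV_3_eq by blast
  then show ?thesis by (auto simp: cell_of_def)
qed

text \<open>Away from the corners of a cell the pieces need not match. This serves for gluing L2
  functions, whose corner values are arbitrary; the corners will be a null set.\<close>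

lemma glue_F_interior: assumes "x \<in> K" "x \<notin> range q" shows "glue g (F i x) = g i x"
proof -
  obtain y where y: "y \<in> K" "F i x = F (cell_of (F i x)) y" using cell_of[of "F i x"] assms by auto
  have "cell_of (F i x) = i"
  proof (rule ccontr)
    assume "cell_of (F i x) \<noteq> i"
    then show False using F_meet[OF assms(1) y] assms(2) by auto
  qed
  then show ?thesis by (simp add: glue_def F_inverse)
qed

lemma glue_F: assumes "\<And>i j. g i (q j) = g j (q i)" "x \<in> K" shows "glue g (F i x) = g i x"
proof -
  define j where "j = cell_of (F i x)"
  obtain y where y: "y \<in> K" "F i x = F j y" using cell_of[of "F i x"] assms by (auto simp: j_def)
  have "glue g (F i x) = g j y" unfolding glue_def j_def[symmetric] by (simp add: y(2) F_inverse)
  also have "\<dots> = g i x"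
  proof (cases "i = j")
    case True
    then show ?thesis using y by (simp add: F_inj)
  next
    case False
    then show ?thesis using F_meet[OF assms(2) y] assms(1) by simp
  qed
  finally show ?thesis .
qed

lemma continuous_on_SG_iff: "continuous_on K u \<longleftrightarrow> (\<forall>i. continuous_on K (\<lambda>x. u (F i x)))"
proof
  assume u: "continuous_on K u"
  show "\<forall>i. continuous_on K (\<lambda>x. u (F i x))"
    by (intro allI continuous_on_compose2[OF u continuous_F]) auto
next
  assume *: "\<forall>i. continuous_on K (\<lambda>x. u (F i x))"
  have "continuous_on (F i ` K) u" for i
  proof -
    have "continuous_on (F i ` K) (\<lambda>x. u (F i (2 *\<^sub>R x - q i)))"
      by (rule continuous_on_compose2[OF *[rule_format, of i]]) (auto intro!: continuous_intros simp: F_inverse)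
    then show ?thesis by (rule continuous_on_eq) (auto simp: F_inverse)
  qed
  then have "continuous_on (\<Union>i. F i ` K) u"
    by (intro continuous_on_closed_Union) (auto intro!: compact_imp_closed compact_continuous_image continuous_F compact_SG)
  then show "continuous_on K u" using SG_unfold by simp
qed

lemma continuous_glue:
  assumes "\<And>i j. g i (q j) = g j (q i)" "\<And>i. continuous_on K (g i)"
  shows "continuous_on K (glue g)"
proof (rule continuous_on_SG_iff[THEN iffD2], rule allI)
  fix i show "continuous_on K (\<lambda>x. glue g (F i x))"
    by (rule continuous_on_eq[OF assms(2)[of i]]) (simp add: glue_F[where g = g, OF assms(1)])
qed

section \<open>Words, addresses of vertices and density of the vertices\<close>

lemma Fw_append: "Fw (v @ w) x = Fw v (Fw w x)" by (induction v) auto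

lemma dist_Fw: "dist (Fw w x) (Fw w y) = dist x y / 2 ^ length w"
  by (induction w) (auto simp: dist_F)

lemma funpow_F: "(F i ^^ k) x = Fw (replicate k i) x" by (induction k) auto

lemma Fw_replicate_q: "Fw (replicate k i) (q i) = q i" by (induction k) (auto simp: F_q)

lemma Fw_eq_cornerD: assumes "x \<in> K" "Fw w x = q j" shows "w = replicate (length w) j \<and> x = q j"
  using assms(2)
proof (induction w)
  case (Cons i w)
  then have "i = j \<and> Fw w x = q j" using F_eq_cornerD[of "Fw w x" i j] assms(1) by auto
  then show ?case using Cons.IH by auto
qed auto

lemma words_Suc: "{w :: 3 list. length w = Suc m} = (\<Union>i. (#) i ` {w. length w = m})"
  by (auto simp: length_Suc_conv)

lemma finite_words: "finite {w :: 3 list. length w = m}"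
  using finite_lists_length_eq[of "UNIV :: 3 set" m] by simp

lemma sum_words_Suc:
  "(\<Sum>w\<in>{w :: 3 list. length w = Suc m}. f w) = (\<Sum>i\<in>UNIV. \<Sum>w\<in>{w. length w = m}. f (i # w))"
  unfolding words_Suc
  by (subst sum.UNION_disjoint) (auto simp: finite_words sum.reindex)

lemma sgV_eq: "sgV q m = {Fw w (q i) | w i. length w = m}"
proof (induction m)
  case (Suc m)
  have "(\<Union>i. F i ` {Fw w (q j) |w j. length w = m}) = {Fw w (q j) |w j. length w = Suc m}" (is "?L = ?R")
  proof
    show "?L \<subseteq> ?R"
    proof
      fix x assume "x \<in> ?L"
      then obtain i w j where "length w = m" "x = F i (Fw w (q j))" by blast
      then have "length (i # w) = Suc m" "x = Fw (i # w) (q j)" by auto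
      then show "x \<in> ?R" by blast
    qed
    show "?R \<subseteq> ?L"
    proof
      fix x assume "x \<in> ?R"
      then obtain i w j where "length w = m" "x = Fw (i # w) (q j)" by (auto simp: length_Suc_conv)
      then have "Fw w (q j) \<in> {Fw w (q j) |w j. length w = m}" "x = F i (Fw w (q j))" by auto
      then show "x \<in> ?L" by blast
    qed
  qed
  then show ?case unfolding sgV.simps Suc .
qed auto

lemma SG_near_vertex: assumes "x \<in> K" "e > 0" obtains w i where "dist x (Fw w (q i)) < e"
proof -
  obtain y where "y \<in> vertices" "dist y x < e"
    using assms unfolding SG_eq_closure closure_approachable by blast
  then obtain m where "y \<in> sgV q m" "dist y x < e" by (auto simp: vertices_def)
  then obtain w i where "y = Fw w (q i)" by (auto simp: sgV_eq)
  then show thesis using that \<open>dist y x < e\<close> by (auto simp: dist_commute)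
qed

lemma eq_on_SG_if_eq_on_vertices:
  fixes u :: "real ^ 2 \<Rightarrow> real"
  assumes "continuous_on K u" "\<And>w i. u (Fw w (q i)) = c" "x \<in> K"
  shows "u x = c"
proof (rule ccontr)
  assume "u x \<noteq> c"
  then obtain d where d: "d > 0" "\<And>y. y \<in> K \<Longrightarrow> dist y x < d \<Longrightarrow> dist (u y) (u x) < dist c (u x)"
    using assms(1,3) unfolding continuous_on_iff by (metis zero_less_dist_iff)
  obtain w i where "dist x (Fw w (q i)) < d" using SG_near_vertex[OF assms(3) d(1)] .
  then show False using d(2)[of "Fw w (q i)"] assms(2) by (simp add: dist_commute)
qed

subsection \<open>The energy form\<close>

text \<open>The polarised energy of the complete graph on three corners, that is, the sum of
  \<open>(a i - a j) * (b i - b j)\<close> over the three pairs.\<close>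

definition corner_form :: "(3 \<Rightarrow> real) \<Rightarrow> (3 \<Rightarrow> real) \<Rightarrow> real" where
  "corner_form a b = 3 * (\<Sum>i\<in>UNIV. a i * b i) - (\<Sum>i\<in>UNIV. a i) * (\<Sum>i\<in>UNIV. b i)"

lemma corner_form_diag:
  "corner_form a a = (a 0 - a 1)\<^sup>2 + (a 1 - a 2)\<^sup>2 + (a 0 - a 2)\<^sup>2"
  by (simp add: corner_form_def sum_3_eq power2_eq_square algebra_simps)

text \<open>The polarised graph energy of level \<open>n\<close>, organised by cells instead of
  edges; \<open>graph_energy_eq\<close> shows the agreement. Recursion on the outermost map makes
  the self-similar scaling by 5/3 definitional.\<close>

primrec cell_form :: "nat \<Rightarrow> (real ^ 2 \<Rightarrow> real) \<Rightarrow> (real ^ 2 \<Rightarrow> real) \<Rightarrow> real" where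
  "cell_form 0 u v = corner_form (\<lambda>i. u (q i)) (\<lambda>i. v (q i))"
| "cell_form (Suc n) u v = 5 / 3 * (\<Sum>i\<in>UNIV. cell_form n (\<lambda>x. u (F i x)) (\<lambda>x. v (F i x)))"

lemma cell_form_cong:
  "(\<And>x. x \<in> K \<Longrightarrow> u x = u' x) \<Longrightarrow> (\<And>x. x \<in> K \<Longrightarrow> v x = v' x) \<Longrightarrow> cell_form n u v = cell_form n u' v'"
proof (induction n arbitrary: u v u' v')
  case (Suc n)
  have "cell_form n (\<lambda>x. u (F i x)) (\<lambda>x. v (F i x)) = cell_form n (\<lambda>x. u' (F i x)) (\<lambda>x. v' (F i x))" for i
    by (rule Suc.IH) (auto intro: Suc.prems)
  then show ?case by simp
qed simp

lemma cell_form_sym: "cell_form n u v = cell_form n v u"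
  by (induction n arbitrary: u v) (simp_all add: corner_form_def mult.commute)

lemma cell_form_add: "cell_form n (\<lambda>x. u x + u' x) v = cell_form n u v + cell_form n u' v"
  by (induction n arbitrary: u u' v)
     (simp_all add: corner_form_def algebra_simps sum.distrib)

lemma cell_form_scale: "cell_form n (\<lambda>x. c * u x) v = c * cell_form n u v"
proof (induction n arbitrary: u v)
  case 0
  then show ?case by (simp add: corner_form_def sum_3_eq algebra_simps)
next
  case (Suc n)
  then show ?case by (simp add: sum_distrib_left mult.left_commute)
qed

lemma cell_form_diff: "cell_form n (\<lambda>x. u x - u' x) v = cell_form n u v - cell_form n u' v"
  using cell_form_add[of n u "\<lambda>x. - 1 * u' x" v] cell_form_scale[of n "- 1" u' v] by simp

lemma cell_form_add_right: "cell_form n v (\<lambda>x. u x + u' x) = cell_form n v u + cell_form n v u'"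
  using cell_form_add cell_form_sym by metis

lemma cell_form_diff_right: "cell_form n v (\<lambda>x. u x - u' x) = cell_form n v u - cell_form n v u'"
  using cell_form_diff cell_form_sym by metis

lemma cell_form_nonneg: "cell_form n u u \<ge> 0"
  by (induction n arbitrary: u) (simp_all add: corner_form_diag sum_nonneg)

text \<open>The difference of the two sides is \<open>5/3\<close> times a sum of squares of the deviations of the
  midpoint values from their energy minimising values, the weights being \<open>2/5, 2/5, 1/5\<close>.\<close>

lemma cell_form_le_Suc: "cell_form n u u \<le> cell_form (Suc n) u u"
proof (induction n arbitrary: u)
  case 0
  define a0 a1 a2 where a: "a0 = u (q 0)" "a1 = u (q 1)" "a2 = u (q 2)"
  define x0 x1 x2 where x: "x0 = u (F 1 (q 2))" "x1 = u (F 0 (q 2))" "x2 = u (F 0 (q 1))"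
  have s: "F 2 (q 1) = F 1 (q 2)" "F 2 (q 0) = F 0 (q 2)" "F 1 (q 0) = F 0 (q 1)"
    by (rule F_swap)+
  define e0 e1 e2 where e: "e0 = x0 - (2 * a1 + 2 * a2 + a0) / 5" "e1 = x1 - (2 * a0 + 2 * a2 + a1) / 5"
    "e2 = x2 - (2 * a1 + 2 * a0 + a2) / 5"
  have "cell_form (Suc 0) u u - cell_form 0 u u
    = 5 / 3 * (((a0 - x2)\<^sup>2 + (x2 - x1)\<^sup>2 + (a0 - x1)\<^sup>2) + ((x2 - a1)\<^sup>2 + (a1 - x0)\<^sup>2 + (x2 - x0)\<^sup>2)
       + ((x1 - x0)\<^sup>2 + (x0 - a2)\<^sup>2 + (x1 - a2)\<^sup>2)) - ((a0 - a1)\<^sup>2 + (a1 - a2)\<^sup>2 + (a0 - a2)\<^sup>2)"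
    by (simp add: sum_3_eq corner_form_diag F_q s a x)
  also have "\<dots> = 5 / 3 * (2 * (e0\<^sup>2 + e1\<^sup>2 + e2\<^sup>2) + (e0 - e1)\<^sup>2 + (e1 - e2)\<^sup>2 + (e0 - e2)\<^sup>2)"
    unfolding e by (simp add: power2_eq_square field_simps)
  also have "\<dots> \<ge> 0" by simp
  finally show ?case by simp
next
  case (Suc n)
  show ?case by (subst (1 2) cell_form.simps(2)) (intro mult_left_mono sum_mono Suc.IH; simp)
qed

lemma incseq_cell_form: "incseq (\<lambda>n. cell_form n u u)"
  by (rule incseq_SucI) (rule cell_form_le_Suc)

section \<open>Agreement of the cell form with the graph energy\<close>

definition adj_pairs :: "nat \<Rightarrow> ((real ^ 2) \<times> (real ^ 2)) set" where
  "adj_pairs m = {(x, y). sg_adj q m x y}"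

lemma adj_pairs_0: "adj_pairs 0 = map_prod q q ` {(i, j). i \<noteq> j}"
  unfolding adj_pairs_def sg_adj_def by (auto simp: image_iff q_inj)

lemma adj_pairs_Suc: "adj_pairs (Suc m) = (\<Union>i. map_prod (F i) (F i) ` adj_pairs m)"
proof (intro set_eqI iffI)
  fix p assume "p \<in> adj_pairs (Suc m)"
  then obtain w a b where w: "length w = Suc m" "p = (Fw w (q a), Fw w (q b))" "Fw w (q a) \<noteq> Fw w (q b)"
    by (auto simp: adj_pairs_def sg_adj_def)
  then obtain i w' where "w = i # w'" "length w' = m" by (auto simp: length_Suc_conv)
  then have "(Fw w' (q a), Fw w' (q b)) \<in> adj_pairs m" "p = map_prod (F i) (F i) (Fw w' (q a), Fw w' (q b))"
    using w by (auto simp: adj_pairs_def sg_adj_def)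
  then show "p \<in> (\<Union>i. map_prod (F i) (F i) ` adj_pairs m)" by blast
next
  fix p assume "p \<in> (\<Union>i. map_prod (F i) (F i) ` adj_pairs m)"
  then obtain i w a b where w: "length w = m" "p = (F i (Fw w (q a)), F i (Fw w (q b)))" "Fw w (q a) \<noteq> Fw w (q b)"
    by (auto simp: adj_pairs_def sg_adj_def)
  then have "length (i # w) = Suc m" "p = (Fw (i # w) (q a), Fw (i # w) (q b))" "Fw (i # w) (q a) \<noteq> Fw (i # w) (q b)"
    by (auto simp: F_inj)
  then show "p \<in> adj_pairs (Suc m)" unfolding adj_pairs_def sg_adj_def
    by (auto simp del: sgFw.simps intro!: exI[of _ "i # w"])
qed

lemma adj_pairs_D: "(x, y) \<in> adj_pairs m \<Longrightarrow> x \<in> K \<and> y \<in> K \<and> x \<noteq> y"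
  by (auto simp: adj_pairs_def sg_adj_def)

lemma finite_adj_pairs: "finite (adj_pairs m)"
  by (induction m) (auto simp: adj_pairs_0 adj_pairs_Suc)

text \<open>Two different cells share at most one point while an edge has two distinct endpoints, so
  no edge is counted twice.\<close>

lemma sum_adj_pairs_Suc:
  "(\<Sum>p\<in>adj_pairs (Suc m). g p) = (\<Sum>i\<in>UNIV. \<Sum>p\<in>adj_pairs m. g (map_prod (F i) (F i) p))"
  unfolding adj_pairs_Suc
proof (subst sum.UNION_disjoint)
  show "\<forall>i\<in>UNIV. \<forall>j\<in>UNIV. i \<noteq> j \<longrightarrow>
      map_prod (F i) (F i) ` adj_pairs m \<inter> map_prod (F j) (F j) ` adj_pairs m = {}"
  proof (intro ballI impI equals0I)
    fix i j :: 3 and p assume "i \<noteq> j" "p \<in> map_prod (F i) (F i) ` adj_pairs m \<inter> map_prod (F j) (F j) ` adj_pairs m"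
    then obtain x y x' y' where "(x, y) \<in> adj_pairs m" "(x', y') \<in> adj_pairs m" "F i x = F j x'" "F i y = F j y'"
      by auto
    then show False using adj_pairs_D F_meet \<open>i \<noteq> j\<close> by metis
  qed
  have "inj_on (map_prod (F i) (F i)) (adj_pairs m)" for i by (auto simp: inj_on_def F_inj)
  then show "(\<Sum>i\<in>UNIV. sum g (map_prod (F i) (F i) ` adj_pairs m)) =
      (\<Sum>i\<in>UNIV. \<Sum>p\<in>adj_pairs m. g (map_prod (F i) (F i) p))"
    by (simp add: sum.reindex)
qed (auto simp: finite_adj_pairs)

lemma graph_energy_eq: "graph_energy q m u = cell_form m u u"
proof -
  have "(5 / 3) ^ m * ((1 / 2) * (\<Sum>(x, y)\<in>adj_pairs m. (u x - u y)\<^sup>2)) = cell_form m u u"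
  proof (induction m arbitrary: u)
    case 0
    have inj: "inj_on (map_prod q q) {(i, j). i \<noteq> j}" by (auto simp: inj_on_def q_inj)
    have "{(i, j :: 3). i \<noteq> j} = {(0, 1), (1, 0), (0, 2), (2, 0), (1, 2), (2, 1)}"
      using UNIV_3_eq by (auto elim: cases_3) (metis cases_3)+
    moreover have "(\<Sum>(x, y)\<in>adj_pairs 0. (u x - u y)\<^sup>2) = (\<Sum>(i, j)\<in>{(i, j). i \<noteq> j}. (u (q i) - u (q j))\<^sup>2)"
      unfolding adj_pairs_0 sum.reindex[OF inj] by (simp add: case_prod_unfold)
    ultimately show ?case
      by (simp add: corner_form_diag power2_commute)
  next
    case (Suc m)
    show ?case
      unfolding sum_adj_pairs_Suc cell_form.simps Suc.IH[symmetric]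
      by (simp add: sum_distrib_left case_prod_unfold mult.assoc)
  qed
  then show ?thesis by (simp add: graph_energy_def adj_pairs_def)
qed

section \<open>The energy domain and the bilinear form as a limit of cell forms\<close>

lemma energy_eq_SUP: "energy q u = (SUP n. ereal (cell_form n u u))"
proof -
  have "(\<lambda>m. ereal (graph_energy q m u)) \<longlonglongrightarrow> (SUP n. ereal (cell_form n u u))"
    unfolding graph_energy_eq
    by (rule LIMSEQ_SUP) (use incseq_cell_form[of u] in \<open>auto simp: incseq_def\<close>)
  then show ?thesis unfolding energy_def by (rule limI)
qed

lemma dom_energy_iff:
  "u \<in> dom_energy q \<longleftrightarrow> continuous_on K u \<and> (\<exists>B. \<forall>n. cell_form n u u \<le> B)"
proof -
  have "energy q u < \<infinity> \<longleftrightarrow> (\<exists>B. \<forall>n. cell_form n u u \<le> B)"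
  proof
    assume "energy q u < \<infinity>"
    moreover have "energy q u \<ge> ereal (cell_form 0 u u)" unfolding energy_eq_SUP by (rule SUP_upper) simp
    ultimately obtain B where B: "energy q u = ereal B" by (cases "energy q u") auto
    have "ereal (cell_form n u u) \<le> ereal B" for n unfolding B[symmetric] energy_eq_SUP by (rule SUP_upper) simp
    then show "\<exists>B. \<forall>n. cell_form n u u \<le> B" by auto
  next
    assume "\<exists>B. \<forall>n. cell_form n u u \<le> B"
    then obtain B where "\<And>n. cell_form n u u \<le> B" by blast
    then have "energy q u \<le> ereal B" unfolding energy_eq_SUP by (intro SUP_least) simp
    then show "energy q u < \<infinity>" by auto
  qed
  then show ?thesis unfolding dom_energy_def by simp
qed

lemma dom_energy_continuous: "u \<in> dom_energy q \<Longrightarrow> continuous_on K u" by (simp add: dom_energy_iff)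

lemma cell_form_lim_energy:
  assumes "u \<in> dom_energy q" shows "(\<lambda>n. cell_form n u u) \<longlonglongrightarrow> real_of_ereal (energy q u)"
proof -
  obtain B where "\<And>n. cell_form n u u \<le> B" using assms dom_energy_iff by blast
  then obtain L where L: "(\<lambda>n. cell_form n u u) \<longlonglongrightarrow> L"
    using incseq_convergent[OF incseq_cell_form[of u]] by blast
  then have "(\<lambda>n. ereal (cell_form n u u)) \<longlonglongrightarrow> ereal L" by simp
  then have "energy q u = ereal L" unfolding energy_def graph_energy_eq by (rule limI)
  then show ?thesis using L by simp
qed

lemma cell_form_bound: "2 * \<bar>cell_form n u v\<bar> \<le> cell_form n u u + cell_form n v v"
proof -
  have "cell_form n (\<lambda>x. u x + v x) (\<lambda>x. u x + v x) = cell_form n u u + cell_form n v v + 2 * cell_form n u v"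
    by (simp add: cell_form_add cell_form_add_right cell_form_sym[of n v u])
  moreover have "cell_form n (\<lambda>x. u x - v x) (\<lambda>x. u x - v x) = cell_form n u u + cell_form n v v - 2 * cell_form n u v"
    by (simp add: cell_form_diff cell_form_diff_right cell_form_sym[of n v u])
  ultimately show ?thesis
    using cell_form_nonneg[of n "\<lambda>x. u x + v x"] cell_form_nonneg[of n "\<lambda>x. u x - v x"] by linarith
qed

lemma dom_energy_add: assumes "u \<in> dom_energy q" "v \<in> dom_energy q" shows "(\<lambda>x. u x + v x) \<in> dom_energy q"
proof -
  obtain B C where *: "\<And>n. cell_form n u u \<le> B" "\<And>n. cell_form n v v \<le> C"
    using assms unfolding dom_energy_iff by metis
  have "cell_form n (\<lambda>x. u x + v x) (\<lambda>x. u x + v x) \<le> 2 * (B + C)" for n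
    using *[of n] cell_form_bound[of n u v]
    by (simp add: cell_form_add cell_form_add_right cell_form_sym[of n v u])
  then show ?thesis using assms by (auto simp: dom_energy_iff intro: continuous_intros)
qed

lemma dom_energy_scale: assumes "u \<in> dom_energy q" shows "(\<lambda>x. c * u x) \<in> dom_energy q"
proof -
  obtain B where *: "\<And>n. cell_form n u u \<le> B" using assms unfolding dom_energy_iff by metis
  have "cell_form n (\<lambda>x. c * u x) (\<lambda>x. c * u x) = c\<^sup>2 * cell_form n u u" for n
    using cell_form_scale[of n c u "\<lambda>x. c * u x"] cell_form_scale[of n c u u] cell_form_sym[of n u "\<lambda>x. c * u x"]
    by (simp add: power2_eq_square)
  then have "cell_form n (\<lambda>x. c * u x) (\<lambda>x. c * u x) \<le> c\<^sup>2 * B" for n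
    using *[of n] by (simp add: mult_left_mono)
  then show ?thesis using assms by (auto simp: dom_energy_iff intro: continuous_intros)
qed

lemma dom_energy_diff: assumes "u \<in> dom_energy q" "v \<in> dom_energy q" shows "(\<lambda>x. u x - v x) \<in> dom_energy q"
  using dom_energy_add[OF assms(1) dom_energy_scale[OF assms(2), of "- 1"]] by simp

lemma cell_form_lim:
  assumes "u \<in> dom_energy q" "v \<in> dom_energy q"
  shows "(\<lambda>n. cell_form n u v) \<longlonglongrightarrow> energy_form q u v"
proof -
  have "(\<lambda>n. (cell_form n (\<lambda>x. u x + v x) (\<lambda>x. u x + v x) - cell_form n (\<lambda>x. u x - v x) (\<lambda>x. u x - v x)) / 4)
     \<longlonglongrightarrow> energy_form q u v"
    unfolding energy_form_def
    by (intro tendsto_intros cell_form_lim_energy dom_energy_add dom_energy_diff assms) simp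
  then show ?thesis
    by (simp add: cell_form_add cell_form_add_right cell_form_diff cell_form_diff_right cell_form_sym[of _ v u])
qed

lemma energy_form_eqI:
  assumes "u \<in> dom_energy q" "v \<in> dom_energy q" "(\<lambda>n. cell_form n u v) \<longlonglongrightarrow> l"
  shows "energy_form q u v = l"
  using LIMSEQ_unique[OF cell_form_lim[OF assms(1,2)] assms(3)] .

lemma dom_energy_F: assumes "u \<in> dom_energy q" shows "(\<lambda>x. u (F i x)) \<in> dom_energy q"
proof -
  obtain B where B: "\<And>n. cell_form n u u \<le> B" using assms unfolding dom_energy_iff by metis
  have "cell_form n (\<lambda>x. u (F i x)) (\<lambda>x. u (F i x)) \<le> B" for n
  proof -
    have "cell_form n (\<lambda>x. u (F i x)) (\<lambda>x. u (F i x)) \<le> (\<Sum>i\<in>UNIV. cell_form n (\<lambda>x. u (F i x)) (\<lambda>x. u (F i x)))"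
      by (rule member_le_sum) (auto simp: cell_form_nonneg)
    also have "\<dots> \<le> 5 / 3 * \<dots>" using sum_nonneg[of UNIV "\<lambda>i. cell_form n (\<lambda>x. u (F i x)) (\<lambda>x. u (F i x))"]
      by (simp add: cell_form_nonneg)
    also have "\<dots> \<le> B" using B[of "Suc n"] by simp
    finally show ?thesis .
  qed
  then show ?thesis using assms continuous_on_SG_iff[of u] by (auto simp: dom_energy_iff)
qed

lemma dom_energyI_F: assumes "\<And>i. (\<lambda>x. u (F i x)) \<in> dom_energy q" shows "u \<in> dom_energy q"
proof -
  obtain B where B: "\<And>i n. cell_form n (\<lambda>x. u (F i x)) (\<lambda>x. u (F i x)) \<le> B i"
    using assms unfolding dom_energy_iff by metis
  have "cell_form n u u \<le> 5 / 3 * (\<Sum>i\<in>UNIV. B i)" for n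
  proof -
    have "cell_form n u u \<le> cell_form (Suc n) u u" by (rule cell_form_le_Suc)
    also have "\<dots> \<le> 5 / 3 * (\<Sum>i\<in>UNIV. B i)" by (simp add: sum_mono B)
    finally show ?thesis .
  qed
  then show ?thesis using assms continuous_on_SG_iff[of u] unfolding dom_energy_iff by blast
qed

lemma dom_energy_cong: assumes "u \<in> dom_energy q" "\<And>x. x \<in> K \<Longrightarrow> v x = u x" shows "v \<in> dom_energy q"
  using assms cell_form_cong[of v u v u] continuous_on_cong[of K K v u] unfolding dom_energy_iff by simp

lemma dom_energy_glue:
  assumes "\<And>i j. g i (q j) = g j (q i)" "\<And>i. g i \<in> dom_energy q" shows "glue g \<in> dom_energy q"
  by (rule dom_energyI_F) (rule dom_energy_cong[OF assms(2)], simp add: glue_F[where g = g, OF assms(1)])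

lemma energy_form_self_similar:
  assumes "u \<in> dom_energy q" "v \<in> dom_energy q"
  shows "energy_form q u v = 5 / 3 * (\<Sum>i\<in>UNIV. energy_form q (\<lambda>x. u (F i x)) (\<lambda>x. v (F i x)))"
proof (rule energy_form_eqI[OF assms])
  have "(\<lambda>n. cell_form (Suc n) u v) \<longlonglongrightarrow> 5 / 3 * (\<Sum>i\<in>UNIV. energy_form q (\<lambda>x. u (F i x)) (\<lambda>x. v (F i x)))"
    unfolding cell_form.simps by (intro tendsto_intros cell_form_lim dom_energy_F assms)
  then show "(\<lambda>n. cell_form n u v) \<longlonglongrightarrow> 5 / 3 * (\<Sum>i\<in>UNIV. energy_form q (\<lambda>x. u (F i x)) (\<lambda>x. v (F i x)))"
    by (rule LIMSEQ_imp_Suc)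
qed

lemma energy_form_sym: "u \<in> dom_energy q \<Longrightarrow> v \<in> dom_energy q \<Longrightarrow> energy_form q u v = energy_form q v u"
  using energy_form_eqI[of u v "energy_form q v u"] cell_form_lim[of v u] by (simp add: cell_form_sym)

lemma energy_form_add_right:
  assumes "u \<in> dom_energy q" "v \<in> dom_energy q" "w \<in> dom_energy q"
  shows "energy_form q u (\<lambda>x. v x + w x) = energy_form q u v + energy_form q u w"
proof (rule energy_form_eqI)
  show "(\<lambda>n. cell_form n u (\<lambda>x. v x + w x)) \<longlonglongrightarrow> energy_form q u v + energy_form q u w"
    unfolding cell_form_add_right by (intro tendsto_intros cell_form_lim assms)
qed (intro assms dom_energy_add)+

lemma energy_form_scale_right:
  assumes "u \<in> dom_energy q" "v \<in> dom_energy q"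
  shows "energy_form q u (\<lambda>x. c * v x) = c * energy_form q u v"
proof (rule energy_form_eqI)
  show "(\<lambda>n. cell_form n u (\<lambda>x. c * v x)) \<longlonglongrightarrow> c * energy_form q u v"
    unfolding cell_form_sym[of _ u] cell_form_scale
    by (subst cell_form_sym) (intro tendsto_intros cell_form_lim assms)
qed (intro assms dom_energy_scale)+

lemma energy_form_diff_left:
  assumes "u \<in> dom_energy q" "v \<in> dom_energy q" "w \<in> dom_energy q"
  shows "energy_form q (\<lambda>x. u x - v x) w = energy_form q u w - energy_form q v w"
proof (rule energy_form_eqI)
  show "(\<lambda>n. cell_form n (\<lambda>x. u x - v x) w) \<longlonglongrightarrow> energy_form q u w - energy_form q v w"
    unfolding cell_form_diff by (intro tendsto_intros cell_form_lim assms)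
qed (intro assms dom_energy_diff)+

lemma energy_form_cong:
  assumes "u \<in> dom_energy q" "v \<in> dom_energy q" "\<And>x. x \<in> K \<Longrightarrow> u' x = u x" "\<And>x. x \<in> K \<Longrightarrow> v' x = v x"
  shows "energy_form q u' v' = energy_form q u v"
proof (rule energy_form_eqI)
  show "(\<lambda>n. cell_form n u' v') \<longlonglongrightarrow> energy_form q u v"
    using cell_form_lim[OF assms(1,2)] cell_form_cong[of u' u v' v] assms(3,4) by simp
qed (use dom_energy_cong assms in metis)+

text \<open>The cell forms are nonnegative and increase to the energy, so all of them vanish.
  Constancy then passes from the corners to all vertices, and to the gasket by continuity.\<close>

lemma energy_form_zero_imp_const:
  assumes "u \<in> dom_energy q" "energy_form q u u = 0" "x \<in> K" "\<And>i. u (q i) = c"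
  shows "u x = c"
proof -
  have "cell_form n u u \<le> 0" for n
    using incseq_le[OF incseq_cell_form cell_form_lim[OF assms(1,1)], of n] assms(2) by simp
  then have z: "cell_form n u u = 0" for n using cell_form_nonneg[of n u] by (simp add: antisym)
  have *: "u (Fw w (q i)) = c" if "\<And>n. cell_form n u u = 0" "\<And>i. u (q i) = c" for w i c u using that
  proof (induction w arbitrary: u)
    case (Cons j w)
    have zj: "cell_form n (\<lambda>x. u (F k x)) (\<lambda>x. u (F k x)) = 0" for n k
    proof -
      have "(\<Sum>k\<in>UNIV. cell_form n (\<lambda>x. u (F k x)) (\<lambda>x. u (F k x))) = 0"
        using Cons.prems(1)[of "Suc n"] by simp
      then show ?thesis by (subst (asm) sum_nonneg_eq_0_iff) (auto simp: cell_form_nonneg)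
    qed
    have "u (F j (q k)) = c" for k
    proof -
      have "corner_form (\<lambda>i. u (F j (q i))) (\<lambda>i. u (F j (q i))) = 0" using zj[of 0 j] by simp
      then have "u (F j (q 0)) = u (F j (q 1))" "u (F j (q 1)) = u (F j (q 2))"
        unfolding corner_form_diag
        by (smt (verit, best) zero_le_power2 zero_eq_power2)+
      \<comment> \<open>The corner \<open>q j\<close> is fixed by \<open>F j\<close>, so the
        constant on the smaller cell is the old one.\<close>
      moreover have "u (F j (q j)) = c" using Cons.prems(2) by (simp add: F_q)
      ultimately show ?thesis by (cases j rule: cases_3; cases k rule: cases_3) auto
    qed
    then have "u (F j (Fw w (q i))) = c" by (rule Cons.IH[of "\<lambda>x. u (F j x)", OF zj])
    then show ?case by simp
  qed simp
  show ?thesis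
    by (rule eq_on_SG_if_eq_on_vertices[OF dom_energy_continuous[OF assms(1)] _ assms(3)]) (rule *[OF z assms(4)])
qed

subsection \<open>Biharmonic functions\<close>

text \<open>Affine interpolation on the cells of level \<open>n\<close>. The type of states is left
  abstract so that data of the Laplacian can travel along with the corner values.\<close>

primrec approximant ::
    "(3 \<Rightarrow> 's \<Rightarrow> 's) \<Rightarrow> ('s \<Rightarrow> 3 \<Rightarrow> real) \<Rightarrow> nat \<Rightarrow> 's \<Rightarrow> real ^ 2 \<Rightarrow> real" where
  "approximant A val 0 s = (\<lambda>x. \<Sum>i\<in>UNIV. val s i * bary i x)"
| "approximant A val (Suc n) s = glue (\<lambda>i. approximant A val n (A i s))"

text \<open>\<open>corner\<close> and \<open>match\<close> make the refined values agree at shared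
  vertices. Since \<open>N\<close> contracts, the refinement from level \<open>n\<close> to the next
  changes the function by at most \<open>2 * N s * r ^ n\<close>, so the telescoping series
  converges uniformly. In the final bound, 2 of the 3 come from this series and 1 from the affine
  start.\<close>

lemma ex_function_from_corner_values:
  fixes A :: "3 \<Rightarrow> 's \<Rightarrow> 's" and val :: "'s \<Rightarrow> 3 \<Rightarrow> real" and N :: "'s \<Rightarrow> real"
  assumes corner: "\<And>s i. val (A i s) i = val s i"
    and match: "\<And>s i j. val (A i s) j = val (A j s) i"
    and osc: "\<And>s i j. \<bar>val s i - val s j\<bar> \<le> N s"
    and contr: "\<And>s i. N (A i s) \<le> r * N s" and r: "0 \<le> r" "r < 1"
  shows "\<exists>U. \<forall>s. continuous_on K (U s) \<and> (\<forall>i. U s (q i) = val s i) \<and>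
    (\<forall>i. \<forall>x\<in>K. U s (F i x) = U (A i s) x) \<and> (\<forall>i. \<forall>x\<in>K. \<bar>U s x - val s i\<bar> \<le> 3 / (1 - r) * N s)"
proof -
  define g where "g = approximant A val"
  have Nn: "N s \<ge> 0" for s using osc[of s 0 0] by simp
  have g_q: "g n s (q i) = val s i" for n s i
  proof (induction n arbitrary: s i)
    case 0
    have "(\<Sum>j\<in>UNIV. val s j * bary j (q i)) = (\<Sum>j\<in>UNIV. if i = j then val s j else 0)"
      by (rule sum.cong) (auto simp: bary_q)
    then show ?case by (simp add: g_def)
  next
    case (Suc n)
    have "glue (\<lambda>i. g n (A i s)) (F i (q i)) = g n (A i s) (q i)"
      by (rule glue_F) (simp_all add: Suc.IH match)
    then show ?case using corner by (simp add: g_def F_q Suc.IH[unfolded g_def])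
  qed
  have g_F: "g (Suc n) s (F i x) = g n (A i s) x" if "x \<in> K" for n s i x
    unfolding g_def approximant.simps
    by (rule glue_F[OF _ that]) (metis g_def g_q match)
  have g_cont: "continuous_on K (g n s)" for n s
  proof (induction n arbitrary: s)
    case 0
    then show ?case unfolding g_def approximant.simps by (intro continuous_intros continuous_bary)
  next
    case (Suc n)
    show ?case unfolding g_def approximant.simps
      by (rule continuous_glue) (metis g_def g_q match, metis g_def Suc.IH)
  qed
  have g_0: "\<bar>g 0 s x - val s j\<bar> \<le> N s" if x: "x \<in> K" for s x j
  proof -
    have "g 0 s x - val s j = (\<Sum>i\<in>UNIV. val s i * bary i x) - val s j * (\<Sum>i\<in>UNIV. bary i x)"
      by (simp add: g_def sum_bary)
    also have "\<dots> = (\<Sum>i\<in>UNIV. (val s i - val s j) * bary i x)"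
      by (simp add: sum_distrib_left sum_subtractf algebra_simps)
    also have "\<bar>\<dots>\<bar> \<le> (\<Sum>i\<in>UNIV. N s * bary i x)"
      using bary_nonneg[OF x] osc[of s _ j]
      by (intro order_trans[OF sum_abs] sum_mono) (simp add: abs_mult mult_right_mono)
    also have "\<dots> = N s" by (simp add: sum_bary flip: sum_distrib_left)
    finally show ?thesis .
  qed
  have g_step: "\<bar>g (Suc n) s x - g n s x\<bar> \<le> 2 * N s * r ^ n" if "x \<in> K" for n s x using that
  proof (induction n arbitrary: s x)
    case 0
    obtain i y where y: "y \<in> K" "x = F i y" using SG_cases[OF 0] .
    have "\<bar>g 0 (A i s) y - val (A i s) i\<bar> \<le> N (A i s)" by (rule g_0[OF y(1)])
    moreover have "r * N s \<le> N s" using r Nn[of s] mult_right_mono[of r 1 "N s"] by simp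
    then have "N (A i s) \<le> N s" using contr[of i s] by simp
    moreover have "\<bar>g 0 s x - val s i\<bar> \<le> N s" by (rule g_0[OF 0])
    ultimately show ?case using g_F[OF y(1), of 0 s i] corner[of i s] y(2) by simp
  next
    case (Suc n)
    obtain i y where y: "y \<in> K" "x = F i y" using SG_cases[OF Suc.prems] .
    have "\<bar>g (Suc (Suc n)) s x - g (Suc n) s x\<bar> = \<bar>g (Suc n) (A i s) y - g n (A i s) y\<bar>"
      by (simp add: y g_F)
    also have "\<dots> \<le> 2 * N (A i s) * r ^ n" by (rule Suc.IH[OF y(1)])
    also have "\<dots> \<le> 2 * (r * N s) * r ^ n" using contr[of i s] r by (intro mult_right_mono) auto
    finally show ?case by (simp add: ac_simps)
  qed
  define U where "U s x = g 0 s x + (\<Sum>n. g (Suc n) s x - g n s x)" for s x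
  have summ: "summable (\<lambda>n. 2 * N s * r ^ n)" for s using r by (intro summable_mult summable_geometric) simp
  have ul: "uniform_limit K (\<lambda>n x. \<Sum>i<n. g (Suc i) s x - g i s x) (\<lambda>x. \<Sum>n. g (Suc n) s x - g n s x) sequentially" for s
    by (rule Weierstrass_m_test[OF _ summ]) (use g_step in auto)
  have lim: "(\<lambda>n. g n s x) \<longlonglongrightarrow> U s x" if "x \<in> K" for s x
  proof -
    have "(\<lambda>n. \<Sum>i<n. g (Suc i) s x - g i s x) \<longlonglongrightarrow> (\<Sum>n. g (Suc n) s x - g n s x)"
      by (rule tendsto_uniform_limitI[OF ul that])
    then have "(\<lambda>n. g 0 s x + (g n s x - g 0 s x)) \<longlonglongrightarrow> U s x"
      unfolding U_def sum_lessThan_telescope[of "\<lambda>i. g i s x"] by (rule tendsto_add[OF tendsto_const])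
    then show ?thesis by simp
  qed
  have "continuous_on K (U s)" for s
  proof -
    have "continuous_on K (\<lambda>x. \<Sum>n. g (Suc n) s x - g n s x)"
      by (rule uniform_limit_theorem[OF _ ul]) (auto intro!: continuous_intros g_cont always_eventually)
    then show ?thesis unfolding U_def by (intro continuous_on_add g_cont)
  qed
  moreover have "U s (q i) = val s i" for s i
    using lim[of "q i" s] unfolding g_q by (simp add: LIMSEQ_const_iff)
  moreover have "U s (F i x) = U (A i s) x" if "x \<in> K" for s i x
  proof (rule LIMSEQ_unique)
    show "(\<lambda>n. g (Suc n) s (F i x)) \<longlonglongrightarrow> U s (F i x)" by (rule LIMSEQ_Suc[OF lim]) (simp add: that)
    show "(\<lambda>n. g (Suc n) s (F i x)) \<longlonglongrightarrow> U (A i s) x" unfolding g_F[OF that] by (rule lim[OF that])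
  qed
  moreover have "\<bar>U s x - val s i\<bar> \<le> 3 / (1 - r) * N s" if "x \<in> K" for s i x
  proof -
    have "norm (\<Sum>n. g (Suc n) s x - g n s x) \<le> (\<Sum>n. 2 * N s * r ^ n)"
      by (rule norm_suminf_le[OF _ summ]) (use g_step[OF that] in auto)
    also have "\<dots> = 2 * N s * (1 / (1 - r))" using r by (subst suminf_mult) (auto simp: suminf_geometric)
    finally have "\<bar>U s x - g 0 s x\<bar> \<le> 2 * N s * (1 / (1 - r))" unfolding U_def by simp
    moreover have "N s * 1 \<le> N s * (1 / (1 - r))" using r Nn[of s] by (intro mult_left_mono) (simp_all add: field_simps)
    ultimately have "\<bar>U s x - val s i\<bar> \<le> 3 * (N s * (1 / (1 - r)))" using g_0[OF that, of s i] by linarith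
    then show ?thesis by (simp add: ac_simps)
  qed
  ultimately show ?thesis by (intro exI[of _ U]) blast
qed

text \<open>For \<open>i \<noteq> j\<close> the third index is \<open>- (i + j)\<close>, and \<open>F i (q j)\<close> is the midpoint opposite to it;
  for \<open>i = j\<close> the formula below gives back \<open>f i\<close>.\<close>

definition harm_sub :: "3 \<Rightarrow> (3 \<Rightarrow> real) \<Rightarrow> 3 \<Rightarrow> real" where
  "harm_sub i f j = (2 * f i + 2 * f j + f (- (i + j))) / 5"

text \<open>A biharmonic function is encoded by its corner values \<open>a\<close> and the corner values \<open>f\<close> of its
  Laplacian. The midpoint values solve the equations stating that the normal derivatives from the
  two adjacent cells cancel.\<close>

definition biharm_sub :: "3 \<Rightarrow> (3 \<Rightarrow> real) \<times> (3 \<Rightarrow> real) \<Rightarrow> (3 \<Rightarrow> real) \<times> (3 \<Rightarrow> real)" where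
  "biharm_sub i s = (let (a, f) = s in
     (\<lambda>j. harm_sub i a j - (if i = j then 0 else (9 * f i + 9 * f j + 7 * f (- (i + j))) / 375),
      \<lambda>j. harm_sub i f j / 5))"

text \<open>For \<open>a\<close> only differences are measured, but for \<open>f\<close> the sizes
  themselves: even a constant \<open>f\<close> moves the midpoint values.\<close>

definition biharm_osc :: "(3 \<Rightarrow> real) \<times> (3 \<Rightarrow> real) \<Rightarrow> real" where
  "biharm_osc s = \<bar>fst s 0 - fst s 1\<bar> + \<bar>fst s 1 - fst s 2\<bar> + \<bar>fst s 0 - fst s 2\<bar>
     + (\<bar>snd s 0\<bar> + \<bar>snd s 1\<bar> + \<bar>snd s 2\<bar>)"

lemma uminus_3: "- (1 :: 3) = 2" "- (2 :: 3) = 1" "- (3 :: 3) = 0" "- (4 :: 3) = 2"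
  by simp_all

lemma harm_sub_same: "harm_sub i f i = f i"
  by (cases i rule: cases_3) (simp_all add: harm_sub_def uminus_3)

lemma harm_sub_swap: "harm_sub i f j = harm_sub j f i"
  by (simp add: harm_sub_def add.commute)

lemma harm_subs:
  "harm_sub 0 f 0 = f 0" "harm_sub 1 f 1 = f 1" "harm_sub 2 f 2 = f 2"
  "harm_sub 0 f 1 = (2 * f 0 + 2 * f 1 + f 2) / 5" "harm_sub 1 f 0 = (2 * f 0 + 2 * f 1 + f 2) / 5"
  "harm_sub 0 f 2 = (2 * f 0 + 2 * f 2 + f 1) / 5" "harm_sub 2 f 0 = (2 * f 0 + 2 * f 2 + f 1) / 5"
  "harm_sub 1 f 2 = (2 * f 1 + 2 * f 2 + f 0) / 5" "harm_sub 2 f 1 = (2 * f 1 + 2 * f 2 + f 0) / 5"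
  by (simp_all add: harm_sub_def uminus_3)

text \<open>Subdivision shrinks the sum of the corner differences of \<open>a\<close> by 3/5, and
  \<open>f\<close> enters the new quantity with weight at most 54/125. The ratio 4/5 leaves
  room.\<close>

lemma biharm_osc_sub: "biharm_osc (biharm_sub i s) \<le> 4 / 5 * biharm_osc s"
proof -
  obtain a f where s: "s = (a, f)" by (cases s)
  note abs_bounds = abs_ge_self[of "a 0 - a 1"] abs_ge_minus_self[of "a 0 - a 1"]
    abs_ge_self[of "a 1 - a 2"] abs_ge_minus_self[of "a 1 - a 2"]
    abs_ge_self[of "a 0 - a 2"] abs_ge_minus_self[of "a 0 - a 2"]
    abs_ge_self[of "f 0"] abs_ge_minus_self[of "f 0"] abs_ge_self[of "f 1"] abs_ge_minus_self[of "f 1"]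
    abs_ge_self[of "f 2"] abs_ge_minus_self[of "f 2"]
  \<comment> \<open>The absolute values become atoms: after \<open>R\<close> and \<open>S\<close>
    bound the new quantities, the final comparison is linear in nonnegative unknowns.\<close>
  define A where "A j k = \<bar>a j - a k\<bar>" for j k
  define B where "B j = \<bar>f j\<bar>" for j
  define R where "R j k = (if i = j \<or> i = k then 2 / 5 * A j k + 1 / 5 * A i (- (j + k)) else 1 / 5 * A j k)
       + (9 * B 0 + 9 * B 1 + 9 * B 2) / 375" for j k
  define S where "S j = (if i = j then B i / 5 else (2 * B i + 2 * B j + B (- (i + j))) / 25)" for j
  have a: "\<bar>fst (biharm_sub i s) j - fst (biharm_sub i s) k\<bar> \<le> R j k" if "j \<noteq> k" for j k
    unfolding R_def A_def B_def using that
    by (cases i rule: cases_3; cases j rule: cases_3; cases k rule: cases_3;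
        simp add: s biharm_sub_def harm_subs uminus_3; intro abs_leI; use abs_bounds in argo)
  have f: "\<bar>snd (biharm_sub i s) j\<bar> \<le> S j" for j
    unfolding S_def B_def
    by (cases i rule: cases_3; cases j rule: cases_3;
        simp add: s biharm_sub_def harm_subs uminus_3; intro abs_leI; use abs_bounds in argo)
  have "biharm_osc (biharm_sub i s) \<le> (R 0 1 + R 1 2 + R 0 2) + (S 0 + S 1 + S 2)"
    unfolding biharm_osc_def by (intro add_mono a f) simp_all
  moreover have sym: "A 1 0 = A 0 1" "A 2 0 = A 0 2" "A 2 1 = A 1 2"
    by (simp_all add: A_def abs_minus_commute)
  have nonneg: "0 \<le> A 0 1" "0 \<le> A 0 2" "0 \<le> A 1 2" "0 \<le> B 0" "0 \<le> B 1" "0 \<le> B 2"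
    by (simp_all add: A_def B_def)
  have "(R 0 1 + R 1 2 + R 0 2) + (S 0 + S 1 + S 2) \<le> 4 / 5 * ((A 0 1 + A 1 2 + A 0 2) + (B 0 + B 1 + B 2))"
    unfolding R_def S_def using nonneg
    by (cases i rule: cases_3; simp add: uminus_3 sym; argo)
  ultimately show ?thesis by (simp add: s biharm_osc_def A_def B_def)
qed

text \<open>The functions are chosen for all states at once, because the self-similarity equation
  relates functions of different states.\<close>

definition biharm :: "(3 \<Rightarrow> real) \<times> (3 \<Rightarrow> real) \<Rightarrow> real ^ 2 \<Rightarrow> real" where
  "biharm = (SOME U. \<forall>s. continuous_on K (U s) \<and> (\<forall>i. U s (q i) = fst s i) \<and>
    (\<forall>i. \<forall>x\<in>K. U s (F i x) = U (biharm_sub i s) x) \<and>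
    (\<forall>i. \<forall>x\<in>K. \<bar>U s x - fst s i\<bar> \<le> 3 / (1 - 4 / 5) * biharm_osc s))"

lemma biharm_props:
  "continuous_on K (biharm s) \<and> (\<forall>i. biharm s (q i) = fst s i) \<and>
    (\<forall>i. \<forall>x\<in>K. biharm s (F i x) = biharm (biharm_sub i s) x) \<and>
    (\<forall>i. \<forall>x\<in>K. \<bar>biharm s x - fst s i\<bar> \<le> 3 / (1 - 4 / 5) * biharm_osc s)"
proof -
  have "\<exists>U. \<forall>s. continuous_on K (U s) \<and> (\<forall>i. U s (q i) = fst s i) \<and>
    (\<forall>i. \<forall>x\<in>K. U s (F i x) = U (biharm_sub i s) x) \<and>
    (\<forall>i. \<forall>x\<in>K. \<bar>U s x - fst s i\<bar> \<le> 3 / (1 - 4 / 5) * biharm_osc s)"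
  proof (rule ex_function_from_corner_values)
    show "fst (biharm_sub i s) i = fst s i" for i s
      by (simp add: biharm_sub_def harm_sub_same case_prod_unfold)
    show "fst (biharm_sub i s) j = fst (biharm_sub j s) i" for i j s
      by (simp add: biharm_sub_def harm_sub_swap[of i _ j] case_prod_unfold add.commute)
    show "\<bar>fst s i - fst s j\<bar> \<le> biharm_osc s" for s :: "(3 \<Rightarrow> real) \<times> (3 \<Rightarrow> real)" and i j
      by (cases i rule: cases_3; cases j rule: cases_3) (simp_all add: biharm_osc_def)
    show "biharm_osc (biharm_sub i s) \<le> 4 / 5 * biharm_osc s" for i s by (rule biharm_osc_sub)
  qed simp_all
  from someI_ex[OF this] show ?thesis unfolding biharm_def by blast
qed

lemma continuous_biharm: "continuous_on K (biharm s)"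
  and biharm_q: "biharm s (q i) = fst s i"
  and biharm_F: "x \<in> K \<Longrightarrow> biharm s (F i x) = biharm (biharm_sub i s) x"
  and biharm_near: "x \<in> K \<Longrightarrow> \<bar>biharm s x - fst s i\<bar> \<le> 15 * biharm_osc s"
  using biharm_props by auto

definition harm :: "(3 \<Rightarrow> real) \<Rightarrow> real ^ 2 \<Rightarrow> real" where "harm a = biharm (a, \<lambda>_. 0)"

lemma continuous_harm: "continuous_on K (harm a)" by (simp add: harm_def continuous_biharm)

lemma harm_q: "harm a (q i) = a i" by (simp add: harm_def biharm_q)

lemma harm_F: assumes "x \<in> K" shows "harm a (F i x) = harm (harm_sub i a) x"
proof -
  have "biharm_sub i (a, \<lambda>_. 0) = (harm_sub i a, \<lambda>_. 0)"
    by (auto simp: biharm_sub_def harm_sub_def)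
  then show ?thesis by (simp add: harm_def biharm_F[OF assms])
qed

lemma harm_near:
  "x \<in> K \<Longrightarrow> \<bar>harm a x - a i\<bar> \<le> 15 * (\<bar>a 0 - a 1\<bar> + \<bar>a 1 - a 2\<bar> + \<bar>a 0 - a 2\<bar>)"
  using biharm_near[of x "(a, \<lambda>_. 0)" i] by (simp add: harm_def biharm_osc_def)

text \<open>\<open>gram f\<close> is \<open>M f\<close>, where \<open>M\<close> is the Gram matrix in L2 of the harmonic functions with corner
  values 0 and 1; its entries are \<open>7/45\<close> on and \<open>4/45\<close> off the diagonal.\<close>

definition gram :: "(3 \<Rightarrow> real) \<Rightarrow> 3 \<Rightarrow> real" where
  "gram f j = (4 * (\<Sum>k\<in>UNIV. f k) + 3 * f j) / 45"

text \<open>The vector \<open>b = D a + M f\<close> of the overview. At this point it is only a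
  formula; \<open>normal_deriv_biharm\<close> identifies it with the normal derivatives.\<close>

definition corner_deriv :: "(3 \<Rightarrow> real) \<times> (3 \<Rightarrow> real) \<Rightarrow> 3 \<Rightarrow> real" where
  "corner_deriv s j = 3 * fst s j - (\<Sum>k\<in>UNIV. fst s k) + gram (snd s) j"

text \<open>A quadrature rule for the integral of \<open>harm f\<close> times \<open>v\<close>: on
  every cell of level \<open>n\<close>, \<open>v\<close> is replaced by the harmonic function with
  the same corner values, and the product is integrated exactly through the Gram matrix.\<close>

primrec gram_form :: "nat \<Rightarrow> (3 \<Rightarrow> real) \<Rightarrow> (real ^ 2 \<Rightarrow> real) \<Rightarrow> real" where
  "gram_form 0 f v = (\<Sum>j\<in>UNIV. gram f j * v (q j))"
| "gram_form (Suc n) f v = (1 / 3) * (\<Sum>i\<in>UNIV. gram_form n (harm_sub i f) (\<lambda>x. v (F i x)))"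

lemma gram_form_scale: "gram_form n (\<lambda>i. f i / c) v = gram_form n f v / c"
proof (induction n arbitrary: f v)
  case 0
  show ?case by (simp add: gram_def sum_3_eq algebra_simps add_divide_distrib diff_divide_distrib)
next
  case (Suc n)
  have "harm_sub i (\<lambda>i. f i / c) = (\<lambda>j. harm_sub i f j / c)" for i
    by (auto simp: harm_sub_def add_divide_distrib)
  then show ?case by (simp add: Suc.IH sum_divide_distrib mult.commute)
qed

text \<open>Balance of fluxes. At a corner \<open>q i\<close> the flux of the subcell, scaled by
  5/3, is the flux of the whole cell (\<open>diag\<close>). At a midpoint the fluxes from the two
  adjacent subcells cancel (\<open>off\<close>).\<close>

lemma corner_deriv_sub:
  "5 / 3 * (\<Sum>i\<in>UNIV. \<Sum>j\<in>UNIV. corner_deriv (biharm_sub i s) j * v (F i (q j)))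
    = (\<Sum>j\<in>UNIV. corner_deriv s j * v (q j))"
proof -
  obtain a f where s: "s = (a, f)" by (cases s)
  have sw: "F 2 (q 1) = F 1 (q 2)" "F 2 (q 0) = F 0 (q 2)" "F 1 (q 0) = F 0 (q 1)"
    by (rule F_swap)+
  have diag: "5 / 3 * corner_deriv (biharm_sub i s) i = corner_deriv s i" for i
    by (cases i rule: cases_3)
       (simp_all add: s corner_deriv_def biharm_sub_def gram_def sum_3_eq harm_subs uminus_3 field_simps)
  have off: "corner_deriv (biharm_sub i s) j + corner_deriv (biharm_sub j s) i = 0" if "i \<noteq> j" for i j
    using that by (cases i rule: cases_3; cases j rule: cases_3)
       (simp_all add: s corner_deriv_def biharm_sub_def gram_def sum_3_eq harm_subs uminus_3 field_simps)
  have "(\<Sum>i\<in>UNIV. \<Sum>j\<in>UNIV. corner_deriv (biharm_sub i s) j * v (F i (q j)))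
    = (\<Sum>i\<in>UNIV. corner_deriv (biharm_sub i s) i * v (q i))
     + (corner_deriv (biharm_sub 0 s) 1 + corner_deriv (biharm_sub 1 s) 0) * v (F 0 (q 1))
     + (corner_deriv (biharm_sub 0 s) 2 + corner_deriv (biharm_sub 2 s) 0) * v (F 0 (q 2))
     + (corner_deriv (biharm_sub 1 s) 2 + corner_deriv (biharm_sub 2 s) 1) * v (F 1 (q 2))"
    by (simp add: sum_3_eq F_q sw algebra_simps)
  also have "\<dots> = (\<Sum>i\<in>UNIV. corner_deriv (biharm_sub i s) i * v (q i))"
    by (subst (1 2 3) off) simp_all
  finally show ?thesis by (simp add: sum_distrib_left diag[symmetric] mult.assoc)
qed

text \<open>The discrete Gauss-Green identity, without error term on any level. In the induction,
  the energy factor 5/3 times the factor 1/5 in the Laplacian data gives the measure factor 1/3, and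
  the boundary terms telescope by \<open>corner_deriv_sub\<close>.\<close>

lemma cell_form_biharm:
  "cell_form n (biharm s) v = - gram_form n (snd s) v + (\<Sum>j\<in>UNIV. corner_deriv s j * v (q j))"
proof (induction n arbitrary: s v)
  case 0
  show ?case by (simp add: corner_form_def corner_deriv_def biharm_q sum_3_eq algebra_simps)
next
  case (Suc n)
  have sn: "snd (biharm_sub i s) = (\<lambda>j. harm_sub i (snd s) j / 5)" for i
    by (simp add: biharm_sub_def case_prod_unfold)
  have "cell_form (Suc n) (biharm s) v = 5 / 3 * (\<Sum>i\<in>UNIV. cell_form n (biharm (biharm_sub i s)) (\<lambda>x. v (F i x)))"
    using cell_form_cong[of "\<lambda>x. biharm s (F i x)" "biharm (biharm_sub i s)" "\<lambda>x. v (F i x)" "\<lambda>x. v (F i x)" n for i]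
    by (simp add: biharm_F)
  also have "\<dots> = 5 / 3 * (\<Sum>i\<in>UNIV. - (gram_form n (harm_sub i (snd s)) (\<lambda>x. v (F i x)) / 5)) +
      5 / 3 * (\<Sum>i\<in>UNIV. \<Sum>j\<in>UNIV. corner_deriv (biharm_sub i s) j * v (F i (q j)))"
    unfolding Suc.IH sn gram_form_scale sum.distrib distrib_left ..
  also have "5 / 3 * (\<Sum>i\<in>UNIV. - (gram_form n (harm_sub i (snd s)) (\<lambda>x. v (F i x)) / 5)) = - gram_form (Suc n) (snd s) v"
    by (simp add: sum_negf flip: sum_divide_distrib)
  finally show ?case unfolding corner_deriv_sub .
qed

lemma gram_form_cong: "(\<And>x. x \<in> K \<Longrightarrow> u x = v x) \<Longrightarrow> gram_form n f u = gram_form n f v"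
proof (induction n arbitrary: f u v)
  case (Suc n)
  have "gram_form n (harm_sub i f) (\<lambda>x. u (F i x)) = gram_form n (harm_sub i f) (\<lambda>x. v (F i x))" for i
    by (rule Suc.IH) (simp add: Suc.prems)
  then show ?case by simp
qed simp

text \<open>The Gram entries are reproduced by averaging over the three subcells, so the quadrature
  of two harmonic functions has the same value on all levels.\<close>

lemma gram_form_harm: "gram_form n f (harm g) = (\<Sum>j\<in>UNIV. gram f j * g j)"
proof (induction n arbitrary: f g)
  case 0
  show ?case by (simp add: harm_q)
next
  case (Suc n)
  have "gram_form n (harm_sub i f) (\<lambda>x. harm g (F i x)) = (\<Sum>j\<in>UNIV. gram (harm_sub i f) j * harm_sub i g j)" for i
    using gram_form_cong[of "\<lambda>x. harm g (F i x)" "harm (harm_sub i g)"] by (simp add: harm_F Suc.IH)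
  moreover have "(1 / 3) * (\<Sum>i\<in>UNIV. \<Sum>j\<in>UNIV. gram (harm_sub i f) j * harm_sub i g j) = (\<Sum>j\<in>UNIV. gram f j * g j)"
    unfolding sum_3_eq gram_def harm_subs by argo
  ultimately show ?case by simp
qed

end

subsection \<open>Integration against the self-similar measure\<close>

locale gasket_measure = gasket q for q +
  fixes \<mu> :: "(real ^ 2) measure"
  assumes self_similar: "self_similar_measure q \<mu>"
begin

sublocale prob_space \<mu>
  using self_similar by (simp add: self_similar_measure_def)

lemma sets_measure [measurable_cong]: "sets \<mu> = sets (restrict_space borel K)"
  using self_similar by (simp add: self_similar_measure_def)

lemma space_measure: "space \<mu> = K"
  using sets_eq_imp_space_eq[OF sets_measure] by (simp add: space_restrict_space)

lemma measurable_self: assumes "f \<in> borel \<rightarrow>\<^sub>M borel" "f \<in> K \<rightarrow> K" shows "f \<in> \<mu> \<rightarrow>\<^sub>M \<mu>"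
  using measurable_restrict_space3[OF assms] measurable_cong_sets[OF sets_measure sets_measure] by blast

lemma measurable_F [measurable]: "F i \<in> \<mu> \<rightarrow>\<^sub>M \<mu>"
proof (rule measurable_self)
  show "F i \<in> borel \<rightarrow>\<^sub>M borel" by (intro borel_measurable_continuous_onI continuous_F)
qed simp

lemma measurable_Fw [measurable]: "Fw w \<in> \<mu> \<rightarrow>\<^sub>M \<mu>"
  by (induction w) (simp_all add: id_def comp_def)

lemma measurable_continuous: "continuous_on K u \<Longrightarrow> u \<in> borel_measurable \<mu>"
  using borel_measurable_continuous_on_restrict measurable_cong_sets[OF sets_measure refl] by blast

lemma bounded_continuous: assumes "continuous_on K (u :: real ^ 2 \<Rightarrow> real)" obtains B where "B \<ge> 0" "\<And>x. x \<in> K \<Longrightarrow> \<bar>u x\<bar> \<le> B"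
proof -
  have "bounded (u ` K)" by (rule compact_imp_bounded[OF compact_continuous_image[OF assms compact_SG]])
  then obtain B where B: "\<And>x. x \<in> K \<Longrightarrow> \<bar>u x\<bar> \<le> B" by (auto simp: bounded_iff)
  then have "B \<ge> 0" using q_in[of 0] abs_ge_zero order_trans by blast
  then show thesis using that B by blast
qed

lemma integrable_continuous: assumes "continuous_on K (u :: real ^ 2 \<Rightarrow> real)" shows "integrable \<mu> u"
proof -
  obtain B where "\<And>x. x \<in> K \<Longrightarrow> \<bar>u x\<bar> \<le> B" using bounded_continuous[OF assms] by blast
  then show ?thesis
    by (intro integrable_const_bound[of u B] AE_I2) (simp_all add: space_measure measurable_continuous assms)
qed

lemma integrable_mult_continuous:
  assumes "integrable \<mu> f" "continuous_on K (v :: real ^ 2 \<Rightarrow> real)" shows "integrable \<mu> (\<lambda>x. f x * v x)"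
proof -
  obtain B where B: "B \<ge> 0" "\<And>x. x \<in> K \<Longrightarrow> \<bar>v x\<bar> \<le> B" using bounded_continuous[OF assms(2)] by blast
  have [measurable]: "f \<in> borel_measurable \<mu>" "v \<in> borel_measurable \<mu>"
    using assms by (auto intro: measurable_continuous)
  show ?thesis
  proof (rule Bochner_Integration.integrable_bound[where f = "\<lambda>x. B * f x"])
    show "AE x in \<mu>. norm (f x * v x) \<le> norm (B * f x)"
    proof (rule AE_I2)
      fix x assume "x \<in> space \<mu>"
      then have "\<bar>v x\<bar> * \<bar>f x\<bar> \<le> B * \<bar>f x\<bar>" using B by (intro mult_right_mono) (auto simp: space_measure)
      then show "norm (f x * v x) \<le> norm (B * f x)" using B(1) by (simp add: abs_mult mult.commute)
    qed
  qed (use assms in auto)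
qed

lemma emeasure_self_similar:
  assumes "A \<in> sets \<mu>" shows "emeasure \<mu> A = (\<Sum>i\<in>UNIV. ennreal (1 / 3) * emeasure \<mu> (F i -` A \<inter> space \<mu>))"
proof -
  have "measure \<mu> A = (\<Sum>i\<in>UNIV. (1 / 3) * measure \<mu> (F i -` A \<inter> space \<mu>))"
    using self_similar assms unfolding self_similar_measure_def
    by (auto simp: space_measure vimage_def Int_def conj_commute)
  then have "emeasure \<mu> A = (\<Sum>i\<in>UNIV. ennreal ((1 / 3) * measure \<mu> (F i -` A \<inter> space \<mu>)))"
    by (simp add: emeasure_eq_measure)
  also have "\<dots> = (\<Sum>i\<in>UNIV. ennreal (1 / 3) * emeasure \<mu> (F i -` A \<inter> space \<mu>))"
    by (intro sum.cong refl) (simp only: emeasure_eq_measure ennreal_mult' measure_nonneg)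
  finally show ?thesis .
qed

lemma nn_integral_self_similar:
  assumes "g \<in> borel_measurable \<mu>"
  shows "(\<integral>\<^sup>+x. g x \<partial>\<mu>) = (\<Sum>i\<in>UNIV. ennreal (1 / 3) * (\<integral>\<^sup>+x. g (F i x) \<partial>\<mu>))"
  using assms
proof (induction rule: borel_measurable_induct)
  case (cong f g)
  have "(\<integral>\<^sup>+x. f x \<partial>\<mu>) = (\<integral>\<^sup>+x. g x \<partial>\<mu>)" by (intro nn_integral_cong cong)
  moreover have "(\<integral>\<^sup>+x. f (F i x) \<partial>\<mu>) = (\<integral>\<^sup>+x. g (F i x) \<partial>\<mu>)" for i
    by (intro nn_integral_cong cong) (simp add: space_measure)
  ultimately show ?case using cong by simp
next
  case (set A)
  have "(\<integral>\<^sup>+x. indicator A (F i x) \<partial>\<mu>) = emeasure \<mu> (F i -` A \<inter> space \<mu>)" for i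
  proof -
    have "(\<integral>\<^sup>+x. indicator A (F i x) \<partial>\<mu>) = (\<integral>\<^sup>+x. indicator (F i -` A \<inter> space \<mu>) x \<partial>\<mu>)"
      by (intro nn_integral_cong) (auto split: split_indicator)
    then show ?thesis using set by simp
  qed
  then show ?case using emeasure_self_similar[OF set] set by simp
next
  case (mult u c)
  have "(\<integral>\<^sup>+x. c * u (F i x) \<partial>\<mu>) = c * (\<integral>\<^sup>+x. u (F i x) \<partial>\<mu>)" for i
    by (intro nn_integral_cmult measurable_compose[OF measurable_F] mult)
  then show ?case using mult by (simp add: nn_integral_cmult sum_distrib_left mult.left_commute)
next
  case (add u v)
  have "(\<integral>\<^sup>+x. v (F i x) + u (F i x) \<partial>\<mu>) = (\<integral>\<^sup>+x. v (F i x) \<partial>\<mu>) + (\<integral>\<^sup>+x. u (F i x) \<partial>\<mu>)" for i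
    by (intro nn_integral_add measurable_compose[OF measurable_F] add)
  then show ?case using add by (simp add: nn_integral_add distrib_left sum.distrib)
next
  case (seq U)
  note [measurable] = seq(1)
  have inc: "incseq (\<lambda>n x. U n (F i x))" for i using \<open>incseq U\<close> by (auto simp: incseq_def le_fun_def)
  have "(\<integral>\<^sup>+x. (SUP n. U n) x \<partial>\<mu>) = (SUP n. \<integral>\<^sup>+x. U n x \<partial>\<mu>)"
    using \<open>incseq U\<close> by (simp add: nn_integral_monotone_convergence_SUP image_comp)
  also have "\<dots> = (SUP n. \<Sum>i\<in>UNIV. ennreal (1 / 3) * (\<integral>\<^sup>+x. U n (F i x) \<partial>\<mu>))"
    using seq by simp
  also have "\<dots> = (\<Sum>i\<in>UNIV. SUP n. ennreal (1 / 3) * (\<integral>\<^sup>+x. U n (F i x) \<partial>\<mu>))"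
    using inc by (intro ennreal_SUP_sum)
      (auto simp: incseq_def le_fun_def intro!: mult_left_mono nn_integral_mono)
  also have "\<dots> = (\<Sum>i\<in>UNIV. ennreal (1 / 3) * (SUP n. \<integral>\<^sup>+x. U n (F i x) \<partial>\<mu>))"
    by (simp add: SUP_mult_left_ennreal)
  also have "\<dots> = (\<Sum>i\<in>UNIV. ennreal (1 / 3) * (\<integral>\<^sup>+x. (SUP n. U n (F i x)) \<partial>\<mu>))"
    using inc by (simp add: nn_integral_monotone_convergence_SUP)
  finally show ?case by (simp add: image_comp)
qed

lemma integrable_self_similar:
  assumes [measurable]: "(g :: real ^ 2 \<Rightarrow> real) \<in> borel_measurable \<mu>"
  shows "integrable \<mu> g \<longleftrightarrow> (\<forall>i. integrable \<mu> (\<lambda>x. g (F i x)))"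
proof -
  have "(\<integral>\<^sup>+x. norm (g x) \<partial>\<mu>) = (\<Sum>i\<in>UNIV. ennreal (1 / 3) * (\<integral>\<^sup>+x. norm (g (F i x)) \<partial>\<mu>))"
    by (rule nn_integral_self_similar) measurable
  moreover have "x = 0 \<or> x < top \<longleftrightarrow> x < top" for x :: ennreal by auto
  ultimately have "(\<integral>\<^sup>+x. norm (g x) \<partial>\<mu>) < \<infinity> \<longleftrightarrow> (\<forall>i. (\<integral>\<^sup>+x. norm (g (F i x)) \<partial>\<mu>) < \<infinity>)"
    by (auto simp: ennreal_mult_less_top)
  then show ?thesis by (auto simp: integrable_iff_bounded)
qed

lemma integral_self_similar:
  assumes "integrable \<mu> (g :: real ^ 2 \<Rightarrow> real)"
  shows "(\<integral>x. g x \<partial>\<mu>) = (1 / 3) * (\<Sum>i\<in>UNIV. \<integral>x. g (F i x) \<partial>\<mu>)"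
proof -
  have [measurable]: "g \<in> borel_measurable \<mu>" using assms by simp
  have int: "integrable \<mu> (\<lambda>x. g (F i x))" for i
    using assms integrable_self_similar[of g] by blast
  have fin: "(\<integral>\<^sup>+x. ennreal (g (F i x)) \<partial>\<mu>) < \<infinity>" "(\<integral>\<^sup>+x. ennreal (- g (F i x)) \<partial>\<mu>) < \<infinity>" for i
    using int[of i] unfolding real_integrable_def less_top infinity_ennreal_def by blast+
  have "enn2real (\<integral>\<^sup>+x. ennreal (h x) \<partial>\<mu>) = (1 / 3) * (\<Sum>i\<in>UNIV. enn2real (\<integral>\<^sup>+x. ennreal (h (F i x)) \<partial>\<mu>))"
    if [measurable]: "h \<in> borel_measurable \<mu>" and "\<And>i. (\<integral>\<^sup>+x. ennreal (h (F i x)) \<partial>\<mu>) < \<infinity>" for h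
  proof -
    have "enn2real (\<integral>\<^sup>+x. ennreal (h x) \<partial>\<mu>) = enn2real (\<Sum>i\<in>UNIV. ennreal (1 / 3) * (\<integral>\<^sup>+x. ennreal (h (F i x)) \<partial>\<mu>))"
      by (subst nn_integral_self_similar) simp_all
    also have "\<dots> = (\<Sum>i\<in>UNIV. enn2real (ennreal (1 / 3) * (\<integral>\<^sup>+x. ennreal (h (F i x)) \<partial>\<mu>)))"
      by (subst enn2real_sum) (use that(2) in \<open>simp_all add: ennreal_mult_less_top\<close>)
    finally show ?thesis by (simp add: enn2real_mult sum_distrib_left)
  qed
  note * = this[of g, OF _ fin(1)] this[of "\<lambda>x. - g x", OF _ fin(2)]
  show ?thesis
    unfolding real_lebesgue_integral_def[OF assms] real_lebesgue_integral_def[OF int]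
    by (simp add: * sum_subtractf right_diff_distrib diff_divide_distrib)
qed

lemma integral_self_similar_words:
  assumes "integrable \<mu> (g :: real ^ 2 \<Rightarrow> real)"
  shows "(\<integral>x. g x \<partial>\<mu>) = (1 / 3) ^ m * (\<Sum>w\<in>{w. length w = m}. \<integral>x. g (Fw w x) \<partial>\<mu>)"
  using assms
proof (induction m arbitrary: g)
  case (Suc m)
  have "integrable \<mu> (\<lambda>x. g (F i x))" for i
    using Suc.prems integrable_self_similar[of g] by auto
  then have "(\<integral>x. g (F i x) \<partial>\<mu>) = (1 / 3) ^ m * (\<Sum>w\<in>{w. length w = m}. \<integral>x. g (F i (Fw w x)) \<partial>\<mu>)" for i
    by (rule Suc.IH[of "\<lambda>x. g (F i x)"])
  then show ?case
    by (simp add: integral_self_similar[OF Suc.prems] sum_words_Suc sum_distrib_left)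
qed simp

lemma AE_F: assumes "AE x in \<mu>. P x" shows "AE x in \<mu>. P (F i x)"
proof -
  obtain N where N: "{x \<in> space \<mu>. \<not> P x} \<subseteq> N" "N \<in> sets \<mu>" "emeasure \<mu> N = 0"
    using assms by (auto elim: AE_E)
  have "(\<Sum>i\<in>UNIV. ennreal (1 / 3) * emeasure \<mu> (F i -` N \<inter> space \<mu>)) = 0"
    using emeasure_self_similar[OF N(2)] N(3) by simp
  then have "emeasure \<mu> (F i -` N \<inter> space \<mu>) = 0"
    by (subst (asm) sum_nonneg_eq_0_iff) auto
  moreover have "{x \<in> space \<mu>. \<not> P (F i x)} \<subseteq> F i -` N \<inter> space \<mu>"
    using N(1) F_in by (fastforce simp: space_measure)
  ultimately show ?thesis using N(2) by (intro AE_I[of _ _ "F i -` N \<inter> space \<mu>"]) auto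
qed

lemma AE_Fw: assumes "AE x in \<mu>. P x" shows "AE x in \<mu>. P (Fw w x)"
  using assms
proof (induction w arbitrary: P)
  case (Cons i w)
  then show ?case using Cons.IH[of "\<lambda>x. P (F i x)"] AE_F[of P i] by simp
qed simp

text \<open>The preimage of \<open>{q i}\<close> in the gasket is \<open>{q i}\<close> under
  \<open>F i\<close> and empty under the other maps. So its measure is one third of itself.\<close>

lemma AE_not_corner: "AE x in \<mu>. x \<notin> range q"
proof -
  have "AE x in \<mu>. x \<noteq> q i" for i
  proof -
    have s: "{q i} \<in> sets \<mu>" unfolding sets_measure
      by (subst sets_restrict_space_iff) (auto simp: borel_closed[OF closed_SG])
    have "{x \<in> K. F j x \<in> {q i}} = (if i = j then {q i} else {})" for j
      using F_eq_cornerD by (auto simp: F_q)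
    moreover have "measure \<mu> {q i} = (\<Sum>j\<in>UNIV. (1 / 3) * measure \<mu> {x \<in> K. F j x \<in> {q i}})"
      using self_similar s unfolding self_similar_measure_def by blast
    ultimately have "measure \<mu> {q i} = (\<Sum>j\<in>UNIV. if i = j then (1 / 3) * measure \<mu> {q i} else 0)"
      by (simp only: if_distrib[of "\<lambda>A. (1 / 3) * measure \<mu> A"] measure_empty mult_zero_right)
    then have "measure \<mu> {q i} = 0" by simp
    then have "emeasure \<mu> {q i} = 0" by (simp add: emeasure_eq_measure)
    then show ?thesis using s by (intro AE_I[of _ _ "{q i}"]) auto
  qed
  then have "AE x in \<mu>. \<forall>i\<in>UNIV. x \<noteq> q i" by (intro AE_finite_allI) auto
  then show ?thesis unfolding image_iff by simp
qed

lemma sets_cell: "F i ` K \<in> sets \<mu>"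
proof -
  have "closed (F i ` K)" by (intro compact_imp_closed compact_continuous_image continuous_F compact_SG)
  then show ?thesis unfolding sets_measure
    by (subst sets_restrict_space_iff) (auto simp: borel_closed[OF closed_SG] borel_closed)
qed

lemma measurable_glue [measurable]:
  assumes [measurable]: "\<And>i. g i \<in> borel_measurable \<mu>" shows "glue g \<in> borel_measurable \<mu>"
proof -
  \<comment> \<open>Outside the cell the inverse of \<open>F i\<close> would leave the gasket.
    Sending such points to \<open>q i\<close> keeps \<open>G i\<close> a map of the gasket into
    itself, as measurability with respect to \<open>\<mu>\<close> on both sides requires.\<close>
  define G where "G i x = (if x \<in> F i ` K then 2 *\<^sub>R x - q i else q i)" for i x
  have cl: "F i ` K \<in> sets borel" for i
    by (intro borel_closed compact_imp_closed compact_continuous_image continuous_F compact_SG)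
  have [measurable]: "G i \<in> \<mu> \<rightarrow>\<^sub>M \<mu>" for i
  proof (rule measurable_self)
    show "G i \<in> borel \<rightarrow>\<^sub>M borel" unfolding G_def using cl[of i] by measurable
    show "G i \<in> K \<rightarrow> K" by (auto simp: G_def F_inverse)
  qed
  note [measurable] = sets_cell
  have "(\<lambda>x. if x \<in> F 0 ` K then g 0 (G 0 x) else if x \<in> F 1 ` K then g 1 (G 1 x) else g 2 (G 2 x)) \<in> borel_measurable \<mu>"
    by measurable
  moreover have "glue g x = (if x \<in> F 0 ` K then g 0 (G 0 x) else if x \<in> F 1 ` K then g 1 (G 1 x) else g 2 (G 2 x))"
    if "x \<in> space \<mu>" for x
    using cell_of[of x] that unfolding glue_def G_def space_measure by (auto simp: cell_of_def)
  ultimately show ?thesis by (subst measurable_cong)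
qed

text \<open>On a small cell, both the quadrature and the integral are close to a corner value of
  \<open>harm f\<close> times the mean of \<open>v\<close>. The corner differences of
  \<open>f\<close> shrink by 3/5 per level and cost 1 (for \<open>gram\<close>) plus 15 (from
  \<open>harm_near\<close>), whence 16; the oscillation of \<open>v\<close> costs
  \<open>C * e\<close>.\<close>

lemma gram_form_approximates:
  assumes "continuous_on K v" "\<And>i. \<bar>f i\<bar> \<le> C" "\<bar>f 0 - f 1\<bar> + \<bar>f 1 - f 2\<bar> + \<bar>f 0 - f 2\<bar> \<le> d"
    and "\<And>x. x \<in> K \<Longrightarrow> \<bar>v x\<bar> \<le> B"
    and "\<And>w x y. length w = n \<Longrightarrow> x \<in> K \<Longrightarrow> y \<in> K \<Longrightarrow> \<bar>v (Fw w x) - v (Fw w y)\<bar> \<le> e"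
  shows "\<bar>gram_form n f v - (\<integral>x. harm f x * v x \<partial>\<mu>)\<bar> \<le> 16 * (3 / 5) ^ n * d * B + C * e"
  using assms
proof (induction n arbitrary: f v d)
  case 0
  have ivm: "integrable \<mu> v" "integrable \<mu> (\<lambda>x. harm f x * v x)"
    using 0(1) by (auto intro!: integrable_continuous continuous_intros continuous_harm)
  have d: "d \<ge> 0" "\<bar>f i - f 0\<bar> \<le> d" "\<bar>f i - f 1\<bar> \<le> d" "\<bar>f i - f 2\<bar> \<le> d" for i
  proof -
    have "\<bar>f 0 - f 1\<bar> \<le> d" "\<bar>f 1 - f 2\<bar> \<le> d" "\<bar>f 0 - f 2\<bar> \<le> d" "d \<ge> 0" using 0(3) by linarith+
    moreover from this have "\<bar>f 1 - f 0\<bar> \<le> d" "\<bar>f 2 - f 1\<bar> \<le> d" "\<bar>f 2 - f 0\<bar> \<le> d"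
      by (simp_all add: abs_minus_commute)
    ultimately show "d \<ge> 0" "\<bar>f i - f 0\<bar> \<le> d" "\<bar>f i - f 1\<bar> \<le> d" "\<bar>f i - f 2\<bar> \<le> d"
      by (cases i rule: cases_3; simp)+
  qed
  have B: "B \<ge> 0" using 0(4)[OF q_in[of 0]] by linarith
  have a: "\<bar>gram f j - f 0 / 3\<bar> \<le> d / 3" for j
  proof -
    have "gram f j - f 0 / 3 = (4 * ((f 1 - f 0) + (f 2 - f 0)) + 3 * (f j - f 0)) / 45"
      by (simp add: gram_def sum_3_eq field_simps)
    moreover have "\<bar>4 * ((f 1 - f 0) + (f 2 - f 0)) + 3 * (f j - f 0)\<bar> \<le> 15 * d"
      using d(1) d(2)[of 1] d(2)[of 2] d(2)[of j] unfolding abs_le_iff by argo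
    ultimately show ?thesis by (simp only: abs_divide) simp
  qed
  have 1: "\<bar>gram_form 0 f v - f 0 * ((v (q 0) + v (q 1) + v (q 2)) / 3)\<bar> \<le> d * B"
  proof -
    have b: "\<bar>(gram f j - f 0 / 3) * v (q j)\<bar> \<le> d / 3 * B" for j
      unfolding abs_mult by (intro mult_mono a 0(4)) (use d in auto)
    have "gram_form 0 f v - f 0 * ((v (q 0) + v (q 1) + v (q 2)) / 3) = (gram f 0 - f 0 / 3) * v (q 0)
      + (gram f 1 - f 0 / 3) * v (q 1) + (gram f 2 - f 0 / 3) * v (q 2)"
      by (simp add: sum_3_eq algebra_simps)
    then show ?thesis using b[of 0] b[of 1] b[of 2] by linarith
  qed
  have abs_integral: "\<bar>\<integral>x. g x \<partial>\<mu>\<bar> \<le> c" if "integrable \<mu> g" "\<And>x. x \<in> K \<Longrightarrow> \<bar>g x\<bar> \<le> c" for g :: "real ^ 2 \<Rightarrow> real" and c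
  proof -
    have "\<bar>\<integral>x. g x \<partial>\<mu>\<bar> \<le> (\<integral>x. \<bar>g x\<bar> \<partial>\<mu>)" using integral_norm_bound[of \<mu> g] by simp
    also have "\<dots> \<le> c" by (rule integral_le_const) (use that in \<open>auto simp: space_measure\<close>)
    finally show ?thesis .
  qed
  have 2: "\<bar>(\<integral>x. harm f x * v x \<partial>\<mu>) - f 0 * (\<integral>x. v x \<partial>\<mu>)\<bar> \<le> 15 * d * B"
  proof -
    have "(\<integral>x. harm f x * v x \<partial>\<mu>) - f 0 * (\<integral>x. v x \<partial>\<mu>) = (\<integral>x. harm f x * v x - f 0 * v x \<partial>\<mu>)"
      using ivm by simp
    also have "\<bar>\<dots>\<bar> \<le> 15 * d * B"
    proof (rule abs_integral)
      show "\<bar>harm f x * v x - f 0 * v x\<bar> \<le> 15 * d * B" if x: "x \<in> K" for x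
      proof -
        have "\<bar>harm f x * v x - f 0 * v x\<bar> = \<bar>harm f x - f 0\<bar> * \<bar>v x\<bar>"
          by (simp add: abs_mult[symmetric] algebra_simps)
        also have "\<dots> \<le> (15 * d) * B"
          using harm_near[OF x, of f 0] 0(3) 0(4)[OF x] d by (intro mult_mono) auto
        finally show ?thesis .
      qed
    qed (use ivm in auto)
    finally show ?thesis .
  qed
  have 3: "\<bar>f 0 * ((v (q 0) + v (q 1) + v (q 2)) / 3) - f 0 * (\<integral>x. v x \<partial>\<mu>)\<bar> \<le> C * e"
  proof -
    have "((v (q 0) + v (q 1) + v (q 2)) / 3) - (\<integral>x. v x \<partial>\<mu>) = (\<integral>x. (v (q 0) + v (q 1) + v (q 2)) / 3 - v x \<partial>\<mu>)"
      using ivm prob_space by simp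
    also have "\<bar>\<dots>\<bar> \<le> e"
    proof (rule abs_integral)
      show "\<bar>(v (q 0) + v (q 1) + v (q 2)) / 3 - v x\<bar> \<le> e" if x: "x \<in> K" for x
        using 0(5)[of "[]" "q 0" x] 0(5)[of "[]" "q 1" x] 0(5)[of "[]" "q 2" x] x
        by (simp add: abs_le_iff) argo
    qed (use ivm in auto)
    finally have "\<bar>f 0\<bar> * \<bar>((v (q 0) + v (q 1) + v (q 2)) / 3) - (\<integral>x. v x \<partial>\<mu>)\<bar> \<le> C * e"
      using 0(2)[of 0] by (intro mult_mono) auto
    then show ?thesis by (simp only: abs_mult[symmetric] right_diff_distrib)
  qed
  show ?case using 1 2 3 by simp
next
  case (Suc n)
  have int: "integrable \<mu> (\<lambda>x. harm f x * v x)"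
    using Suc.prems(1) by (auto intro!: integrable_continuous continuous_intros continuous_harm)
  have *: "\<bar>gram_form n (harm_sub i f) (\<lambda>x. v (F i x)) - (\<integral>x. harm f (F i x) * v (F i x) \<partial>\<mu>)\<bar>
      \<le> 16 * (3 / 5) ^ n * (3 / 5 * d) * B + C * e" for i
  proof -
    have "\<bar>gram_form n (harm_sub i f) (\<lambda>x. v (F i x)) - (\<integral>x. harm (harm_sub i f) x * v (F i x) \<partial>\<mu>)\<bar>
      \<le> 16 * (3 / 5) ^ n * (3 / 5 * d) * B + C * e"
    proof (rule Suc.IH)
      show "continuous_on K (\<lambda>x. v (F i x))" using Suc.prems(1) continuous_on_SG_iff by blast
      show "\<bar>harm_sub i f j\<bar> \<le> C" for j
        using Suc.prems(2)[of i] Suc.prems(2)[of j] Suc.prems(2)[of "- (i + j)"]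
        unfolding harm_sub_def abs_le_iff by argo
      note abs_bounds = abs_ge_self[of "f 0 - f 1"] abs_ge_minus_self[of "f 0 - f 1"]
        abs_ge_self[of "f 1 - f 2"] abs_ge_minus_self[of "f 1 - f 2"]
        abs_ge_self[of "f 0 - f 2"] abs_ge_minus_self[of "f 0 - f 2"]
      define A where "A j k = \<bar>f j - f k\<bar>" for j k
      have A: "A 1 0 = A 0 1" "A 2 0 = A 0 2" "A 2 1 = A 1 2" by (simp_all add: A_def abs_minus_commute)
      define g where "g = harm_sub i f"
      have "\<bar>g j - g k\<bar> \<le> (if i = j \<or> i = k then 2 / 5 * A j k + 1 / 5 * A i (- (j + k)) else 1 / 5 * A j k)"
        if "j \<noteq> k" for j k
        unfolding A_def g_def using that
        by (cases i rule: cases_3; cases j rule: cases_3; cases k rule: cases_3;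
            intro abs_leI; simp add: harm_subs uminus_3; use abs_bounds in argo)
      from add_mono[OF add_mono[OF this[of 0 1] this[of 1 2]] this[of 0 2]]
      have "\<bar>g 0 - g 1\<bar> + \<bar>g 1 - g 2\<bar> + \<bar>g 0 - g 2\<bar>
        \<le> (if i = 0 \<or> i = 1 then 2 / 5 * A 0 1 + 1 / 5 * A i (- (0 + 1)) else 1 / 5 * A 0 1)
        + (if i = 1 \<or> i = 2 then 2 / 5 * A 1 2 + 1 / 5 * A i (- (1 + 2)) else 1 / 5 * A 1 2)
        + (if i = 0 \<or> i = 2 then 2 / 5 * A 0 2 + 1 / 5 * A i (- (0 + 2)) else 1 / 5 * A 0 2)"
        by simp
      also have "\<dots> \<le> 3 / 5 * (A 0 1 + A 1 2 + A 0 2)"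
        using abs_ge_zero[of "f 0 - f 1"] abs_ge_zero[of "f 1 - f 2"] abs_ge_zero[of "f 0 - f 2"]
        unfolding A_def[symmetric] by (cases i rule: cases_3; simp add: uminus_3 A)
      also have "\<dots> \<le> 3 / 5 * d" using Suc.prems(3) by (simp add: A_def)
      finally show "\<bar>harm_sub i f 0 - harm_sub i f 1\<bar> + \<bar>harm_sub i f 1 - harm_sub i f 2\<bar> +
          \<bar>harm_sub i f 0 - harm_sub i f 2\<bar> \<le> 3 / 5 * d" by (simp add: g_def)
      show "\<bar>v (F i x)\<bar> \<le> B" if "x \<in> K" for x using Suc.prems(4) that by simp
      show "\<bar>v (F i (Fw w x)) - v (F i (Fw w y))\<bar> \<le> e" if "length w = n" "x \<in> K" "y \<in> K" for w x y
        using Suc.prems(5)[of "i # w" x y] that by simp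
    qed
    also have "(\<integral>x. harm (harm_sub i f) x * v (F i x) \<partial>\<mu>) = (\<integral>x. harm f (F i x) * v (F i x) \<partial>\<mu>)"
      by (intro Bochner_Integration.integral_cong) (simp_all add: space_measure harm_F)
    finally show ?thesis .
  qed
  have "gram_form (Suc n) f v - (\<integral>x. harm f x * v x \<partial>\<mu>) = (1 / 3) * (\<Sum>i\<in>UNIV.
      gram_form n (harm_sub i f) (\<lambda>x. v (F i x)) - (\<integral>x. harm f (F i x) * v (F i x) \<partial>\<mu>))"
    by (simp add: integral_self_similar[OF int] sum_subtractf right_diff_distrib)
  also have "\<bar>\<dots>\<bar> \<le> (1 / 3) * (\<Sum>i\<in>(UNIV :: 3 set). 16 * (3 / 5) ^ n * (3 / 5 * d) * B + C * e)"
    unfolding abs_mult by (intro mult_mono order_trans[OF sum_abs] sum_mono *) auto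
  also have "\<dots> = 16 * (3 / 5) ^ Suc n * d * B + C * e" by simp
  finally show ?case .
qed

lemma small_cells:
  assumes "continuous_on K (v :: real ^ 2 \<Rightarrow> real)" "e > 0"
  obtains N where "\<And>n w x y. n \<ge> N \<Longrightarrow> length w = n \<Longrightarrow> x \<in> K \<Longrightarrow> y \<in> K \<Longrightarrow> \<bar>v (Fw w x) - v (Fw w y)\<bar> \<le> e"
proof -
  obtain d where d: "d > 0" "\<And>x y. x \<in> K \<Longrightarrow> y \<in> K \<Longrightarrow> dist y x < d \<Longrightarrow> dist (v y) (v x) < e"
    using compact_uniformly_continuous[OF assms(1) compact_SG] assms(2) unfolding uniformly_continuous_on_def by blast
  obtain D where D: "D > 0" "\<And>x y. x \<in> K \<Longrightarrow> y \<in> K \<Longrightarrow> dist x y \<le> D"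
  proof -
    obtain D where "\<And>x y. x \<in> K \<Longrightarrow> y \<in> K \<Longrightarrow> dist x y \<le> D"
      using compact_imp_bounded[OF compact_SG] unfolding bounded_two_points by blast
    then show thesis by (intro that[of "max D 1"]) (auto simp: le_max_iff_disj)
  qed
  obtain N where N: "(1 / 2) ^ N < d / D" using real_arch_pow_inv[of "d / D" "1 / 2"] d D by auto
  have "\<bar>v (Fw w x) - v (Fw w y)\<bar> \<le> e" if "n \<ge> N" "length w = n" "x \<in> K" "y \<in> K" for n w x y
  proof -
    have "dist (Fw w x) (Fw w y) = dist x y * (1 / 2) ^ n" by (simp add: dist_Fw that power_one_over divide_simps)
    also have "\<dots> \<le> D * (1 / 2) ^ N" using that D by (intro mult_mono power_decreasing) auto
    also have "\<dots> < d" using N D by (simp add: field_simps)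
    finally show ?thesis using d(2)[of "Fw w y" "Fw w x"] that by (auto simp: dist_real_def)
  qed
  then show thesis using that by blast
qed

lemma gram_form_lim:
  assumes v: "continuous_on K v"
  shows "(\<lambda>n. gram_form n f v) \<longlonglongrightarrow> (\<integral>x. harm f x * v x \<partial>\<mu>)"
proof -
  obtain B where B: "B \<ge> 0" "\<And>x. x \<in> K \<Longrightarrow> \<bar>v x\<bar> \<le> B" using bounded_continuous[OF v] by blast
  define C where "C = \<bar>f 0\<bar> + \<bar>f 1\<bar> + \<bar>f 2\<bar>"
  have C: "\<bar>f i\<bar> \<le> C" for i by (cases i rule: cases_3) (simp_all add: C_def)
  then have C0: "C \<ge> 0" using abs_ge_zero order_trans by blast
  define d where "d = \<bar>f 0 - f 1\<bar> + \<bar>f 1 - f 2\<bar> + \<bar>f 0 - f 2\<bar>"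
  show ?thesis
  proof (rule LIMSEQ_I)
    fix r :: real assume r: "r > 0"
    define e where "e = r / (4 * (C + 1))"
    have e: "e > 0" "C * e \<le> r / 2"
    proof -
      show "e > 0" using r C0 by (simp add: e_def)
      have "C * e \<le> (C + 1) * e" using \<open>e > 0\<close> by (simp add: algebra_simps)
      also have "(C + 1) * e = r / 4" using C0 by (simp add: e_def field_simps)
      finally show "C * e \<le> r / 2" using r by simp
    qed
    obtain N where N: "\<And>n w x y. n \<ge> N \<Longrightarrow> length w = n \<Longrightarrow> x \<in> K \<Longrightarrow> y \<in> K \<Longrightarrow> \<bar>v (Fw w x) - v (Fw w y)\<bar> \<le> e"
      using small_cells[OF v e(1)] by blast
    have "(\<lambda>n. 16 * (3 / 5 :: real) ^ n * d * B) \<longlonglongrightarrow> 16 * 0 * d * B"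
      by (intro tendsto_intros LIMSEQ_power_zero) simp
    then have "\<forall>\<^sub>F n in sequentially. 16 * (3 / 5) ^ n * d * B < r / 2"
      using r by (intro order_tendstoD) auto
    then obtain N' where N': "\<And>n. n \<ge> N' \<Longrightarrow> 16 * (3 / 5) ^ n * d * B < r / 2"
      unfolding eventually_sequentially by blast
    have "norm (gram_form n f v - (\<integral>x. harm f x * v x \<partial>\<mu>)) < r" if "n \<ge> max N N'" for n
    proof -
      have "\<bar>gram_form n f v - (\<integral>x. harm f x * v x \<partial>\<mu>)\<bar> \<le> 16 * (3 / 5) ^ n * d * B + C * e"
        by (rule gram_form_approximates) (use v C B N that in \<open>auto simp: d_def\<close>)
      then show ?thesis using N'[of n] that e by simp
    qed
    then show "\<exists>no. \<forall>n\<ge>no. norm (gram_form n f v - (\<integral>x. harm f x * v x \<partial>\<mu>)) < r" by blast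
  qed
qed

text \<open>The quadrature converges to the integral and is constant on harmonic functions. So
  \<open>gram\<close> is indeed the L2 Gram matrix.\<close>

lemma integral_harm_harm: "(\<integral>x. harm f x * harm g x \<partial>\<mu>) = (\<Sum>j\<in>UNIV. gram f j * g j)"
  using LIMSEQ_unique[OF gram_form_lim[OF continuous_harm, of f g]] by (simp add: gram_form_harm)

lemma cell_form_biharm_lim:
  assumes "continuous_on K v"
  shows "(\<lambda>n. cell_form n (biharm s) v) \<longlonglongrightarrow>
    - (\<integral>x. harm (snd s) x * v x \<partial>\<mu>) + (\<Sum>j\<in>UNIV. corner_deriv s j * v (q j))"
  unfolding cell_form_biharm by (intro tendsto_intros gram_form_lim assms)

text \<open>The discrete identity with \<open>v = biharm s\<close> makes the cell forms of
  \<open>biharm s\<close> converge, hence bounded.\<close>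

lemma biharm_in_dom: "biharm s \<in> dom_energy q"
proof -
  have "convergent (\<lambda>n. cell_form n (biharm s) (biharm s))"
    by (rule convergentI[OF cell_form_biharm_lim[OF continuous_biharm]])
  then have "Bseq (\<lambda>n. cell_form n (biharm s) (biharm s))" by (rule convergent_imp_Bseq)
  then obtain B where "\<And>n. norm (cell_form n (biharm s) (biharm s)) \<le> B" by (auto simp: Bseq_def)
  then have "\<forall>n. cell_form n (biharm s) (biharm s) \<le> B" by (simp add: abs_le_iff)
  then show ?thesis unfolding dom_energy_iff using continuous_biharm by blast
qed

lemma energy_form_biharm:
  assumes "v \<in> dom_energy q"
  shows "energy_form q (biharm s) v =
    - (\<integral>x. harm (snd s) x * v x \<partial>\<mu>) + (\<Sum>j\<in>UNIV. corner_deriv s j * v (q j))"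
  by (rule energy_form_eqI[OF biharm_in_dom assms cell_form_biharm_lim[OF dom_energy_continuous[OF assms]]])

lemma harm_in_dom: "harm a \<in> dom_energy q" by (simp add: harm_def biharm_in_dom)

lemma energy_form_harm:
  assumes "v \<in> dom_energy q"
  shows "energy_form q (harm a) v = (\<Sum>j\<in>UNIV. (3 * a j - (\<Sum>k\<in>UNIV. a k)) * v (q j))"
proof -
  have "harm (\<lambda>_. 0) x = 0" if "x \<in> K" for x using harm_near[OF that, of "\<lambda>_. 0" 0] by simp
  then have "(\<integral>x. harm (\<lambda>_. 0) x * v x \<partial>\<mu>) = (\<integral>x. 0 \<partial>\<mu>)"
    by (intro Bochner_Integration.integral_cong) (simp_all add: space_measure)
  then show ?thesis
    using energy_form_biharm[OF assms, of "(a, \<lambda>_. 0)"] by (simp add: harm_def corner_deriv_def gram_def)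
qed

lemma continuous_in_L2: assumes "continuous_on K f" shows "f \<in> L2_fun \<mu>"
  unfolding L2_fun_def using assms
  by (auto intro!: measurable_continuous integrable_continuous continuous_intros)

lemma has_laplacian_biharm: "has_laplacian q \<mu> (biharm s) (harm (snd s))"
  unfolding has_laplacian_def
  by (auto simp: biharm_in_dom continuous_in_L2 continuous_harm energy_form_biharm)

subsection \<open>The Gauss-Green formula and normal derivatives\<close>

lemma integrable_L2: "f \<in> L2_fun \<mu> \<Longrightarrow> integrable \<mu> f"
  unfolding L2_fun_def by (auto intro: square_integrable_imp_integrable)

lemma has_laplacianD:
  assumes "has_laplacian q \<mu> u f"
  shows "u \<in> dom_energy q" "f \<in> L2_fun \<mu>" "integrable \<mu> f" "f \<in> borel_measurable \<mu>" "integrable \<mu> (\<lambda>x. (f x)\<^sup>2)"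
  using assms by (auto simp: has_laplacian_def L2_fun_def intro: integrable_L2)

lemma has_laplacian_test:
  assumes "has_laplacian q \<mu> u f" "v \<in> dom_energy q" "\<And>i. v (q i) = 0"
  shows "energy_form q u v = - (\<integral>x. f x * v x \<partial>\<mu>)"
  using assms unfolding has_laplacian_def by auto

lemma zero_in_dom: "(\<lambda>_. 0) \<in> dom_energy q"
  using dom_energy_scale[OF harm_in_dom, of 0] by simp

lemma energy_form_zero_right: "u \<in> dom_energy q \<Longrightarrow> energy_form q u (\<lambda>_. 0) = 0"
  using energy_form_scale_right[of u "\<lambda>_. 0" 0] zero_in_dom by simp

lemma energy_form_glue:
  assumes "u \<in> dom_energy q" "\<And>i j. g i (q j) = g j (q i)" "\<And>i. g i \<in> dom_energy q"
  shows "energy_form q u (glue g) = 5 / 3 * (\<Sum>i\<in>UNIV. energy_form q (\<lambda>x. u (F i x)) (g i))"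
proof -
  have "energy_form q (\<lambda>x. u (F i x)) (\<lambda>x. glue g (F i x)) = energy_form q (\<lambda>x. u (F i x)) (g i)" for i
    by (rule energy_form_cong) (auto simp: assms dom_energy_F glue_F[where g = g, OF assms(2)])
  then show ?thesis
    using energy_form_self_similar[OF assms(1) dom_energy_glue[where g = g, OF assms(2,3)]] by simp
qed

lemma glue_q: assumes "\<And>i j. g i (q j) = g j (q i)" shows "glue g (q i) = g i (q i)"
  using glue_F[where g = g, OF assms, of "q i" i] by (simp add: F_q)

lemma integral_mult_glue:
  assumes "integrable \<mu> f" "\<And>i j. g i (q j) = g j (q i)" "\<And>i. continuous_on K (g i)"
  shows "(\<integral>x. f x * glue g x \<partial>\<mu>) = (1 / 3) * (\<Sum>i\<in>UNIV. \<integral>x. f (F i x) * g i x \<partial>\<mu>)"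
proof -
  have "integrable \<mu> (\<lambda>x. f x * glue g x)"
    by (intro integrable_mult_continuous assms(1) continuous_glue assms(3) assms(2))
  then have "(\<integral>x. f x * glue g x \<partial>\<mu>) = (1 / 3) * (\<Sum>i\<in>UNIV. \<integral>x. f (F i x) * glue g (F i x) \<partial>\<mu>)"
    by (rule integral_self_similar)
  moreover have "(\<integral>x. f (F i x) * glue g (F i x) \<partial>\<mu>) = (\<integral>x. f (F i x) * g i x \<partial>\<mu>)" for i
    by (intro Bochner_Integration.integral_cong) (simp_all add: space_measure glue_F[where g = g, OF assms(2)])
  ultimately show ?thesis by simp
qed

lemma integrable_F: assumes "integrable \<mu> (f :: real ^ 2 \<Rightarrow> real)" shows "integrable \<mu> (\<lambda>x. f (F i x))"
proof -
  have "f \<in> borel_measurable \<mu>" using assms by simp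
  then show ?thesis using integrable_self_similar[of f] assms by blast
qed

lemma L2_F: assumes "f \<in> L2_fun \<mu>" shows "(\<lambda>x. f (F i x)) \<in> L2_fun \<mu>"
  using assms integrable_F[of "\<lambda>x. (f x)\<^sup>2" i] measurable_compose[OF measurable_F, of f]
  by (auto simp: L2_fun_def)

lemma L2_scale: assumes "f \<in> L2_fun \<mu>" shows "(\<lambda>x. c * f x) \<in> L2_fun \<mu>"
  using assms by (auto simp: L2_fun_def power_mult_distrib)

lemma L2_mult: assumes "f \<in> L2_fun \<mu>" "g \<in> L2_fun \<mu>" shows "integrable \<mu> (\<lambda>x. f x * g x)"
proof -
  have [measurable]: "f \<in> borel_measurable \<mu>" "g \<in> borel_measurable \<mu>" using assms by (auto simp: L2_fun_def)
  have int: "integrable \<mu> (\<lambda>x. (f x)\<^sup>2 + (g x)\<^sup>2)" using assms by (auto simp: L2_fun_def)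
  have b: "\<bar>f x * g x\<bar> \<le> (f x)\<^sup>2 + (g x)\<^sup>2" for x
  proof -
    have "0 \<le> (\<bar>f x\<bar> - \<bar>g x\<bar>)\<^sup>2" by simp
    then have "2 * \<bar>f x * g x\<bar> \<le> (f x)\<^sup>2 + (g x)\<^sup>2" by (simp add: power2_diff abs_mult)
    then show ?thesis using abs_ge_zero[of "f x * g x"] by linarith
  qed
  show ?thesis
    by (rule Bochner_Integration.integrable_bound[OF int]) (auto intro!: AE_I2 order_trans[OF b])
qed

lemma L2_diff: assumes "f \<in> L2_fun \<mu>" "g \<in> L2_fun \<mu>" shows "(\<lambda>x. f x - g x) \<in> L2_fun \<mu>"
proof -
  have "integrable \<mu> (\<lambda>x. (f x)\<^sup>2 + (g x)\<^sup>2 - 2 * (f x * g x))"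
    using assms L2_mult[OF assms] by (auto simp: L2_fun_def)
  then show ?thesis using assms by (auto simp: L2_fun_def power2_diff mult.assoc)
qed

lemma has_laplacian_diff:
  assumes "has_laplacian q \<mu> u f" "has_laplacian q \<mu> v g"
  shows "has_laplacian q \<mu> (\<lambda>x. u x - v x) (\<lambda>x. f x - g x)"
  unfolding has_laplacian_def
proof (intro conjI ballI impI)
  note d = has_laplacianD[OF assms(1)] has_laplacianD[OF assms(2)]
  show "(\<lambda>x. u x - v x) \<in> dom_energy q" using d by (intro dom_energy_diff)
  show "(\<lambda>x. f x - g x) \<in> L2_fun \<mu>" using d by (intro L2_diff)
  fix w assume w: "w \<in> dom_energy q" "\<forall>x\<in>sgV q 0. w x = 0"
  have "integrable \<mu> (\<lambda>x. f x * w x)" "integrable \<mu> (\<lambda>x. g x * w x)"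
    using d w by (auto intro!: integrable_mult_continuous dom_energy_continuous)
  then show "energy_form q (\<lambda>x. u x - v x) w = - (\<integral>x. (f x - g x) * w x \<partial>\<mu>)"
    using w d has_laplacian_test[OF assms(1) w(1)] has_laplacian_test[OF assms(2) w(1)]
    by (simp add: energy_form_diff_left left_diff_distrib)
qed

lemma has_laplacian_cong:
  assumes "has_laplacian q \<mu> u f" "\<And>x. x \<in> K \<Longrightarrow> u' x = u x"
  shows "has_laplacian q \<mu> u' f"
  using assms dom_energy_cong[of u u'] energy_form_cong[of u _ u'] unfolding has_laplacian_def by auto

text \<open>A test function vanishing at the corners extends by zero from the cell to the whole
  gasket through \<open>glue\<close>. The 5 is the quotient of the energy factor 5/3 and the measure
  factor 1/3.\<close>

lemma has_laplacian_F:
  assumes "has_laplacian q \<mu> u f"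
  shows "has_laplacian q \<mu> (\<lambda>x. u (F i x)) (\<lambda>x. f (F i x) / 5)"
  unfolding has_laplacian_def
proof (intro conjI ballI impI)
  note d = has_laplacianD[OF assms]
  show "(\<lambda>x. u (F i x)) \<in> dom_energy q" using d by (intro dom_energy_F)
  show "(\<lambda>x. f (F i x) / 5) \<in> L2_fun \<mu>" using L2_scale[OF L2_F[OF d(2)], of "1 / 5" i] by simp
  fix v assume v: "v \<in> dom_energy q" "\<forall>x\<in>sgV q 0. v x = 0"
  define g where "g j = (if j = i then v else (\<lambda>_. 0))" for j
  have v0: "v (q j) = 0" for j using v by simp
  have match: "g j (q l) = g l (q j)" for j l by (simp add: g_def v0)
  have dom: "g j \<in> dom_energy q" for j by (simp add: g_def v zero_in_dom)
  have vanish: "glue g (q j) = 0" for j using glue_q[where g = g, OF match, of j] by (simp add: g_def v0)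
  have "5 / 3 * (\<Sum>j\<in>UNIV. energy_form q (\<lambda>x. u (F j x)) (g j)) = energy_form q u (glue g)"
    by (rule energy_form_glue[symmetric]) (use d match dom in auto)
  also have "\<dots> = - (\<integral>x. f x * glue g x \<partial>\<mu>)"
    by (rule has_laplacian_test[OF assms dom_energy_glue[where g = g, OF match dom] vanish])
  also have "\<dots> = - ((1 / 3) * (\<Sum>j\<in>UNIV. \<integral>x. f (F j x) * g j x \<partial>\<mu>))"
    by (subst integral_mult_glue) (use d match dom dom_energy_continuous in auto)
  finally have "5 / 3 * (\<Sum>j\<in>UNIV. energy_form q (\<lambda>x. u (F j x)) (g j)) = - ((1 / 3) * (\<Sum>j\<in>UNIV. \<integral>x. f (F j x) * g j x \<partial>\<mu>))" .
  moreover have "(\<Sum>j\<in>UNIV. energy_form q (\<lambda>x. u (F j x)) (g j)) = (\<Sum>j\<in>UNIV. if j = i then energy_form q (\<lambda>x. u (F i x)) v else 0)"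
    by (intro sum.cong) (auto simp: g_def energy_form_zero_right dom_energy_F d)
  moreover have "(\<Sum>j\<in>UNIV. \<integral>x. f (F j x) * g j x \<partial>\<mu>) = (\<Sum>j\<in>UNIV. if j = i then (\<integral>x. f (F i x) * v x \<partial>\<mu>) else 0)"
    by (intro sum.cong) (auto simp: g_def)
  ultimately show "energy_form q (\<lambda>x. u (F i x)) v = - (\<integral>x. f (F i x) / 5 * v x \<partial>\<mu>)"
    by simp
qed

lemma has_laplacian_Fw:
  assumes "has_laplacian q \<mu> u f"
  shows "has_laplacian q \<mu> (\<lambda>x. u (Fw w x)) (\<lambda>x. f (Fw w x) / 5 ^ length w)"
  using assms
proof (induction w arbitrary: u f)
  case (Cons i w)
  show ?case using Cons.IH[OF has_laplacian_F[OF Cons.prems, of i]] by simp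
qed simp

definition unit :: "3 \<Rightarrow> 3 \<Rightarrow> real" where "unit i j = (if i = j then 1 else 0)"

text \<open>The spline equal to \<open>1\<close> at \<open>q i\<close>, zero at the other points of \<open>sgV q k\<close>, and harmonic on
  all cells of level \<open>k\<close>. Pairing it with \<open>u\<close> produces the difference quotient in the definition of
  the normal derivative.\<close>

primrec corner_spline :: "3 \<Rightarrow> nat \<Rightarrow> real ^ 2 \<Rightarrow> real" where
  "corner_spline i 0 = harm (unit i)"
| "corner_spline i (Suc k) = glue (\<lambda>j. if j = i then corner_spline i k else (\<lambda>_. 0))"

lemma corner_spline_props:
  "corner_spline i k \<in> dom_energy q \<and> (\<forall>j. corner_spline i k (q j) = unit i j)"
proof (induction k)
  case 0
  then show ?case by (simp add: harm_in_dom harm_q)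
next
  case (Suc k)
  let ?g = "\<lambda>j. if j = i then corner_spline i k else (\<lambda>_. 0)"
  have match: "?g j (q l) = ?g l (q j)" for j l using Suc by (auto simp: unit_def)
  have "corner_spline i (Suc k) \<in> dom_energy q"
    unfolding corner_spline.simps
    by (rule dom_energy_glue) (use match Suc zero_in_dom in auto)
  moreover have "corner_spline i (Suc k) (q j) = unit i j" for j
    unfolding corner_spline.simps using glue_q[where g = ?g, OF match, of j] Suc by (auto simp: unit_def)
  ultimately show ?case by blast
qed

lemma corner_spline_match:
  "(if j = i then corner_spline i k else (\<lambda>_. 0)) (q l) = (if l = i then corner_spline i k else (\<lambda>_. 0)) (q j)"
  using corner_spline_props[of i k] by (auto simp: unit_def)

lemma energy_form_corner_spline:
  assumes "u \<in> dom_energy q"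
  shows "energy_form q u (corner_spline i k) =
    (5 / 3) ^ k * (2 * u (q i) - u ((F i ^^ k) (q (i + 1))) - u ((F i ^^ k) (q (i - 1))))"
  using assms
proof (induction k arbitrary: u)
  case 0
  have "energy_form q u (harm (unit i)) = (\<Sum>j\<in>UNIV. (3 * unit i j - (\<Sum>k\<in>UNIV. unit i k)) * u (q j))"
    by (subst energy_form_sym[OF 0 harm_in_dom]) (rule energy_form_harm[OF 0])
  then show ?case by (cases i rule: cases_3) (simp_all add: sum_3_eq unit_def neg_3_eq)
next
  case (Suc k)
  have "energy_form q u (corner_spline i (Suc k)) =
    5 / 3 * (\<Sum>j\<in>UNIV. energy_form q (\<lambda>x. u (F j x)) (if j = i then corner_spline i k else (\<lambda>_. 0)))"
    unfolding corner_spline.simps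
    by (rule energy_form_glue[where g = "\<lambda>j. if j = i then corner_spline i k else (\<lambda>_. 0)", OF Suc.prems corner_spline_match])
      (use corner_spline_props zero_in_dom in auto)
  also have "(\<Sum>j\<in>UNIV. energy_form q (\<lambda>x. u (F j x)) (if j = i then corner_spline i k else (\<lambda>_. 0)))
    = (\<Sum>j\<in>UNIV. if j = i then energy_form q (\<lambda>x. u (F i x)) (corner_spline i k) else 0)"
    by (intro sum.cong) (auto simp: energy_form_zero_right dom_energy_F Suc.prems)
  finally show ?case using Suc.IH[OF dom_energy_F[OF Suc.prems], of i] by (simp add: F_q)
qed

lemma integral_corner_spline:
  assumes "integrable \<mu> f"
  shows "(\<integral>x. f x * corner_spline i k x \<partial>\<mu>) = (1 / 3) ^ k * (\<integral>x. f ((F i ^^ k) x) * harm (unit i) x \<partial>\<mu>)"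
  using assms
proof (induction k arbitrary: f)
  case (Suc k)
  have "(\<integral>x. f x * corner_spline i (Suc k) x \<partial>\<mu>) =
    (1 / 3) * (\<Sum>j\<in>UNIV. \<integral>x. f (F j x) * (if j = i then corner_spline i k else (\<lambda>_. 0)) x \<partial>\<mu>)"
    unfolding corner_spline.simps
    by (rule integral_mult_glue[where g = "\<lambda>j. if j = i then corner_spline i k else (\<lambda>_. 0)", OF Suc.prems corner_spline_match])
      (use corner_spline_props dom_energy_continuous zero_in_dom in auto)
  also have "(\<Sum>j\<in>UNIV. \<integral>x. f (F j x) * (if j = i then corner_spline i k else (\<lambda>_. 0)) x \<partial>\<mu>)
    = (\<Sum>j\<in>UNIV. if j = i then (\<integral>x. f (F i x) * corner_spline i k x \<partial>\<mu>) else 0)"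
    by (intro sum.cong) auto
  finally show ?case using Suc.IH[OF integrable_F[OF Suc.prems], of i] by simp
qed simp

lemma L2_Fw: "f \<in> L2_fun \<mu> \<Longrightarrow> (\<lambda>x. f (Fw w x)) \<in> L2_fun \<mu>"
proof (induction w arbitrary: f)
  case (Cons i w)
  then show ?case using Cons.IH[OF L2_F[OF Cons.prems, of i]] by simp
qed simp

lemma integral_cell_le:
  assumes "integrable \<mu> g" "\<And>x. (g x :: real) \<ge> 0"
  shows "(1 / 3) ^ length w * (\<integral>x. g (Fw w x) \<partial>\<mu>) \<le> (\<integral>x. g x \<partial>\<mu>)"
proof -
  have "(\<integral>x. g (Fw w x) \<partial>\<mu>) \<le> (\<Sum>v\<in>{v. length v = length w}. \<integral>x. g (Fw v x) \<partial>\<mu>)"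
    by (rule member_le_sum) (auto simp: finite_words assms)
  then show ?thesis
    unfolding integral_self_similar_words[OF assms(1), of "length w"] by (intro mult_left_mono) auto
qed

lemma integral_corner_spline_lim:
  assumes "f \<in> L2_fun \<mu>"
  shows "(\<lambda>k. \<integral>x. f x * corner_spline i k x \<partial>\<mu>) \<longlonglongrightarrow> 0"
proof -
  obtain B where B: "B \<ge> 0" "\<And>x. x \<in> K \<Longrightarrow> \<bar>harm (unit i) x\<bar> \<le> B"
    using bounded_continuous[OF continuous_harm] by blast
  define A where "A = (\<integral>x. (f x)\<^sup>2 \<partial>\<mu>)"
  have f2: "integrable \<mu> (\<lambda>x. (f x)\<^sup>2)" using assms by (simp add: L2_fun_def)
  have bound: "\<bar>\<integral>x. f x * corner_spline i k x \<partial>\<mu>\<bar> \<le> B * ((2 / 3) ^ k * A + (1 / 2) ^ k)" for k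
  proof -
    define g where "g x = f ((F i ^^ k) x)" for x
    have g: "g \<in> L2_fun \<mu>" unfolding g_def funpow_F using L2_Fw[OF assms] .
    \<comment> \<open>Without a sup bound on \<open>f\<close>, the integrand is split by
      \<open>\<bar>g\<bar> \<le> t * g\<^sup>2 + 1 / t\<close>. The first part is bounded by
      \<open>t * A\<close> after multiplication by \<open>(1 / 3) ^ k\<close>, the second becomes
      \<open>(1 / 3) ^ k / t\<close>. So \<open>t\<close> must tend to 0 but more slowly than
      \<open>(1 / 3) ^ k\<close>.\<close>
    define t :: real where "t = (2 / 3) ^ k"
    have t: "t > 0" by (simp add: t_def)
    have gi: "integrable \<mu> (\<lambda>x. B * (t * (g x)\<^sup>2 + 1 / t))" using g by (auto simp: L2_fun_def)
    have "\<bar>\<integral>x. g x * harm (unit i) x \<partial>\<mu>\<bar> \<le> (\<integral>x. \<bar>g x * harm (unit i) x\<bar> \<partial>\<mu>)"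
      using integral_norm_bound[of \<mu> "\<lambda>x. g x * harm (unit i) x"] by simp
    also have "\<dots> \<le> (\<integral>x. B * (t * (g x)\<^sup>2 + 1 / t) \<partial>\<mu>)"
    proof (rule integral_mono)
      show "integrable \<mu> (\<lambda>x. \<bar>g x * harm (unit i) x\<bar>)"
        by (intro integrable_abs integrable_mult_continuous integrable_L2 g continuous_harm)
      fix x assume "x \<in> space \<mu>"
      then have h: "\<bar>harm (unit i) x\<bar> \<le> B" using B by (simp add: space_measure)
      have "0 \<le> (t * \<bar>g x\<bar> - 1)\<^sup>2 / t" using t by simp
      also have "\<dots> = t * (g x)\<^sup>2 + 1 / t - 2 * \<bar>g x\<bar>" using t by (simp add: power2_diff power_mult_distrib field_simps power2_eq_square)
      finally have "\<bar>g x\<bar> \<le> t * (g x)\<^sup>2 + 1 / t" using abs_ge_zero[of "g x"] by linarith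
      then have "\<bar>g x\<bar> * \<bar>harm (unit i) x\<bar> \<le> (t * (g x)\<^sup>2 + 1 / t) * B"
        using h t by (intro mult_mono) auto
      then show "\<bar>g x * harm (unit i) x\<bar> \<le> B * (t * (g x)\<^sup>2 + 1 / t)" by (simp add: abs_mult mult.commute)
    qed (rule gi)
    also have "\<dots> = B * (t * (\<integral>x. (g x)\<^sup>2 \<partial>\<mu>) + 1 / t)"
      using g by (simp add: L2_fun_def prob_space)
    finally have "(1 / 3) ^ k * \<bar>\<integral>x. g x * harm (unit i) x \<partial>\<mu>\<bar> \<le> (1 / 3) ^ k * (B * (t * (\<integral>x. (g x)\<^sup>2 \<partial>\<mu>) + 1 / t))"
      by (intro mult_left_mono) auto
    also have "\<dots> = B * (t * ((1 / 3) ^ k * (\<integral>x. (g x)\<^sup>2 \<partial>\<mu>)) + (1 / 3) ^ k / t)"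
      by (simp add: algebra_simps)
    also have "(1 / 3) ^ k / t = (1 / 2) ^ k" by (simp add: t_def flip: power_divide)
    also have "B * (t * ((1 / 3) ^ k * (\<integral>x. (g x)\<^sup>2 \<partial>\<mu>)) + (1 / 2) ^ k) \<le> B * (t * A + (1 / 2) ^ k)"
      using integral_cell_le[OF f2, of "replicate k i"] B t
      by (intro mult_left_mono add_mono) (auto simp: A_def g_def funpow_F)
    finally show ?thesis
      using integral_corner_spline[OF integrable_L2[OF assms], of i k] by (simp add: g_def abs_mult t_def)
  qed
  have "(\<lambda>k. B * ((2 / 3) ^ k * A + (1 / 2) ^ k)) \<longlonglongrightarrow> B * (0 * A + 0)"
    by (intro tendsto_intros LIMSEQ_power_zero) auto
  then have lim: "(\<lambda>k. B * ((2 / 3) ^ k * A + (1 / 2) ^ k)) \<longlonglongrightarrow> 0"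
    by (simp only: mult_zero_left mult_zero_right add_0)
  show ?thesis
    by (rule Lim_null_comparison[OF _ lim], unfold real_norm_def) (intro always_eventually allI bound)
qed

text \<open>The defect of the weak equation when it is tested with a harmonic function that does not
  vanish at \<open>q i\<close>. It needs no limit, whereas the convergence in
  \<open>normal_deriv\<close> is still to be shown.\<close>

definition flux :: "(real ^ 2 \<Rightarrow> real) \<Rightarrow> (real ^ 2 \<Rightarrow> real) \<Rightarrow> 3 \<Rightarrow> real" where
  "flux u f i = energy_form q u (harm (unit i)) + (\<integral>x. f x * harm (unit i) x \<partial>\<mu>)"

text \<open>The defect \<open>L\<close> is linear and vanishes on admissible test functions.
  Subtracting from \<open>v\<close> the harmonic function with its corner values leaves such a test
  function.\<close>

lemma gauss_green_flux:
  assumes "has_laplacian q \<mu> u f" "v \<in> dom_energy q"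
  shows "energy_form q u v = - (\<integral>x. f x * v x \<partial>\<mu>) + (\<Sum>i\<in>UNIV. flux u f i * v (q i))"
proof -
  note d = has_laplacianD[OF assms(1)]
  define L where "L v = energy_form q u v + (\<integral>x. f x * v x \<partial>\<mu>)" for v
  have int: "integrable \<mu> (\<lambda>x. f x * v x)" if "v \<in> dom_energy q" for v
    using that d by (intro integrable_mult_continuous dom_energy_continuous)
  have L_add: "L (\<lambda>x. v x + w x) = L v + L w" if "v \<in> dom_energy q" "w \<in> dom_energy q" for v w
    using int[OF that(1)] int[OF that(2)]
    by (simp add: L_def energy_form_add_right[OF d(1) that] distrib_left)
  have L_scale: "L (\<lambda>x. c * v x) = c * L v" if "v \<in> dom_energy q" for v c
    using int[OF that] by (simp add: L_def energy_form_scale_right[OF d(1) that] distrib_left mult.left_commute)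
  have L_zero: "L v = 0" if "v \<in> dom_energy q" "\<And>i. v (q i) = 0" for v
    using has_laplacian_test[OF assms(1) that] by (simp add: L_def)
  let ?h = "\<lambda>i x. v (q i) * harm (unit i) x"
  have h: "?h i \<in> dom_energy q" for i by (intro dom_energy_scale harm_in_dom)
  have nh: "(\<lambda>x. - 1 * (?h 0 x + (?h 1 x + ?h 2 x))) \<in> dom_energy q"
    by (intro dom_energy_scale dom_energy_add harm_in_dom)
  have "L (\<lambda>x. v x + - 1 * (?h 0 x + (?h 1 x + ?h 2 x))) = 0"
  proof (rule L_zero)
    show "(\<lambda>x. v x + - 1 * (?h 0 x + (?h 1 x + ?h 2 x))) \<in> dom_energy q" by (rule dom_energy_add[OF assms(2) nh])
    show "v (q i) + - 1 * (?h 0 (q i) + (?h 1 (q i) + ?h 2 (q i))) = 0" for i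
      by (cases i rule: cases_3) (simp_all add: harm_q unit_def)
  qed
  also have "L (\<lambda>x. v x + - 1 * (?h 0 x + (?h 1 x + ?h 2 x))) = L v - (L (?h 0) + (L (?h 1) + L (?h 2)))"
    by (subst L_add[OF assms(2) nh], subst L_scale, intro dom_energy_add h,
        subst L_add, rule h, intro dom_energy_add h, subst L_add, rule h, rule h) simp
  finally have "L v = (\<Sum>i\<in>UNIV. v (q i) * flux u f i)"
    by (simp add: sum_3_eq L_scale[OF harm_in_dom]) (simp add: L_def flux_def)
  then show ?thesis by (simp add: L_def mult.commute)
qed

text \<open>Paired with \<open>u\<close>, the corner spline gives the difference quotient of level
  \<open>k\<close>, while its corner values do not depend on \<open>k\<close>. Gauss-Green thus
  expresses the quotient as the flux minus an integral that tends to 0.\<close>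

lemma flux_lim:
  assumes "has_laplacian q \<mu> u f"
  shows "(\<lambda>k. (5 / 3) ^ k * (2 * u (q i) - u ((F i ^^ k) (q (i + 1))) - u ((F i ^^ k) (q (i - 1))))) \<longlonglongrightarrow> flux u f i"
proof -
  note d = has_laplacianD[OF assms]
  have "energy_form q u (corner_spline i k) = - (\<integral>x. f x * corner_spline i k x \<partial>\<mu>) + flux u f i" for k
  proof -
    have "(\<Sum>j\<in>UNIV. flux u f j * corner_spline i k (q j)) = (\<Sum>j\<in>UNIV. if j = i then flux u f j else 0)"
      using corner_spline_props[of i k] by (intro sum.cong) (auto simp: unit_def)
    then show ?thesis using gauss_green_flux[OF assms, of "corner_spline i k"] corner_spline_props[of i k] by simp
  qed
  moreover have "(\<lambda>k. - (\<integral>x. f x * corner_spline i k x \<partial>\<mu>) + flux u f i) \<longlonglongrightarrow> - 0 + flux u f i"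
    by (intro tendsto_intros integral_corner_spline_lim d)
  ultimately show ?thesis by (simp add: energy_form_corner_spline[OF d(1)])
qed

lemma normal_deriv_eq_flux: assumes "has_laplacian q \<mu> u f" shows "normal_deriv q u [] i = flux u f i"
  using limI[OF flux_lim[OF assms, of i]] by (simp add: normal_deriv_def)

lemma gauss_green:
  assumes "has_laplacian q \<mu> u f" "v \<in> dom_energy q"
  shows "energy_form q u v = - (\<integral>x. f x * v x \<partial>\<mu>) + (\<Sum>i\<in>UNIV. normal_deriv q u [] i * v (q i))"
  using gauss_green_flux[OF assms] normal_deriv_eq_flux[OF assms(1)] by simp

section \<open>Normal derivatives on smaller cells and their cancellation\<close>

lemma normal_deriv_Fw:
  assumes "has_laplacian q \<mu> u f"
  shows "normal_deriv q u (v @ w) i = (5 / 3) ^ length v * normal_deriv q (\<lambda>x. u (Fw v x)) w i"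
proof -
  let ?X = "\<lambda>w k. 2 * u (Fw w (q i)) - u (Fw w ((F i ^^ k) (q (i + 1)))) - u (Fw w ((F i ^^ k) (q (i - 1))))"
  have conv: "(\<lambda>k. (5 / 3) ^ k * ?X w k) \<longlonglongrightarrow> normal_deriv q (\<lambda>x. u (Fw w x)) [] i" for w
    using flux_lim[OF has_laplacian_Fw[OF assms, of w], of i]
    by (simp add: normal_deriv_eq_flux[OF has_laplacian_Fw[OF assms]])
  have *: "(\<lambda>k. (5 / 3) ^ (m + k) * ?X w k) \<longlonglongrightarrow> (5 / 3) ^ m * normal_deriv q (\<lambda>x. u (Fw w x)) [] i" for w m
    using tendsto_mult_left[OF conv[of w], of "(5 / 3) ^ m"] by (simp add: power_add mult.assoc)
  have "normal_deriv q u (v @ w) i = (5 / 3) ^ (length v + length w) * normal_deriv q (\<lambda>x. u (Fw (v @ w) x)) [] i"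
    using limI[OF *[of "length v + length w" "v @ w"]] by (simp add: normal_deriv_def)
  moreover have "normal_deriv q (\<lambda>x. u (Fw v x)) w i = (5 / 3) ^ length w * normal_deriv q (\<lambda>x. u (Fw (v @ w) x)) [] i"
    using limI[OF *[of "length w" "v @ w"]] by (simp add: normal_deriv_def Fw_append)
  ultimately show ?thesis by (simp add: power_add)
qed

lemma normal_deriv_Cons:
  assumes "has_laplacian q \<mu> u f"
  shows "normal_deriv q u (j # w) i = 5 / 3 * normal_deriv q (\<lambda>x. u (F j x)) w i"
  using normal_deriv_Fw[OF assms, of "[j]" w i] by simp

text \<open>The cells shrinking to \<open>q j\<close> have the same normal derivative there, because
  the difference quotients for the smaller cell are a tail of the original sequence.\<close>

lemma normal_deriv_replicate:
  assumes "has_laplacian q \<mu> u f"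
  shows "normal_deriv q u (replicate m j) j = normal_deriv q u [] j"
proof -
  have "(\<lambda>k. (5 / 3) ^ (k + m) * (2 * u (q j) - u ((F j ^^ (k + m)) (q (j + 1))) - u ((F j ^^ (k + m)) (q (j - 1)))))
     \<longlonglongrightarrow> flux u f j"
    by (rule LIMSEQ_ignore_initial_segment[OF flux_lim[OF assms]])
  moreover have "(F j ^^ (k + m)) x = Fw (replicate m j) ((F j ^^ k) x)" for k x
    by (subst add.commute) (simp add: funpow_add funpow_F)
  ultimately have "(\<lambda>k. (5 / 3) ^ (m + k) * (2 * u (q j) - u (Fw (replicate m j) ((F j ^^ k) (q (j + 1))))
      - u (Fw (replicate m j) ((F j ^^ k) (q (j - 1)))))) \<longlonglongrightarrow> flux u f j"
    by (simp add: add.commute)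
  from limI[OF this] show ?thesis
    by (simp add: normal_deriv_eq_flux[OF assms]) (simp add: normal_deriv_def Fw_replicate_q)
qed

lemma normal_deriv_cong:
  assumes "\<And>x. x \<in> K \<Longrightarrow> u' x = u x" shows "normal_deriv q u' w i = normal_deriv q u w i"
  unfolding normal_deriv_def funpow_F using assms by simp

lemma normal_deriv_diff:
  assumes "has_laplacian q \<mu> u f" "has_laplacian q \<mu> v g"
  shows "normal_deriv q (\<lambda>x. u x - v x) w i = normal_deriv q u w i - normal_deriv q v w i"
proof -
  have nil: "normal_deriv q (\<lambda>x. u x - v x) [] i = normal_deriv q u [] i - normal_deriv q v [] i"
    if "has_laplacian q \<mu> u f" "has_laplacian q \<mu> v g" for u v f g
  proof -
    have "integrable \<mu> (\<lambda>x. f x * harm (unit i) x)" "integrable \<mu> (\<lambda>x. g x * harm (unit i) x)"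
      using that has_laplacianD by (auto intro!: integrable_mult_continuous continuous_harm)
    then have "flux (\<lambda>x. u x - v x) (\<lambda>x. f x - g x) i = flux u f i - flux v g i"
      using that has_laplacianD by (simp add: flux_def energy_form_diff_left harm_in_dom left_diff_distrib)
    then show ?thesis
      by (simp add: normal_deriv_eq_flux[OF that(1)] normal_deriv_eq_flux[OF that(2)]
          normal_deriv_eq_flux[OF has_laplacian_diff[OF that]])
  qed
  show ?thesis
    using normal_deriv_Fw[OF has_laplacian_diff[OF assms], of w "[]" i] normal_deriv_Fw[OF assms(1), of w "[]" i]
      normal_deriv_Fw[OF assms(2), of w "[]" i] nil[OF has_laplacian_Fw[OF assms(1), of w] has_laplacian_Fw[OF assms(2), of w]]
    by (simp add: right_diff_distrib)
qed

text \<open>Test with a tent that is 1 at the midpoint and 0 at the three corners. The weak equation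
  on the whole gasket has no boundary term, while Gauss-Green on the two cells produces exactly the
  two normal derivatives.\<close>

lemma normal_deriv_cancel_midpoint:
  assumes "has_laplacian q \<mu> u f" "i \<noteq> j"
  shows "normal_deriv q (\<lambda>x. u (F i x)) [] j + normal_deriv q (\<lambda>x. u (F j x)) [] i = 0"
proof -
  note d = has_laplacianD[OF assms(1)]
  define b where "b k l = normal_deriv q (\<lambda>x. u (F k x)) [] l" for k l
  define g where "g k = (if k = i then harm (unit j) else if k = j then harm (unit i) else (\<lambda>_. 0))" for k
  have match: "g k (q l) = g l (q k)" for k l using assms(2) by (auto simp: g_def harm_q unit_def)
  have dom: "g k \<in> dom_energy q" for k by (simp add: g_def harm_in_dom zero_in_dom)
  have vanish: "glue g (q k) = 0" for k
    using glue_q[where g = g, OF match, of k] assms(2) by (simp add: g_def harm_q unit_def)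
  have int: "integrable \<mu> (\<lambda>x. f (F k x) * g k x)" for k
    by (intro integrable_mult_continuous integrable_F d dom_energy_continuous dom)
  have "- (\<integral>x. f x * glue g x \<partial>\<mu>) = energy_form q u (glue g)"
    by (rule has_laplacian_test[OF assms(1) dom_energy_glue[where g = g, OF match dom] vanish, symmetric])
  also have "\<dots> = 5 / 3 * (\<Sum>k\<in>UNIV. energy_form q (\<lambda>x. u (F k x)) (g k))"
    by (rule energy_form_glue) (use d match dom in auto)
  also have "\<dots> = 5 / 3 * (\<Sum>k\<in>UNIV. - (\<integral>x. f (F k x) * g k x \<partial>\<mu>) / 5 + (\<Sum>l\<in>UNIV. b k l * g k (q l)))"
    by (subst gauss_green[OF has_laplacian_F[OF assms(1)] dom]) (simp add: b_def)
  also have "\<dots> = - (\<integral>x. f x * glue g x \<partial>\<mu>) + 5 / 3 * (\<Sum>k\<in>UNIV. \<Sum>l\<in>UNIV. b k l * g k (q l))"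
    using integral_mult_glue[OF d(3), of g] match dom dom_energy_continuous
    by (simp add: sum_subtractf right_diff_distrib flip: sum_divide_distrib)
  finally have "(\<Sum>k\<in>UNIV. \<Sum>l\<in>UNIV. b k l * g k (q l)) = 0" by simp
  moreover have "(\<Sum>k\<in>UNIV. \<Sum>l\<in>UNIV. b k l * g k (q l)) = b i j + b j i"
    using assms(2) by (cases i rule: cases_3; cases j rule: cases_3) (simp_all add: sum_3_eq g_def harm_q unit_def)
  ultimately show ?thesis by (simp add: b_def)
qed

lemma AE_glue: "AE x in \<mu>. glue f (F i x) = f i x"
proof -
  have "AE x in \<mu>. x \<in> K" by (rule AE_I2) (simp add: space_measure)
  with AE_not_corner show ?thesis by eventually_elim (simp add: glue_F_interior)
qed

lemma L2_glue:
  assumes "\<And>i. f i \<in> L2_fun \<mu>" shows "glue f \<in> L2_fun \<mu>"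
proof -
  have [measurable]: "\<And>i. f i \<in> borel_measurable \<mu>" using assms by (auto simp: L2_fun_def)
  have "integrable \<mu> (\<lambda>x. (glue f (F i x))\<^sup>2)" for i
  proof (rule integrable_cong_AE_imp[of _ "\<lambda>x. (f i x)\<^sup>2"])
    show "AE x in \<mu>. (f i x)\<^sup>2 = (glue f (F i x))\<^sup>2"
      using AE_glue[of f i] by eventually_elim simp
  qed (use assms in \<open>auto simp: L2_fun_def\<close>)
  moreover have "(\<lambda>x. (glue f x)\<^sup>2) \<in> borel_measurable \<mu>" "glue f \<in> borel_measurable \<mu>" by measurable
  ultimately show ?thesis
    using integrable_self_similar[of "\<lambda>x. (glue f x)\<^sup>2"] unfolding L2_fun_def by blast
qed

text \<open>The converse: sum Gauss-Green over the three cells. The products of normal derivatives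
  and test values are antisymmetric under exchanging the two addresses of a midpoint and zero at the
  corners, so they sum to zero. The factor 5 undoes the rescaling in
  \<open>has_laplacian_F\<close>.\<close>

lemma has_laplacian_glue:
  assumes lap: "\<And>i. has_laplacian q \<mu> (\<lambda>x. u (F i x)) (f i)"
    and cancel: "\<And>i j. i \<noteq> j \<Longrightarrow> normal_deriv q (\<lambda>x. u (F i x)) [] j + normal_deriv q (\<lambda>x. u (F j x)) [] i = 0"
  shows "has_laplacian q \<mu> u (glue (\<lambda>i x. 5 * f i x))"
  unfolding has_laplacian_def
proof (intro conjI ballI impI)
  let ?f = "glue (\<lambda>i x. 5 * f i x)"
  note d = has_laplacianD[OF lap]
  show dom: "u \<in> dom_energy q" by (rule dom_energyI_F) (rule d)
  show L2: "?f \<in> L2_fun \<mu>" by (intro L2_glue L2_scale d)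
  fix v assume v: "v \<in> dom_energy q" "\<forall>x\<in>sgV q 0. v x = 0"
  define b where "b i j = normal_deriv q (\<lambda>x. u (F i x)) [] j" for i j
  define c where "c i j = v (F i (q j))" for i j
  have c: "c i j = c j i" "c i i = 0" for i j using v by (simp_all add: c_def F_swap[of i] F_q)
  have b: "b i j * c i j = - (b j i * c j i)" for i j
  proof (cases "i = j")
    case False
    then have "b i j = - b j i" using cancel[OF False] by (simp add: b_def)
    then show ?thesis by (simp add: c)
  qed (simp add: c)
  have "(\<Sum>i\<in>UNIV. \<Sum>j\<in>UNIV. b i j * c i j) = (\<Sum>i\<in>UNIV. \<Sum>j\<in>UNIV. b j i * c j i)" by (rule sum.swap)
  moreover have "\<dots> = - (\<Sum>i\<in>UNIV. \<Sum>j\<in>UNIV. b i j * c i j)"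
    unfolding sum_negf[symmetric] by (intro sum.cong refl) (rule b)
  ultimately have bc: "(\<Sum>i\<in>UNIV. \<Sum>j\<in>UNIV. b i j * c i j) = 0" by simp
  have int: "integrable \<mu> (\<lambda>x. ?f x * v x)"
    by (intro integrable_mult_continuous integrable_L2 L2 dom_energy_continuous v)
  have "(\<integral>x. ?f (F i x) * v (F i x) \<partial>\<mu>) = 5 * (\<integral>x. f i x * v (F i x) \<partial>\<mu>)" for i
  proof -
    have m: "?f \<in> borel_measurable \<mu>" "v \<in> borel_measurable \<mu>" "f i \<in> borel_measurable \<mu>"
      using L2 d v by (auto simp: L2_fun_def intro: measurable_continuous dom_energy_continuous)
    note [measurable] = m
    have "(\<integral>x. ?f (F i x) * v (F i x) \<partial>\<mu>) = (\<integral>x. 5 * f i x * v (F i x) \<partial>\<mu>)"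
    proof (rule integral_cong_AE)
      show "AE x in \<mu>. ?f (F i x) * v (F i x) = 5 * f i x * v (F i x)"
        using AE_glue[of "\<lambda>i x. 5 * f i x" i] by eventually_elim simp
    qed measurable
    then show ?thesis by (simp add: mult.assoc)
  qed
  then have I: "(\<integral>x. ?f x * v x \<partial>\<mu>) = 5 / 3 * (\<Sum>i\<in>UNIV. \<integral>x. f i x * v (F i x) \<partial>\<mu>)"
    by (simp add: integral_self_similar[OF int] sum_distrib_left)
  have "energy_form q u v = 5 / 3 * (\<Sum>i\<in>UNIV. - (\<integral>x. f i x * v (F i x) \<partial>\<mu>) + (\<Sum>j\<in>UNIV. b i j * c i j))"
    unfolding energy_form_self_similar[OF dom v(1)]
    by (subst gauss_green[OF lap dom_energy_F[OF v(1)]]) (simp add: b_def c_def)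
  also have "\<dots> = - (\<integral>x. ?f x * v x \<partial>\<mu>)" unfolding sum.distrib bc I by (simp add: sum_negf)
  finally show "energy_form q u v = - (\<integral>x. ?f x * v x \<partial>\<mu>)" .
qed

lemma normal_deriv_biharm: "normal_deriv q (biharm s) [] i = corner_deriv s i"
proof -
  have "energy_form q (biharm s) (harm (unit i)) = - (\<integral>x. harm (snd s) x * harm (unit i) x \<partial>\<mu>)
     + (\<Sum>j\<in>UNIV. corner_deriv s j * harm (unit i) (q j))"
    by (rule energy_form_biharm[OF harm_in_dom])
  moreover have "(\<Sum>j\<in>UNIV. corner_deriv s j * harm (unit i) (q j)) = (\<Sum>j\<in>UNIV. if j = i then corner_deriv s j else 0)"
    by (intro sum.cong) (auto simp: harm_q unit_def)
  ultimately have "flux (biharm s) (harm (snd s)) i = corner_deriv s i" by (simp add: flux_def)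
  then show ?thesis by (simp add: normal_deriv_eq_flux[OF has_laplacian_biharm])
qed

subsection \<open>Uniqueness of the Laplacian\<close>

lemma harm_const: "x \<in> K \<Longrightarrow> harm (\<lambda>_. c) x = c"
  using harm_near[of x "\<lambda>_. c" 0] by simp

lemma laplacian_zero_orthogonal:
  assumes "has_laplacian q \<mu> (\<lambda>_. 0) e" "v \<in> dom_energy q"
  shows "(\<integral>x. e x * v x \<partial>\<mu>) = 0"
proof -
  have "energy_form q (\<lambda>_. 0) v = 0"
    using energy_form_sym[OF zero_in_dom assms(2)] energy_form_zero_right[OF assms(2)] by simp
  moreover have "normal_deriv q (\<lambda>_. 0) [] i = 0" for i by (simp add: normal_deriv_def limI)
  ultimately show ?thesis using gauss_green[OF assms] by simp
qed

text \<open>The indicator of a cell is no test function, but on the rescaled cell \<open>e\<close>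
  is again, up to a factor, a Laplacian of zero, and there the constant 1 is harmonic.\<close>

lemma laplacian_zero_integral_cell:
  assumes "has_laplacian q \<mu> (\<lambda>_. 0) e" shows "(\<integral>x. e (Fw w x) \<partial>\<mu>) = 0"
proof -
  have "(\<integral>x. e (Fw w x) / 5 ^ length w * harm (\<lambda>_. 1) x \<partial>\<mu>) = 0"
    by (rule laplacian_zero_orthogonal[OF has_laplacian_Fw[OF assms] harm_in_dom])
  moreover have "(\<integral>x. e (Fw w x) / 5 ^ length w * harm (\<lambda>_. 1) x \<partial>\<mu>) = (\<integral>x. e (Fw w x) / 5 ^ length w \<partial>\<mu>)"
    by (intro Bochner_Integration.integral_cong) (simp_all add: space_measure harm_const)
  ultimately show ?thesis by simp
qed

lemma integrable_Fw: assumes "integrable \<mu> (f :: real ^ 2 \<Rightarrow> real)" shows "integrable \<mu> (\<lambda>x. f (Fw w x))"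
  using assms
proof (induction w arbitrary: f)
  case (Cons i w)
  then show ?case using Cons.IH[OF integrable_F[OF Cons.prems, of i]] by simp
qed simp

lemma continuous_Fw: assumes "continuous_on K (v :: real ^ 2 \<Rightarrow> real)" shows "continuous_on K (\<lambda>x. v (Fw w x))"
  using assms
proof (induction w arbitrary: v)
  case (Cons i w)
  then show ?case using Cons.IH[of "\<lambda>x. v (F i x)"] continuous_on_SG_iff[of v] by simp
qed simp

text \<open>On small cells \<open>v\<close> is within \<open>r\<close> of a constant, and
  \<open>e\<close> annihilates constants on cells. So the integral is at most \<open>r\<close> times
  the L1 norm of \<open>e\<close>, for every positive \<open>r\<close>.\<close>

lemma laplacian_zero_orthogonal_continuous:
  assumes "has_laplacian q \<mu> (\<lambda>_. 0) e" "continuous_on K v"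
  shows "(\<integral>x. e x * v x \<partial>\<mu>) = 0"
proof -
  note d = has_laplacianD[OF assms(1)]
  define A where "A = (\<integral>x. \<bar>e x\<bar> \<partial>\<mu>)"
  have A0: "A \<ge> 0" by (simp add: A_def)
  have bound: "\<bar>\<integral>x. e x * v x \<partial>\<mu>\<bar> \<le> r * A" if r: "r > 0" for r
  proof -
    obtain N where N: "\<And>n w x y. n \<ge> N \<Longrightarrow> length w = n \<Longrightarrow> x \<in> K \<Longrightarrow> y \<in> K \<Longrightarrow> \<bar>v (Fw w x) - v (Fw w y)\<bar> \<le> r"
      using small_cells[OF assms(2) r] by blast
    have cell: "\<bar>\<integral>x. e (Fw w x) * v (Fw w x) \<partial>\<mu>\<bar> \<le> r * (\<integral>x. \<bar>e (Fw w x)\<bar> \<partial>\<mu>)" if w: "length w = N" for w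
    proof -
      let ?c = "v (Fw w (q 0))"
      have int: "integrable \<mu> (\<lambda>x. e (Fw w x) * v (Fw w x))" "integrable \<mu> (\<lambda>x. e (Fw w x))"
        by (intro integrable_mult_continuous integrable_Fw d continuous_Fw assms)+
      have "(\<integral>x. e (Fw w x) * v (Fw w x) \<partial>\<mu>) = (\<integral>x. e (Fw w x) * (v (Fw w x) - ?c) \<partial>\<mu>)"
        using int laplacian_zero_integral_cell[OF assms(1), of w] by (simp add: right_diff_distrib)
      also have "\<bar>\<dots>\<bar> \<le> (\<integral>x. \<bar>e (Fw w x) * (v (Fw w x) - ?c)\<bar> \<partial>\<mu>)"
        using integral_norm_bound[of \<mu> "\<lambda>x. e (Fw w x) * (v (Fw w x) - ?c)"] by simp
      also have "\<dots> \<le> (\<integral>x. r * \<bar>e (Fw w x)\<bar> \<partial>\<mu>)"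
      proof (rule integral_mono)
        show "\<bar>e (Fw w x) * (v (Fw w x) - ?c)\<bar> \<le> r * \<bar>e (Fw w x)\<bar>" if "x \<in> space \<mu>" for x
          using mult_left_mono[OF N[OF order_refl w, of x "q 0"], of "\<bar>e (Fw w x)\<bar>"] that
          by (simp add: abs_mult space_measure mult.commute)
      qed (use int in \<open>auto simp: right_diff_distrib\<close>)
      finally show ?thesis by simp
    qed
    have "(\<integral>x. e x * v x \<partial>\<mu>) = (1 / 3) ^ N * (\<Sum>w\<in>{w. length w = N}. \<integral>x. e (Fw w x) * v (Fw w x) \<partial>\<mu>)"
      by (rule integral_self_similar_words) (intro integrable_mult_continuous d assms)
    also have "\<bar>\<dots>\<bar> \<le> (1 / 3) ^ N * (\<Sum>w\<in>{w. length w = N}. r * (\<integral>x. \<bar>e (Fw w x)\<bar> \<partial>\<mu>))"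
      unfolding abs_mult by (intro mult_mono order_trans[OF sum_abs] sum_mono) (use cell in auto)
    also have "\<dots> = r * A"
      using integral_self_similar_words[of "\<lambda>x. \<bar>e x\<bar>" N] d by (simp add: A_def sum_distrib_left mult.left_commute)
    finally show ?thesis .
  qed
  show ?thesis
  proof (rule ccontr)
    assume "(\<integral>x. e x * v x \<partial>\<mu>) \<noteq> 0"
    then have p: "\<bar>\<integral>x. e x * v x \<partial>\<mu>\<bar> > 0" by simp
    define I where "I = \<bar>\<integral>x. e x * v x \<partial>\<mu>\<bar>"
    have "I \<le> I / (2 * (A + 1)) * A" using bound[of "I / (2 * (A + 1))"] p A0 by (simp add: I_def)
    also have "\<dots> \<le> I / 2" using p A0 by (simp add: I_def field_simps)
    finally show False using p by (simp add: I_def)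
  qed
qed

text \<open>The indicator of a closed set is a pointwise limit of the continuous functions
  \<open>p n\<close> with values in [0, 1]; dominated convergence applies with bound
  \<open>\<bar>e\<bar>\<close>.\<close>

lemma laplacian_zero_integral_closed:
  assumes "has_laplacian q \<mu> (\<lambda>_. 0) e" "closed C"
  shows "(\<integral>x. indicator C x * e x \<partial>\<mu>) = 0"
proof (cases "C = {}")
  case False
  note d = has_laplacianD[OF assms(1)]
  define p where "p n x = max 0 (1 - real n * infdist x C)" for n x
  have cont: "continuous_on S (p n)" for n S unfolding p_def by (intro continuous_intros)
  have [measurable]: "e \<in> borel_measurable \<mu>" "p n \<in> borel_measurable \<mu>" for n
    using d by (auto intro: measurable_continuous cont)
  have C: "C \<inter> space \<mu> \<in> sets \<mu>" unfolding sets_measure space_measure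
    by (subst sets_restrict_space_iff) (auto simp: borel_closed assms(2) closed_SG)
  have "(\<lambda>n. \<integral>x. e x * p n x \<partial>\<mu>) \<longlonglongrightarrow> (\<integral>x. indicator C x * e x \<partial>\<mu>)"
  proof (rule integral_dominated_convergence[where w = "\<lambda>x. \<bar>e x\<bar>"])
    have "(\<lambda>x. indicator (C \<inter> space \<mu>) x * e x) \<in> borel_measurable \<mu>" using C by measurable
    then show "(\<lambda>x. indicator C x * e x) \<in> borel_measurable \<mu>"
      by (rule measurable_cong[THEN iffD1, rotated]) (auto simp: indicator_def)
    show "integrable \<mu> (\<lambda>x. \<bar>e x\<bar>)" using d by simp
    show "AE x in \<mu>. norm (e x * p n x) \<le> \<bar>e x\<bar>" for n
    proof (rule AE_I2)
      fix x
      have "\<bar>p n x\<bar> \<le> 1" using infdist_nonneg[of x C] by (simp add: p_def)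
      then show "norm (e x * p n x) \<le> \<bar>e x\<bar>" using mult_left_mono[of "\<bar>p n x\<bar>" 1 "\<bar>e x\<bar>"] by (simp add: abs_mult)
    qed
    show "AE x in \<mu>. (\<lambda>n. e x * p n x) \<longlonglongrightarrow> indicator C x * e x"
    proof (rule AE_I2)
      fix x
      have "(\<lambda>n. p n x) \<longlonglongrightarrow> indicator C x"
      proof (cases "x \<in> C")
        case True
        then show ?thesis by (simp add: p_def)
      next
        case False
        then have pos: "infdist x C > 0"
          using in_closed_iff_infdist_zero[OF assms(2) \<open>C \<noteq> {}\<close>, of x] infdist_nonneg[of x C] by linarith
        obtain N where N: "real N * infdist x C > 1" using reals_Archimedean3[OF pos] by blast
        have "p n x = 0" if "n \<ge> N" for n
        proof -
          have "real N * infdist x C \<le> real n * infdist x C" using that pos by (intro mult_right_mono) auto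
          then show ?thesis using N by (simp add: p_def)
        qed
        then have "\<forall>\<^sub>F n in sequentially. p n x = indicator C x"
          using False by (auto simp: eventually_sequentially)
        then show ?thesis by (rule tendsto_eventually)
      qed
      then show "(\<lambda>n. e x * p n x) \<longlonglongrightarrow> indicator C x * e x"
        using tendsto_mult_left[of "\<lambda>n. p n x" "indicator C x" sequentially "e x"] by (simp add: mult.commute)
    qed
  qed measurable
  then show ?thesis
    by (simp add: laplacian_zero_orthogonal_continuous[OF assms(1) cont] LIMSEQ_const_iff)
qed simp

text \<open>Closed sets are stable under intersection and generate the Borel sets, so Dynkin
  induction gives integral zero over every Borel set. The sets where \<open>e\<close> is positive
  and where it is negative are then null.\<close>

lemma laplacian_zero_AE:
  assumes "has_laplacian q \<mu> (\<lambda>_. 0) e" shows "AE x in \<mu>. e x = 0"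
proof -
  note d = has_laplacianD[OF assms]
  have meas: "B \<inter> K \<in> sets \<mu>" if "B \<in> sets borel" for B
    unfolding sets_measure using that by (auto simp: sets_restrict_space)
  have int: "integrable \<mu> (\<lambda>x. indicator B x * e x)" if "B \<in> sets borel" for B
  proof -
    have "integrable \<mu> (\<lambda>x. indicator (B \<inter> K) x * e x)"
      using integrable_mult_indicator[OF meas[OF that] d(3)] by simp
    then show ?thesis
      by (rule Bochner_Integration.integrable_cong[THEN iffD1, rotated -1]) (auto simp: space_measure indicator_def)
  qed
  have total: "(\<integral>x. e x \<partial>\<mu>) = 0" using laplacian_zero_integral_cell[OF assms, of "[]"] by simp
  have zero: "(\<integral>x. indicator B x * e x \<partial>\<mu>) = 0" if "B \<in> sets borel" for B
  proof -
    have s: "sets borel = sigma_sets UNIV (Collect closed)"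
      by (subst borel_eq_closed) simp
    have stable: "Int_stable (Collect closed :: (real ^ 2) set set)" by (auto simp: Int_stable_def)
    have pow: "Collect closed \<subseteq> Pow (UNIV :: (real ^ 2) set)" by simp
    from stable pow that[unfolded s] show ?thesis
    proof (induction rule: sigma_sets_induct_disjoint)
      case (basic A)
      then show ?case using laplacian_zero_integral_closed[OF assms] by simp
    next
      case (compl A)
      have "(\<lambda>x. indicator (UNIV - A) x * e x) = (\<lambda>x. e x - indicator A x * e x)"
        by (auto simp: indicator_def)
      then show ?case using compl int[of A] d(3) total by (simp add: s)
    next
      case (union A)
      have A: "A i \<in> sets borel" for i using union s by auto
      have "set_lebesgue_integral \<mu> (\<Union>i. A i \<inter> K) e = (\<Sum>i. set_lebesgue_integral \<mu> (A i \<inter> K) e)"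
      proof (rule lebesgue_integral_countable_add)
        show "A i \<inter> K \<in> sets \<mu>" for i by (rule meas[OF A])
        then have "(\<Union>i. A i \<inter> K) \<in> sets \<mu>" by (intro sets.countable_UN) auto
        then show "set_integrable \<mu> (\<Union>i. A i \<inter> K) e"
          unfolding set_integrable_def by (rule integrable_mult_indicator) (rule d)
        show "A i \<inter> K \<inter> (A j \<inter> K) = {}" if "i \<noteq> j" for i j
          using union(1) that by (auto simp: disjoint_family_on_def)
      qed
      moreover have "set_lebesgue_integral \<mu> (B \<inter> K) e = (\<integral>x. indicator B x * e x \<partial>\<mu>)" for B
        unfolding set_lebesgue_integral_def
        by (intro Bochner_Integration.integral_cong) (auto simp: space_measure indicator_def)
      ultimately show ?case using union(3) by (simp flip: Int_UN_distrib2)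
    qed auto
  qed
  have nonpos: "AE x in \<mu>. s * e x \<le> 0" for s :: real
  proof -
    have "{x \<in> space \<mu>. s * e x > 0} \<in> sets \<mu>" using d(4) by measurable
    then obtain B where B: "B \<in> sets borel" "{x \<in> space \<mu>. s * e x > 0} = K \<inter> B"
      unfolding sets_measure sets_restrict_space by auto
    have "AE x in \<mu>. s * (indicator B x * e x) = 0"
    proof (rule integral_nonneg_eq_0_iff_AE[THEN iffD1])
      show "integrable \<mu> (\<lambda>x. s * (indicator B x * e x))" using int[OF B(1)] by simp
      show "AE x in \<mu>. 0 \<le> s * (indicator B x * e x)"
      proof (rule AE_I2)
        fix x assume "x \<in> space \<mu>"
        then have "x \<in> B \<Longrightarrow> s * e x > 0" using B(2) by (auto simp: space_measure)
        then show "0 \<le> s * (indicator B x * e x)" by (auto simp: indicator_def)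
      qed
      show "(\<integral>x. s * (indicator B x * e x) \<partial>\<mu>) = 0" using zero[OF B(1)] by simp
    qed
    moreover have "AE x in \<mu>. x \<in> K" by (rule AE_I2) (simp add: space_measure)
    ultimately show ?thesis
    proof eventually_elim
      case (elim x)
      show ?case
      proof (rule ccontr)
        assume "\<not> s * e x \<le> 0"
        then have "x \<in> {x \<in> space \<mu>. s * e x > 0}" using elim(2) unfolding space_measure by simp
        then have "x \<in> B" unfolding B(2) by simp
        then show False using elim(1) \<open>\<not> s * e x \<le> 0\<close> by (auto simp: indicator_def)
      qed
    qed
  qed
  show ?thesis using nonpos[of 1] nonpos[of "- 1"] by eventually_elim simp
qed

lemma has_laplacian_unique:
  assumes "has_laplacian q \<mu> u f" "has_laplacian q \<mu> u g" shows "AE x in \<mu>. f x = g x"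
proof -
  have "has_laplacian q \<mu> (\<lambda>x. u x - u x) (\<lambda>x. f x - g x)" by (rule has_laplacian_diff[OF assms])
  then have "AE x in \<mu>. f x - g x = 0" by (intro laplacian_zero_AE) simp
  then show ?thesis by eventually_elim simp
qed

lemma laplacian_zero_imp_zero:
  assumes "has_laplacian q \<mu> u e" "AE x in \<mu>. e x = 0" "\<And>i. u (q i) = 0" "x \<in> K"
  shows "u x = 0"
proof -
  note d = has_laplacianD[OF assms(1)]
  have "AE x in \<mu>. e x * u x = 0" using assms(2) by eventually_elim simp
  then have "(\<integral>x. e x * u x \<partial>\<mu>) = 0" by (rule integral_eq_zero_AE)
  then have "energy_form q u u = 0" using has_laplacian_test[OF assms(1) d(1) assms(3)] by simp
  then show ?thesis by (rule energy_form_zero_imp_const[OF d(1) _ assms(4,3)])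
qed

subsection \<open>Piecewise biharmonic functions\<close>

lemma Fw_meet_Cons:
  assumes "Fw (i # v) (q a) = Fw (j # w) (q b)" "i \<noteq> j"
  shows "v = replicate (length v) j \<and> a = j \<and> w = replicate (length w) i \<and> b = i"
proof -
  have "F i (Fw v (q a)) = F j (Fw w (q b))" using assms(1) by simp
  then have "Fw v (q a) = q j \<and> Fw w (q b) = q i" by (intro F_meet) (use assms(2) in auto)
  then show ?thesis using Fw_eq_cornerD[of "q a" v j] Fw_eq_cornerD[of "q b" w i] by (auto simp: q_inj)
qed

text \<open>Two addresses of one point that differ in the first letter determine all their later
  letters and corners by \<open>F_meet\<close>. Three pairwise different first letters would force
  one corner index to take two values.\<close>

lemma at_most_two_addresses:
  assumes "length v = n" "length w = n" "length u = n"
    "Fw v (q a) = Fw w (q b)" "Fw v (q a) = Fw u (q c)"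
  shows "(v, a) = (w, b) \<or> (v, a) = (u, c) \<or> (w, b) = (u, c)"
  using assms
proof (induction n arbitrary: v w u)
  case 0
  then show ?case by (simp add: q_inj)
next
  case (Suc n)
  obtain i v' where v: "v = i # v'" "length v' = n" using Suc.prems(1) by (auto simp: length_Suc_conv)
  obtain j w' where w: "w = j # w'" "length w' = n" using Suc.prems(2) by (auto simp: length_Suc_conv)
  obtain k u' where u: "u = k # u'" "length u' = n" using Suc.prems(3) by (auto simp: length_Suc_conv)
  have eq: "Fw (i # v') (q a) = Fw (j # w') (q b)" "Fw (i # v') (q a) = Fw (k # u') (q c)"
    "Fw (j # w') (q b) = Fw (k # u') (q c)" using Suc.prems by (auto simp: v w u)
  consider "i = j" "j = k" | "i = j" "i \<noteq> k" | "i \<noteq> j" "i = k" | "i \<noteq> j" "j = k" | "i \<noteq> j" "i \<noteq> k" "j \<noteq> k"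
    by blast
  then show ?case
  proof cases
    case 1
    then have "Fw v' (q a) = Fw w' (q b)" "Fw v' (q a) = Fw u' (q c)" using eq by (auto simp: F_inj)
    then show ?thesis using Suc.IH[OF v(2) w(2) u(2)] 1 by (auto simp: v w u)
  next
    case 2
    then show ?thesis using Fw_meet_Cons[OF eq(2)] Fw_meet_Cons[OF eq(3)] by (auto simp: v w u; metis v(2) w(2))
  next
    case 3
    then show ?thesis using Fw_meet_Cons[OF eq(1)] Fw_meet_Cons[OF eq(3)[symmetric]]
      by (auto simp: v w u; metis v(2) u(2))
  next
    case 4
    then show ?thesis using Fw_meet_Cons[OF eq(1)] Fw_meet_Cons[OF eq(2)] by (auto simp: v w u; metis w(2) u(2))
  next
    case 5
    then show ?thesis using Fw_meet_Cons[OF eq(1)] Fw_meet_Cons[OF eq(2)] by auto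
  qed
qed

text \<open>Strip the common prefix of the two words. Where they part, both remainders are constant
  words, so \<open>normal_deriv_replicate\<close> reduces the claim to the midpoint case.\<close>

lemma normal_deriv_cancel:
  assumes "has_laplacian q \<mu> u f" "length v = length w" "Fw v (q a) = Fw w (q b)" "(v, a) \<noteq> (w, b)"
  shows "normal_deriv q u v a + normal_deriv q u w b = 0"
  using assms
proof (induction v arbitrary: w u f)
  case Nil
  then show ?case by (simp add: q_inj)
next
  case (Cons i v)
  obtain j w' where w: "w = j # w'" "length w' = length v" using Cons.prems(2) by (metis length_Suc_conv)
  show ?case
  proof (cases "i = j")
    case True
    have "normal_deriv q (\<lambda>x. u (F i x)) v a + normal_deriv q (\<lambda>x. u (F i x)) w' b = 0"
      by (rule Cons.IH[OF has_laplacian_F[OF Cons.prems(1)]]) (use Cons.prems w True in \<open>auto simp: F_inj\<close>)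
    then have "normal_deriv q (\<lambda>x. u (F i x)) v a = - normal_deriv q (\<lambda>x. u (F i x)) w' b" by simp
    then show ?thesis using True by (simp add: w normal_deriv_Cons[OF Cons.prems(1)])
  next
    case False
    have m: "v = replicate (length v) j" "a = j" "w' = replicate (length w') i" "b = i"
      by (rule Fw_meet_Cons[OF Cons.prems(3)[unfolded w(1)] False, THEN conjunct1]
          Fw_meet_Cons[OF Cons.prems(3)[unfolded w(1)] False, THEN conjunct2, THEN conjunct1]
          Fw_meet_Cons[OF Cons.prems(3)[unfolded w(1)] False, THEN conjunct2, THEN conjunct2, THEN conjunct1]
          Fw_meet_Cons[OF Cons.prems(3)[unfolded w(1)] False, THEN conjunct2, THEN conjunct2, THEN conjunct2])+
    have "normal_deriv q (\<lambda>x. u (F i x)) v a = normal_deriv q (\<lambda>x. u (F i x)) [] j"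
      using normal_deriv_replicate[OF has_laplacian_F[OF Cons.prems(1)], of i "length v" j]
      unfolding m(1)[symmetric] m(2) .
    moreover have "normal_deriv q (\<lambda>x. u (F j x)) w' b = normal_deriv q (\<lambda>x. u (F j x)) [] i"
      using normal_deriv_replicate[OF has_laplacian_F[OF Cons.prems(1)], of j "length w'" i]
      unfolding m(3)[symmetric] m(4) .
    ultimately show ?thesis
      using normal_deriv_cancel_midpoint[OF Cons.prems(1) False]
      unfolding w normal_deriv_Cons[OF Cons.prems(1)] by simp
  qed
qed

text \<open>Data are indexed by cell and corner instead of by point, because this form restricts
  directly to the three subcells.\<close>

definition consistent :: "nat \<Rightarrow> (3 list \<Rightarrow> 3 \<Rightarrow> real) \<Rightarrow> (3 list \<Rightarrow> 3 \<Rightarrow> real) \<Rightarrow> bool" where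
  "consistent m a b \<longleftrightarrow> (\<forall>v w i j. length v = m \<and> length w = m \<and> Fw v (q i) = Fw w (q j) \<longrightarrow>
     a v i = a w j \<and> ((v, i) \<noteq> (w, j) \<longrightarrow> b v i + b w j = 0))"

text \<open>Induction on the outermost letter: solve in the three subcells and glue; consistency
  provides matching values and cancelling derivatives at the midpoints. The scalar \<open>c\<close>
  in \<open>c * harm h\<close> absorbs the factor 5 of each gluing.\<close>

lemma ex_piecewise_biharmonic:
  assumes "consistent m a b"
  shows "\<exists>u f. has_laplacian q \<mu> u f \<and>
    (\<forall>w. length w = m \<longrightarrow> (\<forall>i. u (Fw w (q i)) = a w i \<and> normal_deriv q u w i = b w i) \<and>
      (\<exists>c h. AE x in \<mu>. f (Fw w x) = c * harm h x))"
  using assms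
proof (induction m arbitrary: a b)
  case 0
  define d where "d j = b [] j - (3 * a [] j - (\<Sum>k\<in>UNIV. a [] k))" for j
  \<comment> \<open>The second component is \<open>15 I - 4 J\<close>, the inverse of
    \<open>M\<close>, applied to \<open>d = b - D a\<close>.\<close>
  define s where "s = (a [], \<lambda>j. 15 * d j - 4 * (\<Sum>k\<in>UNIV. d k))"
  have "gram (snd s) j = d j" for j
    by (simp add: s_def gram_def sum_3_eq algebra_simps)
  then have "corner_deriv s j = b [] j" for j by (simp add: corner_deriv_def) (simp add: s_def d_def)
  then have "(\<forall>i. biharm s (Fw w (q i)) = a w i \<and> normal_deriv q (biharm s) w i = b w i) \<and>
      (\<exists>c h. AE x in \<mu>. harm (snd s) (Fw w x) = c * harm h x)" if "length w = 0" for w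
    using that by (auto simp: normal_deriv_biharm biharm_q intro!: exI[of _ 1] exI[of _ "snd s"]) (simp add: s_def)
  then show ?case using has_laplacian_biharm by blast
next
  case (Suc m)
  define a' where "a' i w = a (i # w)" for i w
  \<comment> \<open>The factor 3/5 cancels the 5/3 that \<open>normal_deriv_Cons\<close> brings in
    when a letter is put in front.\<close>
  define b' where "b' i w k = 3 / 5 * b (i # w) k" for i w k
  have cons: "a v i = a w j" "(v, i) \<noteq> (w, j) \<Longrightarrow> b v i + b w j = 0"
    if "length v = Suc m" "length w = Suc m" "Fw v (q i) = Fw w (q j)" for v w i j
    using Suc.prems that unfolding consistent_def by blast+
  have "consistent m (a' i) (b' i)" for i
    unfolding consistent_def a'_def b'_def
  proof (intro allI impI)
    fix v w k l assume *: "length v = m \<and> length w = m \<and> Fw v (q k) = Fw w (q l)"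
    then have **: "length (i # v) = Suc m" "length (i # w) = Suc m" "Fw (i # v) (q k) = Fw (i # w) (q l)" by auto
    then show "a (i # v) k = a (i # w) l \<and> ((v, k) \<noteq> (w, l) \<longrightarrow> 3 / 5 * b (i # v) k + 3 / 5 * b (i # w) l = 0)"
      using cons[OF **] by (auto simp flip: distrib_left)
  qed
  then have IH: "\<exists>u f. has_laplacian q \<mu> u f \<and>
    (\<forall>w. length w = m \<longrightarrow> (\<forall>k. u (Fw w (q k)) = a' i w k \<and> normal_deriv q u w k = b' i w k) \<and>
      (\<exists>c h. AE x in \<mu>. f (Fw w x) = c * harm h x))" for i by (rule Suc.IH)
  define Q where "Q i u f \<longleftrightarrow> has_laplacian q \<mu> u f \<and>
    (\<forall>w. length w = m \<longrightarrow> (\<forall>k. u (Fw w (q k)) = a' i w k \<and> normal_deriv q u w k = b' i w k) \<and>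
      (\<exists>c h. AE x in \<mu>. f (Fw w x) = c * harm h x))" for i u f
  have "\<exists>u f. Q i u f" for i unfolding Q_def by (rule IH)
  then obtain U f where "\<And>i. Q i (U i) (f i)" by metis
  then have U: "\<And>i. has_laplacian q \<mu> (U i) (f i)"
    "\<And>i w k. length w = m \<Longrightarrow> U i (Fw w (q k)) = a' i w k"
    "\<And>i w k. length w = m \<Longrightarrow> normal_deriv q (U i) w k = b' i w k"
    "\<And>i w. length w = m \<Longrightarrow> \<exists>c h. AE x in \<mu>. f i (Fw w x) = c * harm h x"
    unfolding Q_def by blast+
  have mid: "Fw (i # replicate m j) (q j) = Fw (j # replicate m i) (q i)" for i j
    by (simp add: Fw_replicate_q F_swap)
  have Uq: "U i (q j) = a (i # replicate m j) j" for i j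
    using U(2)[of "replicate m j" i j] by (simp add: Fw_replicate_q a'_def)
  have Ud: "normal_deriv q (U i) [] j = 3 / 5 * b (i # replicate m j) j" for i j
    using U(3)[of "replicate m j" i j] normal_deriv_replicate[OF U(1), of i m j] by (simp add: b'_def)
  have match: "U i (q j) = U j (q i)" for i j
    unfolding Uq by (rule cons(1)[OF _ _ mid]) simp_all
  have glueF: "glue U (F i x) = U i x" if "x \<in> K" for i x by (rule glue_F[where g = U, OF match that])
  have lapF: "has_laplacian q \<mu> (\<lambda>x. glue U (F i x)) (f i)" for i
    by (rule has_laplacian_cong[OF U(1) glueF])
  have ndF: "normal_deriv q (\<lambda>x. glue U (F i x)) w k = normal_deriv q (U i) w k" for i w k
    by (rule normal_deriv_cong) (rule glueF)
  let ?f = "glue (\<lambda>i x. 5 * f i x)"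
  have lap: "has_laplacian q \<mu> (glue U) ?f"
  proof (rule has_laplacian_glue[OF lapF])
    fix i j :: 3 assume "i \<noteq> j"
    then have "b (i # replicate m j) j + b (j # replicate m i) i = 0" by (intro cons(2)[OF _ _ mid]) simp_all
    then show "normal_deriv q (\<lambda>x. glue U (F i x)) [] j + normal_deriv q (\<lambda>x. glue U (F j x)) [] i = 0"
      by (simp add: ndF Ud flip: distrib_left)
  qed
  have "(\<forall>k. glue U (Fw w (q k)) = a w k \<and> normal_deriv q (glue U) w k = b w k) \<and>
      (\<exists>c h. AE x in \<mu>. ?f (Fw w x) = c * harm h x)" if w: "length w = Suc m" for w
  proof -
    obtain i v where v: "w = i # v" "length v = m" using w by (auto simp: length_Suc_conv)
    obtain c h where ch: "AE x in \<mu>. f i (Fw v x) = c * harm h x" using U(4)[OF v(2)] by blast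
    have "AE x in \<mu>. ?f (F i (Fw v x)) = 5 * f i (Fw v x)" by (rule AE_Fw[OF AE_glue])
    with ch have "AE x in \<mu>. ?f (Fw w x) = (5 * c) * harm h x" by eventually_elim (simp add: v)
    moreover have "glue U (Fw w (q k)) = a w k" for k using U(2)[OF v(2)] by (simp add: v glueF a'_def)
    moreover have "normal_deriv q (glue U) w k = b w k" for k
      using U(3)[OF v(2), of i k] by (simp add: v normal_deriv_Cons[OF lap] ndF b'_def)
    ultimately show ?thesis by blast
  qed
  then show ?case using lap by blast
qed

text \<open>On each cell the energy form of \<open>z\<close> with a harmonic function sees only the
  corner values of \<open>z\<close>, and the boundary term of Gauss-Green only its normal
  derivatives. Both vanish, which leaves the integral.\<close>

lemma piecewise_harmonic_orthogonal:
  assumes "has_laplacian q \<mu> z e" "f \<in> L2_fun \<mu>"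
    and harm: "\<And>w. length w = m \<Longrightarrow> \<exists>c h. AE x in \<mu>. f (Fw w x) = c * harm h x"
    and zero: "\<And>w i. length w = m \<Longrightarrow> z (Fw w (q i)) = 0" "\<And>w i. length w = m \<Longrightarrow> normal_deriv q z w i = 0"
  shows "(\<integral>x. e x * f x \<partial>\<mu>) = 0"
proof -
  note d = has_laplacianD[OF assms(1)]
  have cell: "(\<integral>x. e (Fw w x) * f (Fw w x) \<partial>\<mu>) = 0" if w: "length w = m" for w
  proof -
    obtain c h where ch: "AE x in \<mu>. f (Fw w x) = c * harm h x" using harm[OF w] by blast
    let ?z = "\<lambda>x. z (Fw w x)"
    note lap = has_laplacian_Fw[OF assms(1), of w]
    have "normal_deriv q ?z [] i = 0" for i
      using normal_deriv_Fw[OF assms(1), of w "[]" i] zero(2)[OF w, of i] by simp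
    moreover have "energy_form q ?z (harm h) = 0"
      using energy_form_sym[OF has_laplacianD(1)[OF lap] harm_in_dom] energy_form_harm[OF has_laplacianD(1)[OF lap]]
        zero(1)[OF w] by simp
    ultimately have "(\<integral>x. e (Fw w x) / 5 ^ length w * harm h x \<partial>\<mu>) = 0"
      using gauss_green[OF lap harm_in_dom, of h] by simp
    then have i: "(\<integral>x. e (Fw w x) * harm h x \<partial>\<mu>) = 0" by simp
    have [measurable]: "e \<in> borel_measurable \<mu>" "f \<in> borel_measurable \<mu>" "harm h \<in> borel_measurable \<mu>"
      using d assms(2) by (auto simp: L2_fun_def intro: measurable_continuous continuous_harm)
    have "(\<integral>x. e (Fw w x) * f (Fw w x) \<partial>\<mu>) = (\<integral>x. c * (e (Fw w x) * harm h x) \<partial>\<mu>)"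
    proof (rule integral_cong_AE)
      show "AE x in \<mu>. e (Fw w x) * f (Fw w x) = c * (e (Fw w x) * harm h x)"
        using ch by eventually_elim simp
    qed measurable
    then show ?thesis using i by simp
  qed
  have "integrable \<mu> (\<lambda>x. e x * f x)" by (rule L2_mult[OF d(2) assms(2)])
  then show ?thesis by (subst integral_self_similar_words[of _ m]) (simp_all add: cell)
qed

lemma piecewise_biharmonic_energy:
  assumes lap: "has_laplacian q \<mu> u f"
    and harm: "\<And>w. length w = m \<Longrightarrow> \<exists>c h. AE x in \<mu>. f (Fw w x) = c * harm h x"
  shows "(\<integral>x. (f x)\<^sup>2 \<partial>\<mu>) = (25 / 3) ^ m * (\<Sum>w\<in>{w. length w = m}.
     Theta (\<lambda>i. u (Fw w (q i))) (\<lambda>i. (3 / 5) ^ m * normal_deriv q u w i))"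
proof -
  note d = has_laplacianD[OF lap]
  have cell: "(\<integral>x. (f (Fw w x))\<^sup>2 \<partial>\<mu>) = 25 ^ m * Theta (\<lambda>i. u (Fw w (q i))) (\<lambda>i. (3 / 5) ^ m * normal_deriv q u w i)"
    if w: "length w = m" for w
  proof -
    obtain c h where ch: "AE x in \<mu>. f (Fw w x) = c * harm h x" using harm[OF w] by blast
    note lapw = has_laplacian_Fw[OF lap, of w]
    define a where "a i = u (Fw w (q i))" for i
    define b where "b i = (3 / 5) ^ m * normal_deriv q u w i" for i
    have [measurable]: "f \<in> borel_measurable \<mu>" "harm g \<in> borel_measurable \<mu>" for g
      using d by (auto intro: measurable_continuous continuous_harm)
    \<comment> \<open>Gauss-Green on the rescaled cell, tested with \<open>harm (unit i)\<close>,
      reads \<open>b = D a + M f\<close> with \<open>f = c / 5 ^ m\<close> times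
      \<open>h\<close>.\<close>
    have b: "b i = 3 * a i - (\<Sum>k\<in>UNIV. a k) + c / 5 ^ m * gram h i" for i
    proof -
      have "b i = normal_deriv q (\<lambda>x. u (Fw w x)) [] i"
        using normal_deriv_Fw[OF lap, of w "[]" i] w by (simp add: b_def flip: power_mult_distrib)
      moreover have "(\<integral>x. f (Fw w x) / 5 ^ m * harm (unit i) x \<partial>\<mu>) = (\<integral>x. c / 5 ^ m * (harm h x * harm (unit i) x) \<partial>\<mu>)"
      proof (rule integral_cong_AE)
        show "AE x in \<mu>. f (Fw w x) / 5 ^ m * harm (unit i) x = c / 5 ^ m * (harm h x * harm (unit i) x)"
          using ch by eventually_elim simp
      qed measurable
      moreover have "(\<Sum>j\<in>UNIV. gram h j * unit i j) = gram h i" "(\<Sum>j\<in>UNIV. g j * unit i j) = g i" for g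
        by (cases i rule: cases_3; simp add: unit_def sum_3_eq)+
      moreover have "energy_form q (\<lambda>x. u (Fw w x)) (harm (unit i)) = 3 * a i - (\<Sum>k\<in>UNIV. a k)"
        using energy_form_sym[OF has_laplacianD(1)[OF lapw] harm_in_dom, of "unit i"]
          energy_form_harm[OF has_laplacianD(1)[OF lapw], of "unit i"]
        by (cases i rule: cases_3) (simp_all add: unit_def sum_3_eq a_def)
      ultimately show ?thesis
        using gauss_green[OF lapw harm_in_dom, of "unit i"] w by (simp add: harm_q integral_harm_harm)
    qed
    have "(\<integral>x. (f (Fw w x))\<^sup>2 \<partial>\<mu>) = (\<integral>x. c\<^sup>2 * (harm h x * harm h x) \<partial>\<mu>)"
    proof (rule integral_cong_AE)
      show "AE x in \<mu>. (f (Fw w x))\<^sup>2 = c\<^sup>2 * (harm h x * harm h x)"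
        using ch by eventually_elim (simp add: power2_eq_square)
    qed measurable
    also have "\<dots> = c\<^sup>2 * (\<Sum>j\<in>UNIV. gram h j * h j)" by (simp add: integral_harm_harm)
    \<comment> \<open>This is \<open>h = (15 I - 4 J) (M h)\<close>, paired with
      \<open>M h\<close>.\<close>
    also have "(\<Sum>j\<in>UNIV. gram h j * h j) = 15 * (\<Sum>j\<in>UNIV. (gram h j)\<^sup>2) - 4 * (\<Sum>j\<in>UNIV. gram h j)\<^sup>2"
      unfolding sum_3_eq gram_def power2_eq_square by argo
    \<comment> \<open>By \<open>b\<close>, the vector \<open>d = D a - b\<close> is minus
      \<open>c / 5 ^ m\<close> times \<open>gram h\<close>; this explains the sign, and squaring
      explains the power of 25.\<close>
    also have "c\<^sup>2 * \<dots> = 25 ^ m * (15 * (\<Sum>j\<in>UNIV. (- (c / 5 ^ m * gram h j))\<^sup>2) - 4 * (\<Sum>j\<in>UNIV. - (c / 5 ^ m * gram h j))\<^sup>2)"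
    proof -
      define t where "t = c / 5 ^ m"
      have "c\<^sup>2 = 25 ^ m * t\<^sup>2" unfolding t_def
        by (simp add: power_divide power_mult[symmetric] mult.commute[of m 2]) (simp add: power_mult)
      then show ?thesis by (simp add: t_def[symmetric] sum_3_eq power2_eq_square algebra_simps)
    qed
    also have "\<dots> = 25 ^ m * Theta a b"
      unfolding Theta_eq by (simp add: b)
    finally show ?thesis by (simp add: a_def[abs_def] b_def[abs_def])
  qed
  show ?thesis
    unfolding integral_self_similar_words[OF d(5), of m]
    by (simp add: cell power_divide flip: sum_distrib_left)
qed

subsection \<open>Minimizers\<close>

lemma laplacian_energy_eq:
  assumes "has_laplacian q \<mu> u f" shows "laplacian_energy q \<mu> u = (\<integral>x. (f x)\<^sup>2 \<partial>\<mu>)"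
proof -
  have lap: "has_laplacian q \<mu> u (laplacian q \<mu> u)"
    unfolding laplacian_def by (rule someI[of "has_laplacian q \<mu> u", OF assms])
  have [measurable]: "f \<in> borel_measurable \<mu>" "laplacian q \<mu> u \<in> borel_measurable \<mu>"
    using has_laplacianD(4)[OF assms] has_laplacianD(4)[OF lap] .
  have "AE x in \<mu>. laplacian q \<mu> u x = f x" by (rule has_laplacian_unique[OF lap assms])
  then have "AE x in \<mu>. \<bar>laplacian q \<mu> u x\<bar>\<^sup>2 = (f x)\<^sup>2" by eventually_elim simp
  then show ?thesis unfolding laplacian_energy_def by (intro integral_cong_AE) measurable
qed

lemma ex_interpolant:
  assumes "cell_choice q m c"
  obtains u f where "has_laplacian q \<mu> u f" "u \<in> interpolants q \<mu> m c \<alpha> \<beta>"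
    "\<And>w. length w = m \<Longrightarrow> \<exists>c h. AE x in \<mu>. f (Fw w x) = c * harm h x"
proof -
  define a where "a w i = \<alpha> (Fw w (q i))" for w i
  \<comment> \<open>\<open>\<beta>\<close> is prescribed in the chosen cell; at its other address,
    if there is one, the point must carry the opposite value.\<close>
  define b where "b w i = (if c (Fw w (q i)) = (w, i) then \<beta> (Fw w (q i)) else - \<beta> (Fw w (q i)))" for w i
  have c: "length (fst (c x)) = m" "Fw (fst (c x)) (q (snd (c x))) = x" if "x \<in> sgV q m" for x
    using assms that unfolding cell_choice_def by blast+
  have "consistent m a b"
    unfolding consistent_def
  proof (intro allI impI conjI; elim conjE)
    fix v w i j assume *: "length v = m" "length w = m" "Fw v (q i) = Fw w (q j)"
    show "a v i = a w j" by (simp add: a_def *)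
    assume ne: "(v, i) \<noteq> (w, j)"
    define x where "x = Fw v (q i)"
    have x: "x \<in> sgV q m" unfolding sgV_eq x_def using *(1) by blast
    \<comment> \<open>A point has at most two addresses, so of two different ones exactly one is the
      chosen one, and the signs in \<open>b\<close> are opposite.\<close>
    have "(v, i) = (w, j) \<or> (v, i) = (fst (c x), snd (c x)) \<or> (w, j) = (fst (c x), snd (c x))"
      by (rule at_most_two_addresses[of _ m]) (use * c[OF x] in \<open>auto simp: x_def\<close>)
    then have "c x = (v, i) \<or> c x = (w, j)" using ne by (metis prod.collapse)
    moreover have "b v i = (if c x = (v, i) then \<beta> x else - \<beta> x)" by (simp only: b_def x_def)
    moreover have "b w j = (if c x = (w, j) then \<beta> x else - \<beta> x)" by (simp only: b_def x_def *(3))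
    ultimately show "b v i + b w j = 0" using ne by auto
  qed
  from ex_piecewise_biharmonic[OF this] obtain u f where u: "has_laplacian q \<mu> u f"
    "\<And>w i. length w = m \<Longrightarrow> u (Fw w (q i)) = a w i"
    "\<And>w i. length w = m \<Longrightarrow> normal_deriv q u w i = b w i"
    "\<And>w. length w = m \<Longrightarrow> \<exists>c h. AE x in \<mu>. f (Fw w x) = c * harm h x"
    by blast
  have "u x = \<alpha> x \<and> normal_deriv q u (fst (c x)) (snd (c x)) = \<beta> x" if x: "x \<in> sgV q m" for x
    using u(2,3)[OF c(1)[OF x], of "snd (c x)"] by (simp add: c(2)[OF x] a_def b_def)
  then have "u \<in> interpolants q \<mu> m c \<alpha> \<beta>"
    using u(1) unfolding interpolants_def dom_L2_laplacian_def by blast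
  then show thesis using that u(1,4) by blast
qed

text \<open>The data fix the normal derivative only in the chosen cell;
  \<open>normal_deriv_cancel\<close> carries it to the other cell at the same point.\<close>

lemma interpolants_diff_zero:
  assumes "cell_choice q m c" "u \<in> interpolants q \<mu> m c \<alpha> \<beta>" "v \<in> interpolants q \<mu> m c \<alpha> \<beta>"
    and "has_laplacian q \<mu> u f" "has_laplacian q \<mu> v g" "length w = m"
  shows "u (Fw w (q i)) - v (Fw w (q i)) = 0" "normal_deriv q (\<lambda>x. u x - v x) w i = 0"
proof -
  define x where "x = Fw w (q i)"
  have x: "x \<in> sgV q m" unfolding sgV_eq x_def using assms(6) by blast
  have c: "length (fst (c x)) = m" "Fw (fst (c x)) (q (snd (c x))) = x"
    using assms(1) x unfolding cell_choice_def by blast+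
  have *: "u x = \<alpha> x" "v x = \<alpha> x" "normal_deriv q u (fst (c x)) (snd (c x)) = \<beta> x"
    "normal_deriv q v (fst (c x)) (snd (c x)) = \<beta> x"
    using assms(2,3) x unfolding interpolants_def by auto
  show "u (Fw w (q i)) - v (Fw w (q i)) = 0" using * by (simp add: x_def)
  have "normal_deriv q u w i = normal_deriv q v w i"
  proof (cases "c x = (w, i)")
    case True
    then show ?thesis using * by simp
  next
    case False
    then have ne: "(w, i) \<noteq> (fst (c x), snd (c x))" by (metis prod.collapse)
    have "normal_deriv q u w i + normal_deriv q u (fst (c x)) (snd (c x)) = 0"
      by (rule normal_deriv_cancel[OF assms(4) _ _ ne]) (simp_all add: c assms(6) x_def[symmetric])
    moreover have "normal_deriv q v w i + normal_deriv q v (fst (c x)) (snd (c x)) = 0"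
      by (rule normal_deriv_cancel[OF assms(5) _ _ ne]) (simp_all add: c assms(6) x_def[symmetric])
    ultimately show ?thesis using * by simp
  qed
  then show "normal_deriv q (\<lambda>x. u x - v x) w i = 0" by (simp add: normal_deriv_diff[OF assms(4,5)])
qed

lemma interpolant_energy_split:
  assumes "cell_choice q m c" "u \<in> interpolants q \<mu> m c \<alpha> \<beta>" "v \<in> interpolants q \<mu> m c \<alpha> \<beta>"
    and u: "has_laplacian q \<mu> u f" and v: "has_laplacian q \<mu> v g"
    and harm: "\<And>w. length w = m \<Longrightarrow> \<exists>c h. AE x in \<mu>. f (Fw w x) = c * harm h x"
  shows "(\<integral>x. (g x)\<^sup>2 \<partial>\<mu>) = (\<integral>x. (f x)\<^sup>2 \<partial>\<mu>) + (\<integral>x. (g x - f x)\<^sup>2 \<partial>\<mu>)"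
proof -
  note d = has_laplacianD[OF u] has_laplacianD[OF v]
  have orth: "(\<integral>x. (g x - f x) * f x \<partial>\<mu>) = 0"
  proof (rule piecewise_harmonic_orthogonal[OF has_laplacian_diff[OF v u] d(2) harm])
    show "v (Fw w (q i)) - u (Fw w (q i)) = 0" "normal_deriv q (\<lambda>x. v x - u x) w i = 0" if "length w = m" for w i
      using interpolants_diff_zero[OF assms(1,3,2) v u that] .
  qed
  have int: "integrable \<mu> (\<lambda>x. (g x - f x)\<^sup>2)" "integrable \<mu> (\<lambda>x. (f x)\<^sup>2)" "integrable \<mu> (\<lambda>x. (g x - f x) * f x)"
    using has_laplacianD(5)[OF has_laplacian_diff[OF v u]] d(5)
      L2_mult[OF has_laplacianD(2)[OF has_laplacian_diff[OF v u]] d(2)] by auto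
  have "(\<integral>x. (g x)\<^sup>2 \<partial>\<mu>) = (\<integral>x. (f x)\<^sup>2 + (g x - f x)\<^sup>2 + 2 * ((g x - f x) * f x) \<partial>\<mu>)"
    by (intro Bochner_Integration.integral_cong refl) (simp add: power2_eq_square algebra_simps)
  also have "\<dots> = (\<integral>x. (f x)\<^sup>2 \<partial>\<mu>) + (\<integral>x. (g x - f x)\<^sup>2 \<partial>\<mu>)"
    using int orth by simp
  finally show ?thesis .
qed

text \<open>By the energy splitting, equality of energies forces equal Laplacians almost everywhere.
  The difference then has Laplacian zero and vanishes at the three corners, so its energy is
  zero.\<close>

lemma minimizer_unique:
  assumes cc: "cell_choice q m c" and u: "has_laplacian q \<mu> u f" "u \<in> interpolants q \<mu> m c \<alpha> \<beta>"
    and harm: "\<And>w. length w = m \<Longrightarrow> \<exists>c h. AE x in \<mu>. f (Fw w x) = c * harm h x"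
  shows "is_minimizer q \<mu> m c \<alpha> \<beta> u"
    and "is_minimizer q \<mu> m c \<alpha> \<beta> v \<Longrightarrow> x \<in> K \<Longrightarrow> v x = u x"
proof -
  have split: "laplacian_energy q \<mu> v = laplacian_energy q \<mu> u + (\<integral>x. (g x - f x)\<^sup>2 \<partial>\<mu>)"
    if "v \<in> interpolants q \<mu> m c \<alpha> \<beta>" "has_laplacian q \<mu> v g" for v g
    using interpolant_energy_split[OF cc u(2) that(1) u(1) that(2) harm]
    by (simp add: laplacian_energy_eq[OF u(1)] laplacian_energy_eq[OF that(2)])
  show "is_minimizer q \<mu> m c \<alpha> \<beta> u"
    unfolding is_minimizer_def
  proof (intro conjI ballI u(2))
    fix v assume v: "v \<in> interpolants q \<mu> m c \<alpha> \<beta>"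
    then obtain g where "has_laplacian q \<mu> v g" unfolding interpolants_def dom_L2_laplacian_def by blast
    from split[OF v this] show "laplacian_energy q \<mu> u \<le> laplacian_energy q \<mu> v" by simp
  qed
  assume min: "is_minimizer q \<mu> m c \<alpha> \<beta> v" and x: "x \<in> K"
  then have v: "v \<in> interpolants q \<mu> m c \<alpha> \<beta>" and le: "laplacian_energy q \<mu> v \<le> laplacian_energy q \<mu> u"
    using u(2) unfolding is_minimizer_def by blast+
  obtain g where g: "has_laplacian q \<mu> v g" using v unfolding interpolants_def dom_L2_laplacian_def by blast
  note lap = has_laplacian_diff[OF g u(1)]
  have "(\<integral>x. (g x - f x)\<^sup>2 \<partial>\<mu>) \<le> 0" using split[OF v g] le by simp
  moreover have "(\<integral>x. (g x - f x)\<^sup>2 \<partial>\<mu>) \<ge> 0" by simp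
  ultimately have "(\<integral>x. (g x - f x)\<^sup>2 \<partial>\<mu>) = 0" by (rule antisym)
  then have "AE x in \<mu>. (g x - f x)\<^sup>2 = 0"
    using integral_nonneg_eq_0_iff_AE[of \<mu> "\<lambda>x. (g x - f x)\<^sup>2"] has_laplacianD(5)[OF lap] by simp
  then have ae: "AE x in \<mu>. g x - f x = 0" by simp
  \<comment> \<open>The corner \<open>q i\<close> is also a corner of the cell of level
    \<open>m\<close> with the constant word, so its value is prescribed.\<close>
  have "v (q i) - u (q i) = 0" for i
    using interpolants_diff_zero(1)[OF cc v u(2) g u(1), of "replicate m i" i] by (simp add: Fw_replicate_q)
  then have "v x - u x = 0" by (intro laplacian_zero_imp_zero[OF lap ae _ x])
  then show "v x = u x" by simp
qed

end

theorem mainTheorem8: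
  fixes q :: "3 \<Rightarrow> real ^ 2" and \<mu> :: "(real ^ 2) measure" and m :: nat
    and c :: "real ^ 2 \<Rightarrow> 3 list \<times> 3" and \<alpha> \<beta> :: "real ^ 2 \<Rightarrow> real"
  assumes "equilateral q"
    and "self_similar_measure q \<mu>"
    and "cell_choice q m c"
  shows "(\<forall>a b. Theta a b =
            90 * (\<Sum>i\<in>UNIV. (a i)\<^sup>2) + 30 * (\<Sum>(i, j)\<in>{(i, j). i \<noteq> j}. a i * b j)
            + 11 * (\<Sum>i\<in>UNIV. (b i)\<^sup>2) - 90 * (\<Sum>(i, j)\<in>{(i, j). i < j}. a i * a j)
            - 60 * (\<Sum>i\<in>UNIV. a i * b i) - 8 * (\<Sum>(i, j)\<in>{(i, j). i < j}. b i * b j))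
    \<and> (\<exists>u. is_minimizer q \<mu> m c \<alpha> \<beta> u \<and>
            (\<forall>u'. is_minimizer q \<mu> m c \<alpha> \<beta> u' \<longrightarrow> (\<forall>x\<in>SG q. u' x = u x)))
    \<and> (\<forall>u. is_minimizer q \<mu> m c \<alpha> \<beta> u \<longrightarrow>
            (\<integral>x. \<bar>laplacian q \<mu> u x\<bar>\<^sup>2 \<partial>\<mu>) =
            (25 / 3) ^ m * (\<Sum>w\<in>{w. length w = m}.
               Theta (\<lambda>i. u (sgFw q w (q i))) (\<lambda>i. (3 / 5) ^ m * normal_deriv q u w i)))"
proof -
  interpret gasket_measure q \<mu>
    by unfold_locales (rule assms)+
  obtain u0 f where u0: "has_laplacian q \<mu> u0 f" "u0 \<in> interpolants q \<mu> m c \<alpha> \<beta>"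
    "\<And>w. length w = m \<Longrightarrow> \<exists>c h. AE x in \<mu>. f (sgFw q w x) = c * harm h x"
    using ex_interpolant[OF assms(3)] by blast
  note min = minimizer_unique[OF assms(3) u0]
  have "(\<integral>x. \<bar>laplacian q \<mu> u x\<bar>\<^sup>2 \<partial>\<mu>) =
            (25 / 3) ^ m * (\<Sum>w\<in>{w. length w = m}.
               Theta (\<lambda>i. u (sgFw q w (q i))) (\<lambda>i. (3 / 5) ^ m * normal_deriv q u w i))"
    if "is_minimizer q \<mu> m c \<alpha> \<beta> u" for u
  proof -
    \<comment> \<open>An arbitrary minimizer agrees with \<open>u0\<close> on the gasket, hence
      inherits its Laplacian \<open>f\<close>, which is a multiple of a harmonic function on every
      cell of level \<open>m\<close>.\<close>
    have lap: "has_laplacian q \<mu> u f"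
      by (rule has_laplacian_cong[OF u0(1)]) (rule min(2)[OF _ that])
    show ?thesis
      using laplacian_energy_eq[OF lap] piecewise_biharmonic_energy[OF lap u0(3)]
      by (simp add: laplacian_energy_def)
  qed
  then show ?thesis using Theta_expand min by blast
qed

end
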